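(* Let $r\in[1,2]$ and $p\in(0,r)$. Then $M_p(B_2^n,d_r)$ behaves asymptotically as $n^{p/r}$; that is, there exist constants $A,B>0$ (depending on $p$ and $r$ but not on $n$) such that for every $n\in\mathbb N$ $$A\,n^{p/r}\le M_p(B_2^n,d_r)\le B\,n^{p/r}.$$
   Context: $B_2^n$ is the closed Euclidean unit ball of $\mathbb R^n$ and $d_r(x,y)=\|x-y\|_r$, with $\|x\|_r=(\sum_i|x_i|^r)^{1/r}$. For a compact set $K\subset\mathbb R^n$, $\mathfrak M^1(K)$ is the set of finite signed Borel measures $\mu$ on $K$ with $\mu(K)=1$, and $M_p(K,d_r)=\sup\{\int_K\int_K\|x-y\|_r^p\,d\mu(x)d\mu(y):\mu\in\mathfrak M^1(K)\}$. *)

theory Defs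
  imports "HOL-Analysis.Analysis"
begin

text \<open>
  The dimension \<open>n\<close> has to vary inside a single formula, so \<open>\<real>\<^sup>n\<close> is represented by the extensional
  functions on \<open>{..<n}\<close>; the finite product \<open>\<sigma>\<close>-algebra is its Borel \<open>\<sigma>\<close>-algebra.
\<close>

definition Rn :: "nat \<Rightarrow> (nat \<Rightarrow> real) measure" where
  "Rn n = Pi\<^sub>M {..<n} (\<lambda>_. borel)"

definition lr_norm :: "nat \<Rightarrow> real \<Rightarrow> (nat \<Rightarrow> real) \<Rightarrow> real" where
  "lr_norm n r x = (\<Sum>i<n. \<bar>x i\<bar> powr r) powr (1 / r)"

definition lr_dist :: "nat \<Rightarrow> real \<Rightarrow> (nat \<Rightarrow> real) \<Rightarrow> (nat \<Rightarrow> real) \<Rightarrow> real" where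
  "lr_dist n r x y = lr_norm n r (\<lambda>i. x i - y i)"

definition euclidean_unit_ball :: "nat \<Rightarrow> (nat \<Rightarrow> real) set" where
  "euclidean_unit_ball n = {x \<in> space (Rn n). L2_set x {..<n} \<le> 1}"

text \<open>
  In the following, a value of type \<^typ>\<open>'a measure\<close> called \<open>M\<close> only serves to carry a measurable space.
  Finiteness of a signed measure is built in, since its values are real numbers.
\<close>

definition finite_signed_measure :: "'a measure \<Rightarrow> ('a set \<Rightarrow> real) \<Rightarrow> bool" where
  "finite_signed_measure M \<mu> \<longleftrightarrow>
     \<mu> {} = 0 \<and>
     (\<forall>F :: nat \<Rightarrow> 'a set. range F \<subseteq> sets M \<longrightarrow> disjoint_family F \<longrightarrow>
        (\<lambda>i. \<mu> (F i)) sums \<mu> (\<Union>i. F i))"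

text \<open>
  The positive part of the Jordan decomposition, \<open>\<mu>\<^sup>+(A) = sup {\<mu>(B) | B \<subseteq> A measurable}\<close>.
  The truncation of negative numbers by \<^const>\<open>ennreal\<close> is harmless because \<open>B = {}\<close> contributes \<open>0\<close>.
  The negative part is the positive part of \<open>-\<mu>\<close>.
\<close>

definition positive_variation :: "'a measure \<Rightarrow> ('a set \<Rightarrow> real) \<Rightarrow> 'a measure" where
  "positive_variation M \<mu> =
     measure_of (space M) (sets M) (\<lambda>A. SUP B \<in> {B \<in> sets M. B \<subseteq> A}. ennreal (\<mu> B))"

definition negative_variation :: "'a measure \<Rightarrow> ('a set \<Rightarrow> real) \<Rightarrow> 'a measure" where
  "negative_variation M \<mu> = positive_variation M (\<lambda>A. - \<mu> A)"

definition signed_integral :: "'a measure \<Rightarrow> ('a set \<Rightarrow> real) \<Rightarrow> ('a \<Rightarrow> real) \<Rightarrow> real" where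
  "signed_integral M \<mu> f =
     (\<integral>x. f x \<partial>positive_variation M \<mu>) - (\<integral>x. f x \<partial>negative_variation M \<mu>)"

definition signed_measures_mass_one :: "nat \<Rightarrow> (nat \<Rightarrow> real) set \<Rightarrow> ((nat \<Rightarrow> real) set \<Rightarrow> real) set" where
  "signed_measures_mass_one n K =
     {\<mu>. finite_signed_measure (restrict_space (Rn n) K) \<mu> \<and> \<mu> K = 1}"

definition energy ::
  "nat \<Rightarrow> (nat \<Rightarrow> real) set \<Rightarrow> ((nat \<Rightarrow> real) \<Rightarrow> (nat \<Rightarrow> real) \<Rightarrow> real) \<Rightarrow> real
    \<Rightarrow> ((nat \<Rightarrow> real) set \<Rightarrow> real) \<Rightarrow> real" where
  "energy n K d p \<mu> =
     signed_integral (restrict_space (Rn n) K) \<mu>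
       (\<lambda>y. signed_integral (restrict_space (Rn n) K) \<mu> (\<lambda>x. d x y powr p))"

text \<open>
  The supremum is taken in \<^typ>\<open>ereal\<close>, so that an upper bound on it is not affected by the
  arbitrary value of the real supremum of an unbounded set.
\<close>

definition max_energy ::
  "real \<Rightarrow> nat \<Rightarrow> (nat \<Rightarrow> real) set \<Rightarrow> ((nat \<Rightarrow> real) \<Rightarrow> (nat \<Rightarrow> real) \<Rightarrow> real) \<Rightarrow> ereal" where
  "max_energy p n K d = (SUP \<mu> \<in> signed_measures_mass_one n K. ereal (energy n K d p \<mu>))"

end

theory Submission
  imports Defs "HOL-Probability.Probability" "HOL-Real_Asymp.Real_Asymp"
begin

text \<open>
  Upper bound. Call a kernel positive definite if its discrete energies are nonnegative. If
  \<open>C - d\<^sup>p\<close> is positive definite on the ball, then sampling points from a signed measure of mass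
  one shows that its energy is at most \<open>C\<close>. On an interval \<open>[-R, R]\<close> the kernel
  \<open>C\<^sub>q R\<^sup>q - \<bar>s - t\<bar>\<^sup>q\<close> is positive definite for \<open>0 < q < 2\<close>. For \<open>r < 2\<close>, summing it over the
  coordinates with \<open>q = r\<close> gives the constant \<open>n C\<^sub>r\<close> for \<open>d\<^sub>r\<^sup>r\<close>, and the binomial series of
  \<open>(1 - u)\<^sup>p\<^sup>/\<^sup>r\<close>, whose nonconstant coefficients are negative, yields \<open>(n C\<^sub>r)\<^sup>p\<^sup>/\<^sup>r\<close> for \<open>d\<^sub>r\<^sup>p\<close>.
  For \<open>r = 2\<close>, average the kernel with \<open>q = p\<close> over the projections onto a Gaussian vector \<open>g\<close>,
  with \<open>R = \<bar>g\<bar>\<close> of order \<open>\<surd>n\<close>.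

  Lower bound. Take \<open>\<mu> = \<Sum>\<^sub>j \<tau>\<^sub>j N(0, \<sigma>\<^sub>j\<^sup>2 I)\<close> with \<open>\<tau>\<^sub>j\<close> the coefficients of the Chebyshev
  polynomial \<open>T\<^sub>n\<close> and \<open>\<sigma>\<^sub>j\<^sup>2 = (j + 1) / (16 v n\<^sup>2)\<close>. Differences of Gaussians are Gaussian, so the
  energy is \<open>E \<bar>G\<bar>\<^sub>r\<^sup>p \<sim> n\<^sup>p\<^sup>/\<^sup>r\<close> times \<open>(16 v n\<^sup>2)\<^sup>-\<^sup>p\<^sup>/\<^sup>2 \<Sum> \<tau>\<^sub>j \<tau>\<^sub>k (j + k + 2)\<^sup>p\<^sup>/\<^sup>2\<close>, and the last
  sum is of order \<open>n\<^sup>p\<close> because \<open>T\<^sub>n\<close> is bounded by \<open>1\<close> on \<open>[0, 1]\<close> but leaves the value \<open>1\<close> at distance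
  \<open>n\<^sup>-\<^sup>2\<close> from \<open>1\<close>. Moving the mass outside the ball to the origin costs an error exponentially small
  in \<open>v n\<close>, which beats \<open>(\<Sum> \<bar>\<tau>\<^sub>j\<bar>)\<^sup>2 \<le> 9\<^sup>n\<close> once \<open>v\<close> is large.
\<close>

section \<open>Signed measures\<close>

text \<open>The obstacle to the lower bound is that no probability measure reaches the claimed
  order: on the ball \<open>||x - y||_r <= 2 n^(1/r - 1/2)\<close>, so its energy is at most
  \<open>2^p n^(p/r - p/2)\<close>. The missing factor \<open>n^(p/2)\<close> has to come from
  masses of opposite sign. Gaussians make this computable, because the energy of a mixture depends
  on sums of variances only. Concentration in the ball caps the variances at order
  \<open>1/n\<close>, and a spacing of order \<open>1/n^2\<close> leaves room for
  \<open>n + 1\<close> of them. Equal spacing turns the exponentials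
  \<open>e^(-(v_j + v_k) t)\<close> of the variances into powers of a single one, hence the
  quadratic form into an integral over the square of a polynomial.

  The upper bound needs two arguments because the constant \<open>C_q\<close> blows up as
  \<open>q\<close> tends to 2: on an interval \<open>C - (s - t)^2\<close> is positive definite for
  no \<open>C\<close>, as weights with small nonzero sum show. Positive definiteness of
  \<open>C - d^p\<close> is asked for, and not just negative definiteness of \<open>d^p\<close> on
  weights of sum zero, because the measures have mass one.\<close>

lemma finite_signed_measure_sums:
  assumes "finite_signed_measure M \<mu>" "\<And>i. F i \<in> sets M" "disjoint_family F"
  shows "(\<lambda>i. \<mu> (F i)) sums \<mu> (\<Union>i. F i)"
proof -
  have "range F \<subseteq> sets M" using assms(2) by auto
  then show ?thesis using assms(1,3) unfolding finite_signed_measure_def by blast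
qed

lemma finite_signed_measure_Un:
  assumes \<mu>: "finite_signed_measure M \<mu>" and AB: "A \<in> sets M" "B \<in> sets M" "A \<inter> B = {}"
  shows "\<mu> (A \<union> B) = \<mu> A + \<mu> B"
proof -
  have e: "\<mu> {} = 0" using \<mu> unfolding finite_signed_measure_def by blast
  have "(\<lambda>i. \<mu> (binaryset A B i)) sums \<mu> (\<Union>i. binaryset A B i)"
    using AB by (intro finite_signed_measure_sums[OF \<mu>])
      (auto simp: disjoint_family_on_def binaryset_def)
  moreover have "(\<lambda>i. \<mu> (binaryset A B i)) sums (\<mu> A + \<mu> B)"
    using e by (rule binaryset_sums)
  ultimately have "\<mu> (\<Union>i. binaryset A B i) = \<mu> A + \<mu> B" by (rule sums_unique2)
  then show ?thesis by (simp add: UN_binaryset_eq)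
qed

lemma finite_signed_measure_Diff:
  assumes "finite_signed_measure M \<mu>" "A \<in> sets M" "B \<in> sets M" "B \<subseteq> A"
  shows "\<mu> (A - B) = \<mu> A - \<mu> B"
proof -
  have "(A - B) \<union> B = A" using assms(4) by blast
  moreover have "(A - B) \<inter> B = {}" by blast
  ultimately show ?thesis
    using finite_signed_measure_Un[OF assms(1), of "A - B" B] assms(2,3) by simp
qed

lemma finite_signed_measure_uminus:
  "finite_signed_measure M \<mu> \<Longrightarrow> finite_signed_measure M (\<lambda>A. - \<mu> A)"
  unfolding finite_signed_measure_def by (auto intro: sums_minus)

text \<open>If \<open>\<mu>\<close> were unbounded, splitting repeatedly would produce disjoint sets whose measures
  do not tend to \<open>0\<close>.\<close>

lemma finite_signed_measure_bounded:
  assumes \<mu>: "finite_signed_measure M \<mu>"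
  obtains b where "\<And>B. B \<in> sets M \<Longrightarrow> \<bar>\<mu> B\<bar> \<le> b"
proof -
  define bad where "bad E \<longleftrightarrow> (\<forall>c. \<exists>B\<in>sets M. B \<subseteq> E \<and> \<bar>\<mu> B\<bar> > c)" for E
  have step: "\<exists>F. F \<in> sets M \<and> bad F \<and> F \<subseteq> E \<and> \<bar>\<mu> (E - F)\<bar> \<ge> 1"
    if E: "E \<in> sets M" "bad E" for E
  proof -
    \<comment> \<open>The margin 1 gives both \<open>B\<close> and \<open>E - B\<close> measure at
      least 1 in absolute value. Hence whichever of them is bad can be kept, with the other one
      split off.\<close>
    obtain B where B: "B \<in> sets M" "B \<subseteq> E" "\<bar>\<mu> B\<bar> > \<bar>\<mu> E\<bar> + 1"
      using E(2) unfolding bad_def by blast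
    have d: "\<mu> (E - B) = \<mu> E - \<mu> B" by (rule finite_signed_measure_Diff[OF \<mu> E(1) B(1,2)])
    have EB: "E - (E - B) = B" using B(2) by blast
    show ?thesis
    proof (cases "bad B")
      case True
      then show ?thesis using B d by (intro exI[of _ B]) auto
    next
      case False
      then obtain c where c: "\<And>C. C \<in> sets M \<Longrightarrow> C \<subseteq> B \<Longrightarrow> \<bar>\<mu> C\<bar> \<le> c"
        unfolding bad_def by (meson not_less)
      have "bad (E - B)"
        unfolding bad_def
      proof
        fix x
        obtain C where C: "C \<in> sets M" "C \<subseteq> E" "\<bar>\<mu> C\<bar> > x + c"
          using E(2) unfolding bad_def by blast
        have "\<mu> C = \<mu> (C \<inter> B) + \<mu> (C - B)"
          using finite_signed_measure_Un[OF \<mu>, of "C \<inter> B" "C - B"] C(1) B(1)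
          by (metis Int_Diff_Un sets.Diff sets.Int inf_commute Int_Diff_disjoint)
        moreover have "\<bar>\<mu> (C \<inter> B)\<bar> \<le> c" using c[of "C \<inter> B"] C(1) B(1) by auto
        ultimately have "\<bar>\<mu> (C - B)\<bar> > x" using C(3) by linarith
        then show "\<exists>C'\<in>sets M. C' \<subseteq> E - B \<and> \<bar>\<mu> C'\<bar> > x"
          using C B by (intro bexI[of _ "C - B"]) auto
      qed
      then show ?thesis using B E EB by (intro exI[of _ "E - B"]) auto
    qed
  qed
  have "\<not> bad (space M)"
  proof
    assume "bad (space M)"
    then have "\<exists>f. \<forall>n. (f n \<in> sets M \<and> bad (f n)) \<and> (f (Suc n) \<subseteq> f n \<and> \<bar>\<mu> (f n - f (Suc n))\<bar> \<ge> 1)"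
      using step by (intro dependent_nat_choice) auto
    then obtain f where f: "\<And>n. f n \<in> sets M" "\<And>n. f (Suc n) \<subseteq> f n" "\<And>n. \<bar>\<mu> (f n - f (Suc n))\<bar> \<ge> 1"
      by blast
    have dec: "decseq f" using f(2) by (rule decseq_SucI)
    have "disjoint_family (\<lambda>n. f n - f (Suc n))"
      unfolding disjoint_family_on_def
    proof (intro ballI impI)
      fix m n :: nat assume "m \<noteq> n"
      then have "Suc m \<le> n \<or> Suc n \<le> m" by linarith
      then have "f n \<subseteq> f (Suc m) \<or> f m \<subseteq> f (Suc n)" using decseqD[OF dec] by blast
      then show "(f m - f (Suc m)) \<inter> (f n - f (Suc n)) = {}" by blast
    qed
    then have "(\<lambda>n. \<mu> (f n - f (Suc n))) sums \<mu> (\<Union>n. f n - f (Suc n))"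
      using f(1) by (intro finite_signed_measure_sums[OF \<mu>]) auto
    then have "(\<lambda>n. \<mu> (f n - f (Suc n))) \<longlonglongrightarrow> 0"
      using sums_summable summable_LIMSEQ_zero by blast
    then obtain n where "\<bar>\<mu> (f n - f (Suc n))\<bar> < 1"
      using LIMSEQ_D[of _ 0 1] by force
    then show False using f(3)[of n] by linarith
  qed
  then obtain c where "\<And>B. B \<in> sets M \<Longrightarrow> B \<subseteq> space M \<Longrightarrow> \<bar>\<mu> B\<bar> \<le> c"
    unfolding bad_def by (meson not_less)
  then show ?thesis using that sets.sets_into_space by metis
qed

text \<open>The terms may have any sign: \<open>ennreal\<close> cuts negative ones to 0, which only
  raises the partial sums. This is what bounds the variation of a union from above.\<close>

lemma ennreal_suminf_le:
  fixes x :: "nat \<Rightarrow> real"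
  assumes "x sums s"
  shows "ennreal s \<le> (\<Sum>i. ennreal (x i))"
proof (rule LIMSEQ_le_const2)
  show "(\<lambda>n. ennreal (\<Sum>i<n. x i)) \<longlonglongrightarrow> ennreal s"
    using assms unfolding sums_def by (rule tendsto_ennrealI)
  have le: "ennreal (\<Sum>i<n. x i) \<le> (\<Sum>i<n. ennreal (x i))" for n
  proof -
    have "ennreal (\<Sum>i<n. x i) \<le> ennreal (\<Sum>i<n. max 0 (x i))"
      by (intro ennreal_leI sum_mono) simp
    also have "\<dots> = (\<Sum>i<n. ennreal (max 0 (x i)))"
      by (rule sum_ennreal[symmetric]) simp
    also have "\<dots> = (\<Sum>i<n. ennreal (x i))"
      by (intro sum.cong refl) (simp add: max_def ennreal_neg)
    finally show ?thesis .
  qed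
  show "\<exists>N. \<forall>n\<ge>N. ennreal (\<Sum>i<n. x i) \<le> (\<Sum>i. ennreal (x i))"
    using order.trans[OF le sum_le_suminf[OF summableI]] by auto
qed

section \<open>Variation measures and the Jordan decomposition\<close>

lemma sets_positive_variation[simp]: "sets (positive_variation M \<mu>) = sets M"
  and space_positive_variation[simp]: "space (positive_variation M \<mu>) = space M"
  by (simp_all add: positive_variation_def sets.sets_measure_of_eq sets.space_measure_of_eq)

lemma sets_negative_variation[simp]: "sets (negative_variation M \<mu>) = sets M"
  and space_negative_variation[simp]: "space (negative_variation M \<mu>) = space M"
  by (simp_all add: negative_variation_def)

lemma emeasure_positive_variation:
  assumes \<mu>: "finite_signed_measure M \<mu>" and A: "A \<in> sets M"
  shows "emeasure (positive_variation M \<mu>) A = (SUP B \<in> {B \<in> sets M. B \<subseteq> A}. ennreal (\<mu> B))"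
proof -
  define v where "v A = (SUP B \<in> {B \<in> sets M. B \<subseteq> A}. ennreal (\<mu> B))" for A
  have e: "\<mu> {} = 0" using \<mu> unfolding finite_signed_measure_def by blast
  have ge: "ennreal (\<mu> B) \<le> v A" if "B \<in> sets M" "B \<subseteq> A" for A B
    unfolding v_def using that by (intro SUP_upper) auto
  have v0: "v {} = 0"
  proof -
    have "{B \<in> sets M. B \<subseteq> {}} = {{}}" by auto
    then show ?thesis unfolding v_def by (simp add: e)
  qed
  have super: "v A + v B \<le> v (A \<union> B)" if AB: "A \<in> sets M" "B \<in> sets M" "A \<inter> B = {}" for A B
  proof -
    have *: "ennreal (\<mu> C) + ennreal (\<mu> D) \<le> v (A \<union> B)"
      if "C \<in> sets M" "C \<subseteq> A" "D \<in> sets M" "D \<subseteq> B" for C D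
    proof (cases "0 \<le> \<mu> C \<and> 0 \<le> \<mu> D")
      case True
      have "\<mu> (C \<union> D) = \<mu> C + \<mu> D"
        using that AB by (intro finite_signed_measure_Un[OF \<mu>]) auto
      then have "ennreal (\<mu> C) + ennreal (\<mu> D) = ennreal (\<mu> (C \<union> D))"
        using True by simp
      also have "\<dots> \<le> v (A \<union> B)" using that by (intro ge) auto
      finally show ?thesis .
    next
      case False
      then have "ennreal (\<mu> C) + ennreal (\<mu> D) = ennreal (\<mu> D) \<or> ennreal (\<mu> C) + ennreal (\<mu> D) = ennreal (\<mu> C)"
        by (auto simp: ennreal_neg)
      moreover have "ennreal (\<mu> C) \<le> v (A \<union> B)" "ennreal (\<mu> D) \<le> v (A \<union> B)"
        using that by (auto intro!: ge)
      ultimately show ?thesis by auto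
    qed
    have 1: "ennreal (\<mu> C) + v B \<le> v (A \<union> B)" if "C \<in> sets M" "C \<subseteq> A" for C
    proof -
      have "ennreal (\<mu> C) + v B = (SUP D \<in> {D \<in> sets M. D \<subseteq> B}. ennreal (\<mu> C) + ennreal (\<mu> D))"
        unfolding v_def by (intro ennreal_SUP_add_right) auto
      also have "\<dots> \<le> v (A \<union> B)" using * that by (intro SUP_least) auto
      finally show ?thesis .
    qed
    have "v A + v B = (SUP C \<in> {C \<in> sets M. C \<subseteq> A}. ennreal (\<mu> C) + v B)"
      unfolding v_def[of A] by (intro ennreal_SUP_add_left[symmetric]) auto
    also have "\<dots> \<le> v (A \<union> B)" using 1 by (intro SUP_least) auto
    finally show ?thesis .
  qed
  have "countably_additive (sets M) v"
    unfolding countably_additive_def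
  proof (intro allI impI antisym)
    fix F :: "nat \<Rightarrow> 'a set" assume F: "range F \<subseteq> sets M" "disjoint_family F" "(\<Union>i. F i) \<in> sets M"
    have part: "(\<Sum>i<n. v (F i)) \<le> v (\<Union>i<n. F i)" for n
    proof (induction n)
      case (Suc n)
      have "(\<Sum>i<Suc n. v (F i)) \<le> v (\<Union>i<n. F i) + v (F n)"
        using Suc by (simp add: add_right_mono)
      also have "\<dots> \<le> v ((\<Union>i<n. F i) \<union> F n)"
      proof (intro super)
        have "F i \<inter> F n = {}" if "i < n" for i
          using F(2) that unfolding disjoint_family_on_def by auto
        then show "(\<Union>i<n. F i) \<inter> F n = {}" by blast
      qed (use F(1) in auto)
      also have "(\<Union>i<n. F i) \<union> F n = (\<Union>i<Suc n. F i)" by (auto simp: less_Suc_eq)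
      finally show ?case .
    qed simp
    have mono: "v A \<le> v B" if "A \<subseteq> B" for A B
      unfolding v_def using that by (intro SUP_subset_mono) auto
    show "(\<Sum>i. v (F i)) \<le> v (\<Union>i. F i)"
      unfolding suminf_eq_SUP by (intro SUP_least order.trans[OF part] mono) auto
    show "v (\<Union>i. F i) \<le> (\<Sum>i. v (F i))"
      unfolding v_def[of "\<Union>i. F i"]
    proof (intro SUP_least)
      fix B assume B: "B \<in> {B \<in> sets M. B \<subseteq> (\<Union>i. F i)}"
      have "(\<lambda>i. \<mu> (B \<inter> F i)) sums \<mu> (\<Union>i. B \<inter> F i)"
        using B F(1,2) by (intro finite_signed_measure_sums[OF \<mu>])
          (auto simp: disjoint_family_on_def)
      moreover have "(\<Union>i. B \<inter> F i) = B" using B by auto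
      ultimately have "ennreal (\<mu> B) \<le> (\<Sum>i. ennreal (\<mu> (B \<inter> F i)))"
        using ennreal_suminf_le by metis
      also have "\<dots> \<le> (\<Sum>i. v (F i))"
        using B F(1) by (intro suminf_le ge) auto
      finally show "ennreal (\<mu> B) \<le> (\<Sum>i. v (F i))" .
    qed
  qed
  then have "emeasure (positive_variation M \<mu>) A = v A"
    unfolding positive_variation_def v_def[symmetric]
    using A v0 by (intro emeasure_measure_of_sigma sets.sigma_algebra_axioms) (auto simp: positive_def)
  then show ?thesis unfolding v_def .
qed

lemma finite_measure_positive_variation:
  assumes \<mu>: "finite_signed_measure M \<mu>"
  shows "finite_measure (positive_variation M \<mu>)"
proof
  obtain b where b: "\<And>B. B \<in> sets M \<Longrightarrow> \<bar>\<mu> B\<bar> \<le> b"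
    using finite_signed_measure_bounded[OF \<mu>] by blast
  have "emeasure (positive_variation M \<mu>) (space M) \<le> ennreal b"
    unfolding emeasure_positive_variation[OF \<mu> sets.top]
    using b by (intro SUP_least ennreal_leI) (auto simp: abs_le_iff)
  then show "emeasure (positive_variation M \<mu>) (space (positive_variation M \<mu>)) \<noteq> \<infinity>"
    by (auto simp: top_unique)
qed

lemma finite_measure_negative_variation:
  "finite_signed_measure M \<mu> \<Longrightarrow> finite_measure (negative_variation M \<mu>)"
  unfolding negative_variation_def
  by (intro finite_measure_positive_variation finite_signed_measure_uminus)

text \<open>For \<open>B \<subseteq> A\<close> one has
  \<open>\<mu> B = \<mu> A - \<mu> (A - B)\<close>, and \<open>- \<mu> (A - B)\<close> is at most
  the negative variation of \<open>A\<close>. Applied to \<open>\<mu>\<close> and to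
  \<open>- \<mu>\<close>, this gives the two halves of the Jordan decomposition.\<close>

lemma measure_positive_variation_le:
  assumes \<mu>: "finite_signed_measure M \<mu>" and A: "A \<in> sets M"
  shows "measure (positive_variation M \<mu>) A \<le> measure (negative_variation M \<mu>) A + \<mu> A"
proof -
  interpret N: finite_measure "negative_variation M \<mu>"
    by (rule finite_measure_negative_variation[OF \<mu>])
  have le: "- \<mu> B \<le> measure (negative_variation M \<mu>) A" if "B \<in> sets M" "B \<subseteq> A" for B
  proof -
    have "ennreal (- \<mu> B) \<le> emeasure (negative_variation M \<mu>) A"
      unfolding negative_variation_def emeasure_positive_variation[OF finite_signed_measure_uminus[OF \<mu>] A]
      using that by (intro SUP_upper) auto
    then show ?thesis unfolding N.emeasure_eq_measure by simp
  qed
  have "\<mu> B \<le> measure (negative_variation M \<mu>) A + \<mu> A" if "B \<in> sets M" "B \<subseteq> A" for B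
    using le[of "A - B"] finite_signed_measure_Diff[OF \<mu> A that] that A by auto
  then have "emeasure (positive_variation M \<mu>) A \<le> ennreal (measure (negative_variation M \<mu>) A + \<mu> A)"
    unfolding emeasure_positive_variation[OF \<mu> A] by (intro SUP_least ennreal_leI) auto
  moreover have "0 \<le> measure (negative_variation M \<mu>) A + \<mu> A" using le[OF A] by simp
  ultimately show ?thesis
    unfolding measure_def[of "positive_variation M \<mu>"] by (metis enn2real_leI)
qed

lemma jordan_decomposition:
  assumes \<mu>: "finite_signed_measure M \<mu>" and A: "A \<in> sets M"
  shows "\<mu> A = measure (positive_variation M \<mu>) A - measure (negative_variation M \<mu>) A"
  using measure_positive_variation_le[OF \<mu> A]
    measure_positive_variation_le[OF finite_signed_measure_uminus[OF \<mu>] A]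
  by (simp add: negative_variation_def)

section \<open>Integrals against linear combinations of measures\<close>

lemma integral_simple_function:
  fixes f :: "'a \<Rightarrow> real"
  assumes "finite_measure N" "simple_function N f"
  shows "(\<integral>x. f x \<partial>N) = (\<Sum>y\<in>f ` space N. y * measure N (f -` {y} \<inter> space N))"
proof -
  interpret finite_measure N by fact
  have m: "f -` {y} \<inter> space N \<in> sets N" for y using assms(2) by (rule simple_functionD)
  have fin: "finite (f ` space N)" using assms(2) by (rule simple_functionD)
  have "(\<integral>x. f x \<partial>N) = (\<integral>x. (\<Sum>y\<in>f ` space N. y * indicator (f -` {y} \<inter> space N) x) \<partial>N)"
  proof (rule Bochner_Integration.integral_cong[OF refl])
    fix x assume x: "x \<in> space N"
    have "(\<Sum>y\<in>f ` space N. y * indicator (f -` {y} \<inter> space N) x) = (\<Sum>y\<in>f ` space N. if y = f x then y else 0)"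
      using x by (intro sum.cong) (auto simp: indicator_def)
    then show "f x = (\<Sum>y\<in>f ` space N. y * indicator (f -` {y} \<inter> space N) x)"
      using x fin by simp
  qed
  also have "\<dots> = (\<Sum>y\<in>f ` space N. y * measure N (f -` {y} \<inter> space N))"
    using m by (simp add: less_top[symmetric])
  finally show ?thesis .
qed

text \<open>A linear relation between finite measures passes to integrals of bounded functions, by
  linearity for simple functions and by dominated convergence in general. Writing it as a vanishing
  sum treats the measures on both sides of an identity alike.\<close>

lemma sum_integral_eq_0:
  fixes f :: "'a \<Rightarrow> real"
  assumes \<nu>: "\<And>i. i \<in> I \<Longrightarrow> finite_measure (\<nu> i)" "\<And>i. i \<in> I \<Longrightarrow> sets (\<nu> i) = sets M"
    and zero: "\<And>A. A \<in> sets M \<Longrightarrow> (\<Sum>i\<in>I. c i * measure (\<nu> i) A) = 0"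
    and f: "f \<in> borel_measurable M" "\<And>x. x \<in> space M \<Longrightarrow> \<bar>f x\<bar> \<le> b"
  shows "(\<Sum>i\<in>I. c i * (\<integral>x. f x \<partial>\<nu> i)) = 0"
proof -
  obtain F where F: "\<And>k. simple_function M (F k)" "\<And>x. x \<in> space M \<Longrightarrow> (\<lambda>k. F k x) \<longlonglongrightarrow> f x"
    "\<And>k x. x \<in> space M \<Longrightarrow> dist (F k x) 0 \<le> 2 * dist (f x) 0"
    using borel_measurable_implies_sequence_metric[OF f(1), of 0] by metis
  have sp: "space (\<nu> i) = space M" if "i \<in> I" for i using sets_eq_imp_space_eq[OF \<nu>(2)[OF that]] .
  have sf: "simple_function (\<nu> i) (F k)" if "i \<in> I" for i k
    using F(1)[of k] sp[OF that] \<nu>(2)[OF that] unfolding simple_function_def by simp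
  have lim: "(\<lambda>k. \<integral>x. F k x \<partial>\<nu> i) \<longlonglongrightarrow> (\<integral>x. f x \<partial>\<nu> i)" if i: "i \<in> I" for i
  proof (rule integral_dominated_convergence[where w = "\<lambda>_. 2 * b"])
    interpret finite_measure "\<nu> i" using \<nu>(1)[OF i] .
    show "f \<in> borel_measurable (\<nu> i)" using f(1) \<nu>(2)[OF i] by (simp cong: measurable_cong_sets)
    show "F k \<in> borel_measurable (\<nu> i)" for k by (rule borel_measurable_simple_function[OF sf[OF i]])
    show "integrable (\<nu> i) (\<lambda>_. 2 * b)" by simp
    show "AE x in \<nu> i. (\<lambda>k. F k x) \<longlonglongrightarrow> f x" using F(2) sp[OF i] by (intro AE_I2) auto
    show "AE x in \<nu> i. norm (F k x) \<le> 2 * b" for k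
      using F(3)[of _ k] f(2) sp[OF i] by (intro AE_I2) (fastforce simp: dist_real_def)
  qed
  have "(\<Sum>i\<in>I. c i * (\<integral>x. F k x \<partial>\<nu> i)) = 0" for k
  proof -
    have "(\<Sum>i\<in>I. c i * (\<integral>x. F k x \<partial>\<nu> i)) =
      (\<Sum>i\<in>I. \<Sum>y\<in>F k ` space M. y * (c i * measure (\<nu> i) (F k -` {y} \<inter> space M)))"
      using sp by (intro sum.cong refl)
        (simp add: integral_simple_function[OF \<nu>(1) sf] sum_distrib_left mult.left_commute)
    also have "\<dots> = (\<Sum>y\<in>F k ` space M. y * (\<Sum>i\<in>I. c i * measure (\<nu> i) (F k -` {y} \<inter> space M)))"
      by (subst sum.swap) (simp add: sum_distrib_left)
    also have "\<dots> = 0" using simple_functionD(2)[OF F(1)] by (simp add: zero)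
    finally show ?thesis .
  qed
  moreover have "(\<lambda>k. \<Sum>i\<in>I. c i * (\<integral>x. F k x \<partial>\<nu> i)) \<longlonglongrightarrow> (\<Sum>i\<in>I. c i * (\<integral>x. f x \<partial>\<nu> i))"
    using lim by (intro tendsto_sum tendsto_mult tendsto_const) auto
  ultimately show ?thesis by (simp add: LIMSEQ_const_iff)
qed

lemma finite_signed_measure_combination:
  assumes "finite I" and \<nu>: "\<And>i. i \<in> I \<Longrightarrow> finite_measure (\<nu> i)" "\<And>i. i \<in> I \<Longrightarrow> sets (\<nu> i) = sets M"
  shows "finite_signed_measure M (\<lambda>A. \<Sum>i\<in>I. c i * measure (\<nu> i) A)"
  unfolding finite_signed_measure_def
proof (intro conjI allI impI)
  fix F :: "nat \<Rightarrow> 'b set" assume F: "range F \<subseteq> sets M" "disjoint_family F"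
  show "(\<lambda>k. \<Sum>i\<in>I. c i * measure (\<nu> i) (F k)) sums (\<Sum>i\<in>I. c i * measure (\<nu> i) (\<Union>k. F k))"
    using F \<nu> by (intro sums_sum sums_mult finite_measure.finite_measure_UNION) auto
qed simp

lemma signed_integral_combination:
  fixes f :: "'a \<Rightarrow> real"
  assumes I: "finite I" and \<nu>: "\<And>i. i \<in> I \<Longrightarrow> finite_measure (\<nu> i)" "\<And>i. i \<in> I \<Longrightarrow> sets (\<nu> i) = sets M"
    and f: "f \<in> borel_measurable M" "\<And>x. x \<in> space M \<Longrightarrow> \<bar>f x\<bar> \<le> b"
  shows "signed_integral M (\<lambda>A. \<Sum>i\<in>I. c i * measure (\<nu> i) A) f = (\<Sum>i\<in>I. c i * (\<integral>x. f x \<partial>\<nu> i))"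
proof -
  define \<mu> where "\<mu> A = (\<Sum>i\<in>I. c i * measure (\<nu> i) A)" for A
  have \<mu>: "finite_signed_measure M \<mu>"
    unfolding \<mu>_def[abs_def] by (rule finite_signed_measure_combination[OF I \<nu>])
  \<comment> \<open>Two indices are added to \<open>I\<close>: \<open>True\<close> for the positive
    variation with coefficient -1, \<open>False\<close> for the negative one with coefficient 1. By
    the Jordan decomposition the enlarged combination vanishes on every measurable set.\<close>
  define N where "N = case_sum \<nu> (\<lambda>p. if p then positive_variation M \<mu> else negative_variation M \<mu>)"
  define e where "e = case_sum c (\<lambda>p. if p then -1 else 1 :: real)"
  have "(\<Sum>j\<in>I <+> UNIV. e j * (\<integral>x. f x \<partial>N j)) = 0"
  proof (rule sum_integral_eq_0[OF _ _ _ f])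
    show "finite_measure (N j)" if "j \<in> I <+> UNIV" for j
      using that \<nu> finite_measure_positive_variation[OF \<mu>] finite_measure_negative_variation[OF \<mu>]
      by (auto simp: N_def)
    show "sets (N j) = sets M" if "j \<in> I <+> UNIV" for j
      using that \<nu>(2) by (elim PlusE) (simp_all add: N_def)
    show "(\<Sum>j\<in>I <+> UNIV. e j * measure (N j) A) = 0" if "A \<in> sets M" for A
      using I jordan_decomposition[OF \<mu> that]
      by (simp add: sum.Plus UNIV_bool N_def e_def \<mu>_def)
  qed
  then show ?thesis
    using I unfolding \<mu>_def[abs_def, symmetric]
    by (simp add: sum.Plus UNIV_bool N_def e_def signed_integral_def)
qed

section \<open>Positive definite kernels\<close>

text \<open>Points are taken from a finite set, hence without repetition; repeated points are
  recovered through \<open>pos_def_on_comp\<close>. Symmetry is demanded separately because the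
  quadratic form sees only the symmetric part of \<open>k\<close>.\<close>

definition pos_def_on :: "'a set \<Rightarrow> ('a \<Rightarrow> 'a \<Rightarrow> real) \<Rightarrow> bool" where
  "pos_def_on S k \<longleftrightarrow> (\<forall>x\<in>S. \<forall>y\<in>S. k x y = k y x) \<and>
     (\<forall>X w. finite X \<longrightarrow> X \<subseteq> S \<longrightarrow> 0 \<le> (\<Sum>x\<in>X. \<Sum>y\<in>X. w x * w y * k x y))"

lemma pos_def_onI:
  assumes "\<And>x y. x \<in> S \<Longrightarrow> y \<in> S \<Longrightarrow> k x y = k y x"
    and "\<And>X w. finite X \<Longrightarrow> X \<subseteq> S \<Longrightarrow> 0 \<le> (\<Sum>x\<in>X. \<Sum>y\<in>X. w x * w y * k x y)"
  shows "pos_def_on S k"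
  using assms unfolding pos_def_on_def by blast

lemma pos_def_on_sym: "pos_def_on S k \<Longrightarrow> x \<in> S \<Longrightarrow> y \<in> S \<Longrightarrow> k x y = k y x"
  unfolding pos_def_on_def by blast

lemma pos_def_onD:
  "pos_def_on S k \<Longrightarrow> finite X \<Longrightarrow> X \<subseteq> S \<Longrightarrow> 0 \<le> (\<Sum>x\<in>X. \<Sum>y\<in>X. w x * w y * k x y)"
  unfolding pos_def_on_def by blast

lemma pos_def_on_subset: "pos_def_on S k \<Longrightarrow> T \<subseteq> S \<Longrightarrow> pos_def_on T k"
  unfolding pos_def_on_def by blast

lemma pos_def_on_cong:
  assumes "pos_def_on S k" "\<And>x y. x \<in> S \<Longrightarrow> y \<in> S \<Longrightarrow> k x y = l x y"
  shows "pos_def_on S l"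
proof (rule pos_def_onI)
  fix X w assume X: "finite X" "X \<subseteq> S"
  have "(\<Sum>x\<in>X. \<Sum>y\<in>X. w x * w y * l x y) = (\<Sum>x\<in>X. \<Sum>y\<in>X. w x * w y * k x y)"
    using X assms(2) by (intro sum.cong refl) (auto simp: subset_iff)
  then show "0 \<le> (\<Sum>x\<in>X. \<Sum>y\<in>X. w x * w y * l x y)" using pos_def_onD[OF assms(1) X] by simp
qed (use assms pos_def_on_sym in metis)

lemma pos_def_on_add:
  assumes "pos_def_on S k" "pos_def_on S l"
  shows "pos_def_on S (\<lambda>x y. k x y + l x y)"
proof (rule pos_def_onI)
  fix X w assume X: "finite X" "X \<subseteq> S"
  show "0 \<le> (\<Sum>x\<in>X. \<Sum>y\<in>X. w x * w y * (k x y + l x y))"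
    using pos_def_onD[OF assms(1) X, of w] pos_def_onD[OF assms(2) X, of w]
    by (simp add: distrib_left sum.distrib)
qed (use assms pos_def_on_sym in metis)

lemma pos_def_on_scale:
  assumes "pos_def_on S k" "0 \<le> c"
  shows "pos_def_on S (\<lambda>x y. c * k x y)"
proof (rule pos_def_onI)
  fix X w assume X: "finite X" "X \<subseteq> S"
  have "(\<Sum>x\<in>X. \<Sum>y\<in>X. w x * w y * (c * k x y)) = c * (\<Sum>x\<in>X. \<Sum>y\<in>X. w x * w y * k x y)"
    by (simp add: sum_distrib_left mult.left_commute)
  then show "0 \<le> (\<Sum>x\<in>X. \<Sum>y\<in>X. w x * w y * (c * k x y))"
    using pos_def_onD[OF assms(1) X] assms(2) by simp
qed (use assms pos_def_on_sym in metis)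

lemma pos_def_on_rank_one: "pos_def_on S (\<lambda>x y. f x * f y :: real)"
proof (rule pos_def_onI)
  fix X w assume X: "finite X" "X \<subseteq> S"
  have "(\<Sum>x\<in>X. \<Sum>y\<in>X. w x * w y * (f x * f y)) = (\<Sum>x\<in>X. w x * f x)\<^sup>2"
    by (simp add: power2_eq_square sum_product mult_ac)
  then show "0 \<le> (\<Sum>x\<in>X. \<Sum>y\<in>X. w x * w y * (f x * f y))" by simp
qed simp

lemma pos_def_on_const: "0 \<le> c \<Longrightarrow> pos_def_on S (\<lambda>x y. c)"
  using pos_def_on_scale[OF pos_def_on_rank_one[of S "\<lambda>_. 1"], of c] by simp

lemma pos_def_on_sum:
  assumes "\<And>i. i \<in> I \<Longrightarrow> pos_def_on S (k i)"
  shows "pos_def_on S (\<lambda>x y. \<Sum>i\<in>I. k i x y)"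
  using assms
  by (induction I rule: infinite_finite_induct) (simp_all add: pos_def_on_const pos_def_on_add)

text \<open>Weights of points with the same image are added up, so \<open>f\<close> may identify
  points. This covers projections to a line as well as finite sequences with repetitions.\<close>

lemma pos_def_on_comp:
  assumes k: "pos_def_on T k" and f: "\<And>x. x \<in> S \<Longrightarrow> f x \<in> T"
  shows "pos_def_on S (\<lambda>x y. k (f x) (f y))"
proof (rule pos_def_onI)
  fix X and w :: "'b \<Rightarrow> real" assume X: "finite X" "X \<subseteq> S"
  define v where "v b = (\<Sum>x\<in>{x\<in>X. f x = b}. w x)" for b
  have *: "(\<Sum>x\<in>X. w x * h (f x)) = (\<Sum>b\<in>f ` X. v b * h b)" for h
  proof -
    have "(\<Sum>x\<in>X. w x * h (f x)) = (\<Sum>b\<in>f ` X. \<Sum>x\<in>{x\<in>X. f x = b}. w x * h (f x))"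
      by (rule sum.image_gen[OF X(1)])
    also have "\<dots> = (\<Sum>b\<in>f ` X. v b * h b)"
      unfolding v_def by (simp add: sum_distrib_right)
    finally show ?thesis .
  qed
  have "(\<Sum>x\<in>X. \<Sum>y\<in>X. w x * w y * k (f x) (f y)) = (\<Sum>x\<in>X. w x * (\<Sum>y\<in>X. w y * k (f x) (f y)))"
    by (simp add: sum_distrib_left mult.assoc)
  also have "\<dots> = (\<Sum>a\<in>f ` X. v a * (\<Sum>b\<in>f ` X. v b * k a b))"
    unfolding *[of "\<lambda>b. k _ b"] by (rule *)
  also have "\<dots> = (\<Sum>a\<in>f ` X. \<Sum>b\<in>f ` X. v a * v b * k a b)"
    by (simp add: sum_distrib_left mult.assoc)
  also have "\<dots> \<ge> 0"
    using X f by (intro pos_def_onD[OF k]) auto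
  finally show "0 \<le> (\<Sum>x\<in>X. \<Sum>y\<in>X. w x * w y * k (f x) (f y))" .
qed (use k f pos_def_on_sym in metis)

lemma pos_def_on_LIMSEQ:
  assumes k: "\<And>m. pos_def_on S (k m)"
    and l: "\<And>x y. x \<in> S \<Longrightarrow> y \<in> S \<Longrightarrow> (\<lambda>m. k m x y) \<longlonglongrightarrow> l x y"
  shows "pos_def_on S l"
proof (rule pos_def_onI)
  fix x y assume xy: "x \<in> S" "y \<in> S"
  have "(\<lambda>m. k m x y) \<longlonglongrightarrow> l y x"
    using l[OF xy(2,1)] pos_def_on_sym[OF k xy] by simp
  then show "l x y = l y x" using l[OF xy] LIMSEQ_unique by blast
next
  fix X w assume X: "finite X" "X \<subseteq> S"
  have "(\<lambda>m. \<Sum>x\<in>X. \<Sum>y\<in>X. w x * w y * k m x y) \<longlonglongrightarrow> (\<Sum>x\<in>X. \<Sum>y\<in>X. w x * w y * l x y)"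
    using X l by (intro tendsto_sum tendsto_mult tendsto_const) auto
  then show "0 \<le> (\<Sum>x\<in>X. \<Sum>y\<in>X. w x * w y * l x y)"
    using pos_def_onD[OF k X] by (intro LIMSEQ_le_const) auto
qed

lemma pos_def_on_has_integral:
  fixes T :: "'b::euclidean_space set"
  assumes k: "\<And>u. u \<in> T \<Longrightarrow> pos_def_on S (k u)"
    and l: "\<And>x y. x \<in> S \<Longrightarrow> y \<in> S \<Longrightarrow> ((\<lambda>u. k u x y) has_integral l x y) T"
  shows "pos_def_on S l"
proof (rule pos_def_onI)
  fix x y assume xy: "x \<in> S" "y \<in> S"
  have "((\<lambda>u. k u x y) has_integral l y x) T"
    by (rule has_integral_eq[OF _ l[OF xy(2,1)]]) (rule pos_def_on_sym[OF k xy(2,1)])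
  then show "l x y = l y x" using l[OF xy] has_integral_unique by blast
next
  fix X w assume X: "finite X" "X \<subseteq> S"
  have "((\<lambda>u. \<Sum>x\<in>X. \<Sum>y\<in>X. w x * w y * k u x y) has_integral
      (\<Sum>x\<in>X. \<Sum>y\<in>X. w x * w y * l x y)) T"
    using X l by (intro has_integral_sum has_integral_mult_right) auto
  then show "0 \<le> (\<Sum>x\<in>X. \<Sum>y\<in>X. w x * w y * l x y)"
    using pos_def_onD[OF k X] by (rule has_integral_nonneg)
qed

lemma pos_def_on_lebesgue_integral:
  assumes k: "\<And>u. u \<in> space M \<Longrightarrow> pos_def_on S (k u)"
    and l: "\<And>x y. x \<in> S \<Longrightarrow> y \<in> S \<Longrightarrow> integrable M (\<lambda>u. k u x y)"
  shows "pos_def_on S (\<lambda>x y. \<integral>u. k u x y \<partial>M)"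
proof (rule pos_def_onI)
  fix x y assume xy: "x \<in> S" "y \<in> S"
  show "(\<integral>u. k u x y \<partial>M) = (\<integral>u. k u y x \<partial>M)"
    using pos_def_on_sym[OF k xy] by (intro Bochner_Integration.integral_cong) auto
next
  fix X w assume X: "finite X" "X \<subseteq> S"
  have "(\<Sum>x\<in>X. \<Sum>y\<in>X. w x * w y * (\<integral>u. k u x y \<partial>M)) =
      (\<integral>u. (\<Sum>x\<in>X. \<Sum>y\<in>X. w x * w y * k u x y) \<partial>M)"
  proof -
    have "integrable M (\<lambda>u. w x * w y * k u x y)" if "x \<in> X" "y \<in> X" for x y
      using l X that by auto
    then show ?thesis
      by (simp add: Bochner_Integration.integral_sum Bochner_Integration.integrable_sum)
  qed
  also have "\<dots> \<ge> 0"
    using pos_def_onD[OF k X] by (intro integral_nonneg_AE) auto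
  finally show "0 \<le> (\<Sum>x\<in>X. \<Sum>y\<in>X. w x * w y * (\<integral>u. k u x y \<partial>M))" .
qed

section \<open>Schur products and fractional powers of kernels\<close>

lemma pos_def_on_diag: "pos_def_on S k \<Longrightarrow> x \<in> S \<Longrightarrow> 0 \<le> k x x"
  using pos_def_onD[of S k "{x}" "\<lambda>_. 1"] by simp

lemma pos_def_on_pair:
  assumes "pos_def_on S k" "x \<in> S" "y \<in> S" "x \<noteq> y"
  shows "0 \<le> a\<^sup>2 * k x x + 2 * a * b * k x y + b\<^sup>2 * k y y"
  using pos_def_onD[OF assms(1), of "{x,y}" "(\<lambda>_. b)(x := a)"] assms pos_def_on_sym[of S k x y]
  by (simp add: power2_eq_square algebra_simps)

text \<open>With \<open>k x x = 0\<close> the form on the two points is affine in the weight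
  \<open>a\<close>, and it could not stay nonnegative with a nonzero slope. The witness in the proof
  produces the value -1.\<close>

lemma pos_def_on_zero_diag:
  assumes "pos_def_on S k" "x \<in> S" "y \<in> S" "k x x = 0"
  shows "k x y = 0"
proof (cases "x = y")
  case False
  have *: "0 \<le> 2 * a * k x y + k y y" for a
    using pos_def_on_pair[OF assms(1-3) False, of a 1] assms(4) by simp
  have "k y y \<ge> 0" using pos_def_on_diag assms by metis
  show ?thesis
  proof (rule ccontr)
    assume "k x y \<noteq> 0"
    then show False using *[of "- (k y y + 1) / (2 * k x y)"] by (simp add: field_simps)
  qed
qed (use assms in simp)

text \<open>The induction splits off the rank one part
  \<open>l x a * l a y / l a a\<close> of \<open>l\<close>, leaving a Schur complement that vanishes at \<open>a\<close>.\<close>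

lemma pos_def_on_mult_aux:
  assumes "finite X" "pos_def_on X k" "pos_def_on X l"
  shows "0 \<le> (\<Sum>x\<in>X. \<Sum>y\<in>X. w x * w y * (k x y * l x y))"
  using assms
proof (induction X arbitrary: l rule: finite_induct)
  case (insert a X)
  define c where "c = l a a"
  define m where "m x y = l x y - l x a * l a y / c" for x y
  have sym: "\<And>x y. x \<in> insert a X \<Longrightarrow> y \<in> insert a X \<Longrightarrow> l x y = l y x"
    using insert.prems(2) pos_def_on_sym by metis
  \<comment> \<open>If \<open>c = 0\<close>, division by \<open>c\<close> gives 0 and
    \<open>m\<close> coincides with \<open>l\<close>; but then the row and column of
    \<open>a\<close> vanish already, so \<open>m\<close> still vanishes there.\<close>
  have c0: "c = 0 \<Longrightarrow> y \<in> insert a X \<Longrightarrow> l a y = 0" for y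
    using pos_def_on_zero_diag[OF insert.prems(2)] unfolding c_def by auto
  have cnn: "0 \<le> c" unfolding c_def using pos_def_on_diag[OF insert.prems(2)] by simp
  have ma: "m a y = 0" "m y a = 0" if "y \<in> insert a X" for y
    using c0[OF _ that] sym[OF that, of a] unfolding m_def c_def by auto
  have m: "pos_def_on X m"
  proof (rule pos_def_onI)
    fix Y w assume Y: "finite Y" "Y \<subseteq> X"
    have aY: "a \<notin> Y" using Y insert.hyps by auto
    define s where "s = (\<Sum>x\<in>Y. w x * l x a)"
    \<comment> \<open>For \<open>c > 0\<close>, \<open>- s / c\<close> is the weight at
      \<open>a\<close> that minimizes the form of \<open>l\<close>. The minimum is the form of the
      Schur complement.\<close>
    define v where "v = w(a := - s / c)"
    have v: "v a = - s / c" "\<And>x. x \<in> Y \<Longrightarrow> v x = w x" using aY by (auto simp: v_def)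
    have sa: "(\<Sum>y\<in>Y. w y * l a y) = s"
      unfolding s_def using Y sym by (intro sum.cong refl) (metis insertCI subset_iff)
    have "0 \<le> (\<Sum>x\<in>insert a Y. \<Sum>y\<in>insert a Y. v x * v y * l x y)"
      using Y by (intro pos_def_onD[OF insert.prems(2)]) auto
    also have "\<dots> = (s / c)\<^sup>2 * c + (- s / c) * (\<Sum>y\<in>Y. w y * l a y)
        + (\<Sum>x\<in>Y. (- s / c) * (w x * l x a) + (\<Sum>y\<in>Y. w x * w y * l x y))"
      using Y(1) aY v by (simp add: sum_distrib_left power2_eq_square c_def mult_ac)
    also have "\<dots> = (s / c)\<^sup>2 * c - 2 * (s / c) * s + (\<Sum>x\<in>Y. \<Sum>y\<in>Y. w x * w y * l x y)"
      unfolding sum.distrib sum_distrib_left[symmetric] sa s_def[symmetric] by simp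
    also have "\<dots> = (\<Sum>x\<in>Y. \<Sum>y\<in>Y. w x * w y * l x y) - s * s / c"
      by (simp add: power2_eq_square)
    also have "s * s / c = (\<Sum>x\<in>Y. \<Sum>y\<in>Y. w x * w y * (l x a * l a y / c))"
      by (subst (2) sa[symmetric], subst s_def)
        (simp add: sum_product sum_divide_distrib mult_ac)
    finally show "0 \<le> (\<Sum>x\<in>Y. \<Sum>y\<in>Y. w x * w y * m x y)"
      by (simp add: m_def algebra_simps sum_subtractf)
  next
    fix x y assume "x \<in> X" "y \<in> X"
    then show "m x y = m y x" using sym[of x y] sym[of x a] sym[of y a] by (simp add: m_def)
  qed
  have k: "pos_def_on X k" using insert.prems(1) pos_def_on_subset by blast
  have fin: "finite (insert a X)" using insert.hyps by simp
  have "0 \<le> (\<Sum>x\<in>X. \<Sum>y\<in>X. w x * w y * (k x y * m x y))"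
    by (rule insert.IH[OF k m])
  also have "\<dots> = (\<Sum>x\<in>insert a X. \<Sum>y\<in>insert a X. w x * w y * (k x y * m x y))"
    using insert.hyps ma by simp
  finally have 1: "0 \<le> \<dots>" .
  \<comment> \<open>Multiplying \<open>k\<close> by the rank one part amounts to replacing the
    weights \<open>w x\<close> by \<open>w x * l x a\<close>.\<close>
  have "0 \<le> (\<Sum>x\<in>insert a X. \<Sum>y\<in>insert a X. (w x * l x a) * (w y * l y a) * k x y)"
    by (rule pos_def_onD[OF insert.prems(1) fin]) simp
  then have "0 \<le> (\<Sum>x\<in>insert a X. \<Sum>y\<in>insert a X. (w x * l x a) * (w y * l y a) * k x y) / c"
    using cnn by simp
  also have "\<dots> = (\<Sum>x\<in>insert a X. \<Sum>y\<in>insert a X. w x * w y * (k x y * (l x a * l a y / c)))"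
    unfolding sum_divide_distrib using sym
    by (intro sum.cong refl) (simp add: mult_ac)
  finally have 2: "0 \<le> \<dots>" .
  have "(\<Sum>x\<in>insert a X. \<Sum>y\<in>insert a X. w x * w y * (k x y * l x y)) =
      (\<Sum>x\<in>insert a X. \<Sum>y\<in>insert a X. w x * w y * (k x y * m x y)) +
      (\<Sum>x\<in>insert a X. \<Sum>y\<in>insert a X. w x * w y * (k x y * (l x a * l a y / c)))"
    unfolding sum.distrib[symmetric] distrib_left[symmetric] m_def by simp
  with 1 2 show ?case by linarith
qed simp

lemma pos_def_on_mult:
  assumes "pos_def_on S k" "pos_def_on S l"
  shows "pos_def_on S (\<lambda>x y. k x y * l x y)"
proof (rule pos_def_onI)
  fix X w assume X: "finite X" "X \<subseteq> S"
  show "0 \<le> (\<Sum>x\<in>X. \<Sum>y\<in>X. w x * w y * (k x y * l x y))"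
    by (rule pos_def_on_mult_aux) (use X assms pos_def_on_subset in auto)
qed (use assms pos_def_on_sym in metis)

lemma pos_def_on_power:
  assumes "pos_def_on S k"
  shows "pos_def_on S (\<lambda>x y. k x y ^ j)"
  by (induction j) (simp_all add: pos_def_on_const pos_def_on_mult assms)

text \<open>The coefficient \<open>a gchoose Suc j\<close> contains the factors
  \<open>a, a - 1, ..., a - j\<close>, of which only the first is positive when
  \<open>a \<le> 1\<close>; its sign is cancelled by that of \<open>(- k) ^ Suc j\<close>. So
  \<open>l\<close>, which stands for \<open>1 - (1 - k)^a\<close>, is a series with nonnegative
  coefficients in powers of \<open>k\<close>.\<close>

lemma pos_def_on_neg_gbinomial_sums:
  assumes k: "pos_def_on S k" and a: "0 < a" "a \<le> 1"
    and l: "\<And>x y. x \<in> S \<Longrightarrow> y \<in> S \<Longrightarrow> (\<lambda>j. - ((a gchoose Suc j) * (- k x y) ^ Suc j)) sums l x y"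
  shows "pos_def_on S l"
proof (rule pos_def_on_LIMSEQ)
  fix m
  have pr: "0 \<le> (\<Prod>i<j. real i + 1 - a)" for j
    using a by (intro prod_nonneg) auto
  have c: "- ((a gchoose Suc j) * (- 1) ^ Suc j) \<ge> 0" for j
  proof -
    have "a gchoose Suc j = (\<Prod>i\<in>{0..j}. a - of_nat i) / fact (Suc j)"
      by (simp add: gbinomial_prod_rev atLeastLessThanSuc_atLeastAtMost)
    also have "(\<Prod>i\<in>{0..j}. a - of_nat i) = a * (\<Prod>i<j. a - real (Suc i))"
      by (simp add: prod.atLeast0_atMost_Suc_shift atLeast0AtMost prod.atMost_shift)
    also have "(\<Prod>i<j. a - real (Suc i)) = (-1) ^ j * (\<Prod>i<j. real i + 1 - a)"
      by (induction j) (simp_all add: algebra_simps)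
    finally have "- ((a gchoose Suc j) * (- 1) ^ Suc j) =
        a * (\<Prod>i<j. real i + 1 - a) / fact (Suc j) * ((-1)^j * (-1)^j)"
      by simp
    also have "\<dots> \<ge> 0" using pr a by (simp flip: power_add mult_2)
    finally show ?thesis .
  qed
  have "- ((a gchoose Suc j) * (- k x y) ^ Suc j) = (- ((a gchoose Suc j) * (- 1) ^ Suc j)) * k x y ^ Suc j"
    for x y j by (subst power_minus) simp
  then have "pos_def_on S (\<lambda>x y. - ((a gchoose Suc j) * (- k x y) ^ Suc j))" for j
    using pos_def_on_scale[OF pos_def_on_power[OF k, of "Suc j"] c[of j]] by (simp only:)
  then show "pos_def_on S (\<lambda>x y. \<Sum>j<m. - ((a gchoose Suc j) * (- k x y) ^ Suc j))"
    by (intro pos_def_on_sum)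
qed (use l in \<open>simp add: sums_def\<close>)

text \<open>With \<open>u = 1 - D / C\<close> the claim concerns \<open>1 - (1 - u)^a\<close>. The
  series requires \<open>\<bar>u\<bar> \<le> 1\<close>: the upper bound is \<open>D \<ge> 0\<close>,
  the lower one is positive definiteness on two points with both weights 1, since
  \<open>u x x = 1\<close>.\<close>

lemma pos_def_on_powr:
  assumes k: "pos_def_on S (\<lambda>x y. C - D x y)" and C: "0 < C" and a: "0 < a" "a \<le> 1"
    and D: "\<And>x y. x \<in> S \<Longrightarrow> y \<in> S \<Longrightarrow> 0 \<le> D x y" "\<And>x. x \<in> S \<Longrightarrow> D x x = 0"
  shows "pos_def_on S (\<lambda>x y. C powr a - D x y powr a)"
proof -
  define u where "u x y = 1 - D x y / C" for x y
  have u: "pos_def_on S u"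
    using pos_def_on_scale[OF k, of "1 / C"] C by (simp add: u_def[abs_def] field_simps)
  have bd: "\<bar>u x y\<bar> \<le> 1" if "x \<in> S" "y \<in> S" for x y
  proof -
    have "u x y \<le> 1" using D(1)[OF that] C by (simp add: u_def)
    moreover have "- 1 \<le> u x y"
    proof (cases "x = y")
      case True
      then show ?thesis using D(2) that by (simp add: u_def)
    next
      case False
      then show ?thesis using pos_def_on_pair[OF u that, of 1 1] D(2) that by (simp add: u_def)
    qed
    ultimately show ?thesis by simp
  qed
  \<comment> \<open>The binomial series is used strictly inside its disc of convergence; the factors
    \<open>\<rho> m\<close>, tending to 1 from below, reach the boundary values of \<open>u\<close>
    in the limit.\<close>
  define \<rho> where "\<rho> m = real m / real (Suc m)" for m
  have \<rho>: "0 \<le> \<rho> m" "\<rho> m < 1" for m by (auto simp: \<rho>_def)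
  have \<rho>lim: "\<rho> \<longlonglongrightarrow> 1" unfolding \<rho>_def using LIMSEQ_n_over_Suc_n by simp
  have "pos_def_on S (\<lambda>x y. 1 - (1 - \<rho> m * u x y) powr a)" for m
  proof (rule pos_def_on_neg_gbinomial_sums[OF pos_def_on_scale[OF u \<rho>(1)] a])
    fix x y assume "x \<in> S" "y \<in> S"
    then have "\<rho> m * \<bar>u x y\<bar> < 1"
      using bd[of x y] \<rho>[of m] by (meson abs_ge_zero le_less_trans mult_left_le)
    then have "\<bar>- (\<rho> m * u x y)\<bar> < 1" using \<rho>[of m] by (simp add: abs_mult)
    from gen_binomial_real[OF this, of a]
    have "(\<lambda>j. (a gchoose j) * (- (\<rho> m * u x y)) ^ j) sums (1 - \<rho> m * u x y) powr a" by simp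
    then have "(\<lambda>j. (a gchoose Suc j) * (- (\<rho> m * u x y)) ^ Suc j) sums ((1 - \<rho> m * u x y) powr a - 1)"
      by (subst sums_Suc_iff) simp
    from sums_minus[OF this]
    show "(\<lambda>j. - ((a gchoose Suc j) * (- (\<rho> m * u x y)) ^ Suc j)) sums (1 - (1 - \<rho> m * u x y) powr a)"
      by simp
  qed
  moreover have "(\<lambda>m. 1 - (1 - \<rho> m * u x y) powr a) \<longlonglongrightarrow> 1 - (1 - 1 * u x y) powr a"
    if "x \<in> S" "y \<in> S" for x y
    using a \<rho>lim bd[OF that] \<rho>
    by (intro tendsto_diff tendsto_const tendsto_powr' tendsto_mult)
      (auto intro!: always_eventually simp: mult_le_one abs_le_iff less_imp_le intro: order.trans[OF mult_left_le])
  ultimately have "pos_def_on S (\<lambda>x y. 1 - (1 - 1 * u x y) powr a)"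
    by (rule pos_def_on_LIMSEQ)
  then have "pos_def_on S (\<lambda>x y. C powr a * (1 - (1 - 1 * u x y) powr a))"
    by (rule pos_def_on_scale) simp
  then show ?thesis
  proof (rule pos_def_on_cong)
    fix x y assume "x \<in> S" "y \<in> S"
    then have "(D x y / C) powr a = D x y powr a / C powr a"
      using D(1) C by (simp add: powr_divide)
    then show "C powr a * (1 - (1 - 1 * u x y) powr a) = C powr a - D x y powr a"
      using C by (simp add: u_def field_simps)
  qed
qed

section \<open>Kernels on an interval\<close>

definition ramp :: "real \<Rightarrow> real \<Rightarrow> real" where
  "ramp u x = max 0 (min u x)"

text \<open>For \<open>z \<ge> 0\<close> this is half the squared L2 distance between two ramps of
  height \<open>u\<close> that start at distance \<open>z\<close>. It is homogeneous of degree 3 in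
  \<open>u\<close> and \<open>z\<close> jointly.\<close>

definition ramp_gap :: "real \<Rightarrow> real \<Rightarrow> real" where
  "ramp_gap u z = (if z \<le> u then u * z\<^sup>2 / 2 - z ^ 3 / 6 else u\<^sup>2 * z / 2 - u ^ 3 / 6)"

lemma has_integral_quadratic:
  fixes a b s t :: real
  assumes "a \<le> b"
  shows "((\<lambda>x. (x - s) * (x - t)) has_integral
    (b ^ 3 / 3 - (s + t) * b\<^sup>2 / 2 + s * t * b) - (a ^ 3 / 3 - (s + t) * a\<^sup>2 / 2 + s * t * a)) {a..b}"
  using assms
  by (intro fundamental_theorem_of_calculus)
    (auto simp flip: has_real_derivative_iff_has_vector_derivative
      intro!: derivative_eq_intros simp: algebra_simps power2_eq_square)

lemma has_integral_linear:
  fixes a b t u :: real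
  assumes "a \<le> b"
  shows "((\<lambda>x. u * (x - t)) has_integral (u * (b - t)\<^sup>2 / 2 - u * (a - t)\<^sup>2 / 2)) {a..b}"
  using assms
  by (intro fundamental_theorem_of_calculus)
    (auto simp flip: has_real_derivative_iff_has_vector_derivative
      intro!: derivative_eq_intros simp: field_simps)

text \<open>The product vanishes left of \<open>t\<close>, where the later ramp starts, and is
  \<open>u\<^sup>2\<close> right of \<open>t + u\<close>. The earlier ramp saturates at
  \<open>s + u\<close>, which lies either after or before \<open>t\<close>; these are the two
  branches of \<open>ramp_gap\<close>.\<close>

lemma has_integral_ramp_mult:
  fixes s t u X :: real
  assumes "s \<le> t" "0 \<le> u" "t + u \<le> X" "- X \<le> t"
  shows "((\<lambda>x. ramp u (x - s) * ramp u (x - t)) has_integral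
     u ^ 3 / 3 - ramp_gap u (t - s) + u\<^sup>2 * (t - s) / 2 + u\<^sup>2 * (X - t - u)) {-X..X}"
proof -
  let ?f = "\<lambda>x. ramp u (x - s) * ramp u (x - t)"
  have left: "(?f has_integral 0) {-X..t}"
    by (rule has_integral_eq[OF _ has_integral_0]) (use assms in \<open>auto simp: ramp_def\<close>)
  have "((\<lambda>x. u\<^sup>2) has_integral u\<^sup>2 * (X - t - u)) {t+u..X}"
    using has_integral_const_real[of "u\<^sup>2" "t + u" X] assms by (simp add: mult.commute diff_diff_eq)
  then have right: "(?f has_integral u\<^sup>2 * (X - t - u)) {t+u..X}"
    by (rule has_integral_eq[rotated]) (use assms in \<open>auto simp: ramp_def power2_eq_square\<close>)
  have mid: "(?f has_integral u ^ 3 / 3 - ramp_gap u (t - s) + u\<^sup>2 * (t - s) / 2) {t..t+u}"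
  proof (cases "t - s \<le> u")
    case True
    then have gap: "ramp_gap u (t - s) = u * (t - s)\<^sup>2 / 2 - (t - s) ^ 3 / 6"
      by (simp add: ramp_gap_def)
    have 1: "(?f has_integral ((s+u) ^ 3 / 3 - (s + t) * (s+u)\<^sup>2 / 2 + s * t * (s+u))
        - (t ^ 3 / 3 - (s + t) * t\<^sup>2 / 2 + s * t * t)) {t..s+u}"
      by (rule has_integral_eq[OF _ has_integral_quadratic])
        (use assms True in \<open>auto simp: ramp_def\<close>)
    have 2: "(?f has_integral (u * (t+u - t)\<^sup>2 / 2 - u * (s+u - t)\<^sup>2 / 2)) {s+u..t+u}"
      by (rule has_integral_eq[OF _ has_integral_linear])
        (use assms True in \<open>auto simp: ramp_def\<close>)
    have "(?f has_integral ((s+u) ^ 3 / 3 - (s + t) * (s+u)\<^sup>2 / 2 + s * t * (s+u))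
        - (t ^ 3 / 3 - (s + t) * t\<^sup>2 / 2 + s * t * t)
        + (u * (t+u - t)\<^sup>2 / 2 - u * (s+u - t)\<^sup>2 / 2)) {t..t+u}"
      by (rule has_integral_combine[OF _ _ 1 2]) (use assms True in auto)
    then show ?thesis
      by (rule has_integral_eq_rhs)
        (simp add: gap power2_eq_square power3_eq_cube field_simps)
  next
    case False
    then have gap: "ramp_gap u (t - s) = u\<^sup>2 * (t - s) / 2 - u ^ 3 / 6"
      by (simp add: ramp_gap_def)
    have "(?f has_integral (u * (t+u - t)\<^sup>2 / 2 - u * (t - t)\<^sup>2 / 2)) {t..t+u}"
      by (rule has_integral_eq[OF _ has_integral_linear])
        (use assms False in \<open>auto simp: ramp_def\<close>)
    then show ?thesis
      by (rule has_integral_eq_rhs)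
        (simp add: gap power2_eq_square power3_eq_cube field_simps)
  qed
  have "(?f has_integral 0 + (u ^ 3 / 3 - ramp_gap u (t - s) + u\<^sup>2 * (t - s) / 2)) {-X..t+u}"
    by (rule has_integral_combine[OF _ _ left mid]) (use assms in auto)
  from has_integral_combine[OF _ _ this right]
  show ?thesis using assms by simp
qed

text \<open>Adding the Gram kernel of the ramps to its reflection cancels the terms linear in
  \<open>s\<close> and \<open>t\<close>.\<close>

lemma pos_def_on_ramp_gap:
  assumes u: "0 \<le> u"
  shows "pos_def_on {-1/2..1/2} (\<lambda>s t. u ^ 3 / 3 + u\<^sup>2 / 2 - ramp_gap u \<bar>s - t\<bar>)"
proof -
  \<comment> \<open>The window is just large enough for every ramp starting in
    \<open>{-1/2..1/2}\<close>, and every reflected one, to saturate inside it.\<close>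
  define X where "X = 1 / 2 + u"
  let ?f = "\<lambda>x s t. ramp u (x - s) * ramp u (x - t)"
  have "pos_def_on {-1/2..1/2} (\<lambda>s t. 2 * (u ^ 3 / 3 + u\<^sup>2 / 2 - ramp_gap u \<bar>s - t\<bar>))"
  proof (rule pos_def_on_has_integral[where k = "\<lambda>x s t. ?f x s t + ?f x (- s) (- t)" and T = "{-X..X}"])
    have aux: "((\<lambda>x. ?f x s t + ?f x (- s) (- t)) has_integral
        2 * (u ^ 3 / 3 + u\<^sup>2 / 2 - ramp_gap u \<bar>s - t\<bar>)) {-X..X}"
      if st: "s \<in> {-1/2..1/2}" "t \<in> {-1/2..1/2}" "s \<le> t" for s t :: real
    proof -
      have "(\<lambda>x. ?f x s t + ?f x (- s) (- t)) = (\<lambda>x. ?f x s t + ?f x (- t) (- s))"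
        by (simp only: mult.commute)
      moreover have "((\<lambda>x. ?f x s t + ?f x (- t) (- s)) has_integral
        (u ^ 3 / 3 - ramp_gap u (t - s) + u\<^sup>2 * (t - s) / 2 + u\<^sup>2 * (X - t - u)) +
        (u ^ 3 / 3 - ramp_gap u (- s - - t) + u\<^sup>2 * (- s - - t) / 2 + u\<^sup>2 * (X - - s - u))) {-X..X}"
        using st u unfolding X_def
        by (intro has_integral_add has_integral_ramp_mult) auto
      moreover have "(u ^ 3 / 3 - ramp_gap u (t - s) + u\<^sup>2 * (t - s) / 2 + u\<^sup>2 * (X - t - u)) +
        (u ^ 3 / 3 - ramp_gap u (- s - - t) + u\<^sup>2 * (- s - - t) / 2 + u\<^sup>2 * (X - - s - u))
        = 2 * (u ^ 3 / 3 + u\<^sup>2 / 2 - ramp_gap u \<bar>s - t\<bar>)"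
        using st by (simp add: X_def field_simps abs_if)
      ultimately show ?thesis by (simp only:)
    qed
    show "((\<lambda>x. ?f x s t + ?f x (- s) (- t)) has_integral
        2 * (u ^ 3 / 3 + u\<^sup>2 / 2 - ramp_gap u \<bar>s - t\<bar>)) {-X..X}"
      if st: "s \<in> {-1/2..1/2}" "t \<in> {-1/2..1/2}" for s t :: real
      using aux[of s t] aux[of t s] st by (cases "s \<le> t") (simp_all add: abs_minus_commute mult.commute)
  qed (intro pos_def_on_add pos_def_on_rank_one)
  then have "pos_def_on {-1/2..1/2} (\<lambda>s t. 1 / 2 * (2 * (u ^ 3 / 3 + u\<^sup>2 / 2 - ramp_gap u \<bar>s - t\<bar>)))"
    by (rule pos_def_on_scale) simp
  then show ?thesis
    by (rule pos_def_on_cong) simp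
qed

lemma has_integral_powr_interval:
  fixes a x y :: real
  assumes "0 < x" "x \<le> y" "a \<noteq> -1"
  shows "((\<lambda>u. u powr a) has_integral (y powr (a + 1) / (a + 1) - x powr (a + 1) / (a + 1))) {x..y}"
  using assms
  by (intro fundamental_theorem_of_calculus)
    (auto simp flip: has_real_derivative_iff_has_vector_derivative
      intro!: derivative_eq_intros)

lemma power_mult_powr:
  fixes u a :: real
  assumes "0 \<le> u"
  shows "u * u powr a = u powr (a + 1)" "u\<^sup>2 * u powr a = u powr (a + 2)"
    "u ^ 3 * u powr a = u powr (a + 3)"
  using assms by (cases "u = 0"; simp add: powr_add)+

text \<open>By homogeneity the integral over all \<open>u > 0\<close> is a multiple of
  \<open>z powr q\<close>, which dictates the weight \<open>u powr (q - 4)\<close>. Stopping at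
  \<open>u = 1\<close> keeps the matching constants \<open>u ^ 3 / 3\<close> integrable; the cut-off
  tail, where \<open>z \<le> u\<close>, is the quadratic term minus the cubic one. Convergence at 0
  needs \<open>1 < q\<close>, the finite quadratic tail needs \<open>q < 2\<close>.\<close>

lemma has_integral_powr_ramp_gap:
  fixes q z :: real
  assumes q: "1 < q" "q < 2" and z: "0 \<le> z" "z \<le> 1"
  shows "((\<lambda>u. ramp_gap u z * u powr (q - 4)) has_integral
    (1 / (2 * (q - 1)) - 1 / (6 * q) + 1 / (2 * (2 - q)) - 1 / (6 * (3 - q))) * z powr q
    - z\<^sup>2 / (2 * (2 - q)) + z ^ 3 / (6 * (3 - q))) {0..1}"
proof (cases "z = 0")
  case True
  show ?thesis
    by (rule has_integral_eq[OF _ has_integral_eq_rhs[OF has_integral_0]])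
      (auto simp: True ramp_gap_def)
next
  case False
  then have z0: "0 < z" using z by simp
  note zp = power_mult_powr[OF z(1)]
  have up: "u\<^sup>2 * u powr (q - 4) = u powr (q - 2)" "u ^ 3 * u powr (q - 4) = u powr (q - 1)"
    "u * u powr (q - 4) = u powr (q - 3)" if "0 \<le> u" for u
    using power_mult_powr[OF that, of "q - 4"] by simp_all
  have 1: "((\<lambda>u. ramp_gap u z * u powr (q - 4)) has_integral
      z / 2 * (z powr (q - 2 + 1) / (q - 2 + 1)) - 1 / 6 * (z powr (q - 1 + 1) / (q - 1 + 1))) {0..z}"
  proof (rule has_integral_eq[OF _ has_integral_diff[OF has_integral_mult_right has_integral_mult_right]])
    fix u assume "u \<in> {0..z}"
    then show "z / 2 * u powr (q - 2) - 1 / 6 * u powr (q - 1) = ramp_gap u z * u powr (q - 4)"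
      using up[of u] by (cases "u = z") (auto simp: ramp_gap_def algebra_simps power2_eq_square power3_eq_cube)
  qed ((rule has_integral_powr_from_0; use q z in simp)+)
  have 2: "((\<lambda>u. ramp_gap u z * u powr (q - 4)) has_integral
      z\<^sup>2 / 2 * (1 powr (q - 3 + 1) / (q - 3 + 1) - z powr (q - 3 + 1) / (q - 3 + 1))
      - z ^ 3 / 6 * (1 powr (q - 4 + 1) / (q - 4 + 1) - z powr (q - 4 + 1) / (q - 4 + 1))) {z..1}"
  proof (rule has_integral_eq[OF _ has_integral_diff[OF has_integral_mult_right has_integral_mult_right]])
    fix u assume "u \<in> {z..1}"
    then show "z\<^sup>2 / 2 * u powr (q - 3) - z ^ 3 / 6 * u powr (q - 4) = ramp_gap u z * u powr (q - 4)"
      using up[of u] z0 by (auto simp: ramp_gap_def algebra_simps)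
  qed ((rule has_integral_powr_interval; use q z z0 in simp)+)
  have frac: "A / c * (x / (- d) - P / (- d)) = A * P / (c * d) - A * x / (c * d)" for A c x d P :: real
    by (simp add: right_diff_distrib)
  show ?thesis
    using has_integral_combine[OF z 1 2]
  proof (rule has_integral_eq_rhs)
    have "q - 1 \<noteq> 0" "q \<noteq> 0" "2 - q \<noteq> 0" "3 - q \<noteq> 0" using q by auto
    moreover have "z / 2 * (z powr (q - 2 + 1) / (q - 2 + 1)) = z powr q / (2 * (q - 1))"
      using zp(1)[of "q - 1"] by simp
    moreover have "z\<^sup>2 / 2 * (1 powr (q - 3 + 1) / (q - 3 + 1) - z powr (q - 3 + 1) / (q - 3 + 1))
       = z powr q / (2 * (2 - q)) - z\<^sup>2 / (2 * (2 - q))"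
    proof -
      have "z\<^sup>2 / 2 * (1 powr (q - 3 + 1) / (q - 3 + 1) - z powr (q - 3 + 1) / (q - 3 + 1))
        = (z\<^sup>2 * z powr (q - 2)) / (2 * (2 - q)) - z\<^sup>2 / (2 * (2 - q))"
        using frac[of "z\<^sup>2" 2 "1 powr (q - 2)" "2 - q" "z powr (q - 2)"] by simp
      then show ?thesis using zp(2)[of "q - 2"] by simp
    qed
    moreover have "z ^ 3 / 6 * (1 powr (q - 4 + 1) / (q - 4 + 1) - z powr (q - 4 + 1) / (q - 4 + 1))
       = z powr q / (6 * (3 - q)) - z ^ 3 / (6 * (3 - q))"
    proof -
      have "z ^ 3 / 6 * (1 powr (q - 4 + 1) / (q - 4 + 1) - z powr (q - 4 + 1) / (q - 4 + 1))
        = (z ^ 3 * z powr (q - 3)) / (6 * (3 - q)) - z ^ 3 / (6 * (3 - q))"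
        using frac[of "z ^ 3" 6 "1 powr (q - 3)" "3 - q" "z powr (q - 3)"] by simp
      then show ?thesis using zp(3)[of "q - 3"] by simp
    qed
    ultimately show "(1 / (2 * (q - 1)) - 1 / (6 * q) + 1 / (2 * (2 - q)) - 1 / (6 * (3 - q))) * z powr q
    - z\<^sup>2 / (2 * (2 - q)) + z ^ 3 / (6 * (3 - q))
      = z / 2 * (z powr (q - 2 + 1) / (q - 2 + 1)) - 1 / 6 * (z powr (q - 1 + 1) / (q - 1 + 1))
      + (z\<^sup>2 / 2 * (1 powr (q - 3 + 1) / (q - 3 + 1) - z powr (q - 3 + 1) / (q - 3 + 1))
      - z ^ 3 / 6 * (1 powr (q - 4 + 1) / (q - 4 + 1) - z powr (q - 4 + 1) / (q - 4 + 1)))"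
      by (simp add: algebra_simps)
  qed
qed

text \<open>A positive combination of the functions \<open>ramp_gap u\<close> equals \<open>z powr q\<close> on the unit interval:
  the quadratic and cubic terms left over by the integral over \<open>u \<in> {0..1}\<close> are proportional to
  \<open>ramp_gap U\<close> for \<open>U = (3 - q) / (2 - q)\<close>.\<close>

lemma pos_def_on_interval_powr_aux:
  fixes q :: real
  assumes q: "1 < q" "q < 2"
  shows "\<exists>C. pos_def_on {-1/2..1/2} (\<lambda>s t. C - \<bar>s - t\<bar> powr q)"
proof -
  define \<kappa> where "\<kappa> = 1 / (2 * (q - 1)) - 1 / (6 * q) + 1 / (2 * (2 - q)) - 1 / (6 * (3 - q))"
  have "1 / (6 * q) < 1 / (2 * (q - 1))" "1 / (6 * (3 - q)) < 1 / (2 * (2 - q))"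
    using q by (intro divide_strict_left_mono; simp)+
  then have \<kappa>: "0 < \<kappa>" unfolding \<kappa>_def by linarith
  \<comment> \<open>\<open>U\<close> is chosen so that \<open>ramp_gap U z / (3 - q)\<close> is
    precisely the missing tail. As \<open>U \<ge> 1\<close>, all distances occurring here fall into
    its first branch.\<close>
  define U where "U = (3 - q) / (2 - q)"
  have U: "1 \<le> U" "0 \<le> U" using q by (auto simp: U_def)
  \<comment> \<open>\<open>C1\<close> is the integral of
    \<open>(u ^ 3 / 3 + u\<^sup>2 / 2) * u powr (q - 4)\<close> over \<open>{0..1}\<close>, left in
    the form delivered by the power rule; \<open>C2\<close> is the constant belonging to
    \<open>U\<close>.\<close>
  define C1 where "C1 = 1 / 3 * (1 powr (q - 1 + 1) / (q - 1 + 1)) + 1 / 2 * (1 powr (q - 2 + 1) / (q - 2 + 1))"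
  define C2 where "C2 = 1 / (3 - q) * (U ^ 3 / 3 + U\<^sup>2 / 2)"
  let ?I = "\<lambda>z. \<kappa> * z powr q - z\<^sup>2 / (2 * (2 - q)) + z ^ 3 / (6 * (3 - q))"
  have "pos_def_on {-1/2..1/2} (\<lambda>s t. C1 - ?I \<bar>s - t\<bar>)"
  proof (rule pos_def_on_has_integral)
    fix u :: real assume u: "u \<in> {0..1}"
    show "pos_def_on {-1/2..1/2} (\<lambda>s t. u powr (q - 4) * (u ^ 3 / 3 + u\<^sup>2 / 2 - ramp_gap u \<bar>s - t\<bar>))"
      using u by (intro pos_def_on_scale pos_def_on_ramp_gap) auto
  next
    fix s t :: real assume st: "s \<in> {-1/2..1/2}" "t \<in> {-1/2..1/2}"
    have up: "u\<^sup>2 * u powr (q - 4) = u powr (q - 2)" "u ^ 3 * u powr (q - 4) = u powr (q - 1)"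
      if "0 \<le> u" for u :: real
      using power_mult_powr[OF that, of "q - 4"] by simp_all
    have "((\<lambda>u. (1 / 3 * u powr (q - 1) + 1 / 2 * u powr (q - 2)) - ramp_gap u \<bar>s - t\<bar> * u powr (q - 4))
        has_integral C1 - ?I \<bar>s - t\<bar>) {0..1}"
      unfolding C1_def \<kappa>_def using q st
      by (intro has_integral_diff has_integral_add has_integral_mult_right has_integral_powr_from_0
          has_integral_powr_ramp_gap) auto
    then show "((\<lambda>u. u powr (q - 4) * (u ^ 3 / 3 + u\<^sup>2 / 2 - ramp_gap u \<bar>s - t\<bar>))
        has_integral C1 - ?I \<bar>s - t\<bar>) {0..1}"
      by (rule has_integral_eq[rotated]) (use up in \<open>auto simp: algebra_simps\<close>)
  qed
  moreover have "pos_def_on {-1/2..1/2} (\<lambda>s t. 1 / (3 - q) * (U ^ 3 / 3 + U\<^sup>2 / 2 - ramp_gap U \<bar>s - t\<bar>))"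
    using q U by (intro pos_def_on_scale pos_def_on_ramp_gap) auto
  ultimately have "pos_def_on {-1/2..1/2} (\<lambda>s t. 1 / \<kappa> * (C1 - ?I \<bar>s - t\<bar>
      + 1 / (3 - q) * (U ^ 3 / 3 + U\<^sup>2 / 2 - ramp_gap U \<bar>s - t\<bar>)))"
    by (rule pos_def_on_scale[OF pos_def_on_add]) (use \<kappa> in simp)
  then have "pos_def_on {-1/2..1/2} (\<lambda>s t. (C1 + C2) / \<kappa> - \<bar>s - t\<bar> powr q)"
  proof (rule pos_def_on_cong)
    fix s t :: real assume st: "s \<in> {-1/2..1/2}" "t \<in> {-1/2..1/2}"
    define z where "z = \<bar>s - t\<bar>"
    have "z \<le> U" using st U unfolding z_def by auto
    then have "1 / (3 - q) * ramp_gap U z = 1 / (3 - q) * (U * z\<^sup>2 / 2 - z ^ 3 / 6)"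
      by (simp add: ramp_gap_def)
    also have "\<dots> = z\<^sup>2 / (2 * (2 - q)) - z ^ 3 / (6 * (3 - q))"
      using q unfolding U_def by (simp add: right_diff_distrib mult.commute)
    finally have comb: "C1 - ?I z + 1 / (3 - q) * (U ^ 3 / 3 + U\<^sup>2 / 2 - ramp_gap U z)
      = C1 + C2 - \<kappa> * z powr q"
      unfolding C2_def right_diff_distrib by linarith
    show "1 / \<kappa> * (C1 - ?I \<bar>s - t\<bar> + 1 / (3 - q) * (U ^ 3 / 3 + U\<^sup>2 / 2 - ramp_gap U \<bar>s - t\<bar>))
      = (C1 + C2) / \<kappa> - \<bar>s - t\<bar> powr q"
      unfolding z_def[symmetric] comb using \<kappa> by (simp add: diff_divide_distrib)
  qed
  then show ?thesis by blast
qed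

text \<open>The mixture of ramps converges only for \<open>q > 1\<close>; smaller exponents are
  fractional powers of the case \<open>3/2\<close>. Dividing by \<open>2 * R\<close> maps
  \<open>{-R..R}\<close> to the unit interval, whence the dependence on \<open>R\<close>.\<close>

lemma pos_def_on_interval_powr:
  fixes q :: real
  assumes q: "0 < q" "q < 2"
  obtains C where "0 < C" "\<And>R. 0 < R \<Longrightarrow> pos_def_on {-R..R} (\<lambda>s t. C * R powr q - \<bar>s - t\<bar> powr q)"
proof -
  \<comment> \<open>Equal weights at the two endpoints, at distance 1, give
    \<open>4 * C - 2 \<ge> 0\<close>.\<close>
  have pos: "0 < C" if "pos_def_on {-1/2..1/2} (\<lambda>s t. C - \<bar>s - t\<bar> powr q)" "0 < q" for C q :: real
    using pos_def_on_pair[OF that(1), of "-1/2" "1/2" 1 1] pos_def_on_diag[OF that(1), of 0] that(2) by simp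
  have "\<exists>C. pos_def_on {-1/2..1/2} (\<lambda>s t. C - \<bar>s - t\<bar> powr q)"
  proof (cases "1 < q")
    case True
    then show ?thesis using pos_def_on_interval_powr_aux q by blast
  next
    case False
    obtain C where C: "pos_def_on {-1/2..1/2} (\<lambda>s t. C - \<bar>s - t\<bar> powr (3/2))"
      using pos_def_on_interval_powr_aux[of "3/2"] by auto
    from pos_def_on_powr[OF C pos[OF C], of "q / (3/2)"] q False
    have "pos_def_on {-1/2..1/2} (\<lambda>s t. C powr (q / (3/2)) - \<bar>s - t\<bar> powr q)"
      by (simp add: powr_powr)
    then show ?thesis by blast
  qed
  then obtain C where C: "pos_def_on {-1/2..1/2} (\<lambda>s t. C - \<bar>s - t\<bar> powr q)" by blast
  have C0: "0 < C" using pos[OF C q(1)] .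
  have "pos_def_on {-R..R} (\<lambda>s t. C * 2 powr q * R powr q - \<bar>s - t\<bar> powr q)" if R: "0 < R" for R
  proof -
    have "pos_def_on {-R..R} (\<lambda>s t. C - \<bar>s / (2*R) - t / (2*R)\<bar> powr q)"
      using R by (intro pos_def_on_comp[OF C]) (auto simp: field_simps)
    from pos_def_on_scale[OF this, of "(2 * R) powr q"]
    have "pos_def_on {-R..R} (\<lambda>s t. (2 * R) powr q * (C - \<bar>s / (2*R) - t / (2*R)\<bar> powr q))" by simp
    then show ?thesis
    proof (rule pos_def_on_cong)
      fix s t
      have "\<bar>s / (2*R) - t / (2*R)\<bar> = \<bar>s - t\<bar> / (2*R)"
        using R by (simp add: diff_divide_distrib[symmetric])
      then show "(2 * R) powr q * (C - \<bar>s / (2*R) - t / (2*R)\<bar> powr q) = C * 2 powr q * R powr q - \<bar>s - t\<bar> powr q"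
        using R by (simp add: powr_divide powr_mult right_diff_distrib)
    qed
  qed
  then show ?thesis using that[of "C * 2 powr q"] C0 by simp
qed

section \<open>Energies and positive definiteness\<close>

lemma bounded_integrable:
  fixes f :: "'a \<Rightarrow> real"
  assumes "finite_measure \<alpha>" "sets \<alpha> = sets M" "f \<in> borel_measurable M"
    and "\<And>x. x \<in> space M \<Longrightarrow> \<bar>f x\<bar> \<le> b"
  shows "integrable \<alpha> f"
proof -
  interpret finite_measure \<alpha> by fact
  show ?thesis
    using assms(2-) sets_eq_imp_space_eq[OF assms(2)]
    by (intro integrable_const_bound[of _ b]) (auto cong: measurable_cong_sets)
qed

text \<open>If both signs failed at every point, then
  \<open>\<bar>h\<bar> \<le> (- l - 1) / T\<close> throughout, where \<open>l\<close> is the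
  difference of the integrals. Integrating would give \<open>- l \<le> - l - 1\<close>.\<close>

lemma exists_signed_point_le:
  fixes h :: "'a \<Rightarrow> real"
  assumes \<alpha>: "finite_measure \<alpha>" "sets \<alpha> = sets M" and \<beta>: "finite_measure \<beta>" "sets \<beta> = sets M"
    and h: "h \<in> borel_measurable M" "\<And>x. x \<in> space M \<Longrightarrow> \<bar>h x\<bar> \<le> b"
    and T: "T = measure \<alpha> (space M) + measure \<beta> (space M)" "0 < T"
  shows "\<exists>x\<in>space M. \<exists>t. \<bar>t\<bar> = T \<and> t * h x \<le> (\<integral>x. h x \<partial>\<alpha>) - (\<integral>x. h x \<partial>\<beta>) + 1"
proof (rule ccontr)
  interpret \<alpha>: finite_measure \<alpha> by fact
  interpret \<beta>: finite_measure \<beta> by fact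
  define l where "l = (\<integral>x. h x \<partial>\<alpha>) - (\<integral>x. h x \<partial>\<beta>)"
  have sp: "space \<alpha> = space M" "space \<beta> = space M"
    using sets_eq_imp_space_eq[OF \<alpha>(2)] sets_eq_imp_space_eq[OF \<beta>(2)] by auto
  assume "\<not> ?thesis"
  then have "T * h x > l + 1 \<and> (- T) * h x > l + 1" if "x \<in> space M" for x
    using that T(2) unfolding l_def
    by (metis abs_minus_cancel abs_of_pos not_less)
  then have bd: "\<bar>h x\<bar> \<le> (- l - 1) / T" if "x \<in> space M" for x
    using that T(2) by (fastforce simp: field_simps abs_le_iff)
  have ia: "integrable \<alpha> h" "integrable \<beta> h"
    using bounded_integrable[OF \<alpha> h] bounded_integrable[OF \<beta> h] by auto
  have A: "(\<integral>x. - h x \<partial>\<alpha>) \<le> (- l - 1) / T * measure \<alpha> (space M)"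
    using integral_mono[of \<alpha> "\<lambda>x. - h x" "\<lambda>_. (- l - 1) / T"] ia bd sp
    by (simp add: abs_le_iff mult.commute)
  have B: "(\<integral>x. h x \<partial>\<beta>) \<le> (- l - 1) / T * measure \<beta> (space M)"
    using integral_mono[of \<beta> "\<lambda>x. h x" "\<lambda>_. (- l - 1) / T"] ia bd sp
    by (simp add: abs_le_iff mult.commute)
  have "- l \<le> (- l - 1) / T * T"
    using A B unfolding T(1) distrib_left l_def by simp
  then show False using T(2) by simp
qed

text \<open>Random sampling. With weights \<open>\<plusminus>T\<close>, a point drawn from the total variation has on average the
  same effect as \<open>\<mu> = \<alpha> - \<beta>\<close> itself. Adding \<open>m\<close> such points to a configuration of energy \<open>E\<close> and
  potential \<open>U\<close> gives expected energy \<open>E + 2 m U + m (m - 1) I\<close> up to diagonal terms of order \<open>m\<close>,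
  where \<open>I\<close> is the energy of \<open>\<mu>\<close>; positive definiteness of the discrete energies thus forces \<open>I \<ge> 0\<close>.\<close>

lemma pos_def_on_signed_integral_nonneg:
  fixes k :: "'a \<Rightarrow> 'a \<Rightarrow> real"
  assumes k: "pos_def_on (space M) k"
    and km: "(\<lambda>(x, y). k x y) \<in> borel_measurable (M \<Otimes>\<^sub>M M)"
    and kb: "\<And>x y. x \<in> space M \<Longrightarrow> y \<in> space M \<Longrightarrow> \<bar>k x y\<bar> \<le> b"
    and \<alpha>: "finite_measure \<alpha>" "sets \<alpha> = sets M" and \<beta>: "finite_measure \<beta>" "sets \<beta> = sets M"
    and L: "\<And>f. L f = (\<integral>x. f x \<partial>\<alpha>) - (\<integral>x. f x \<partial>\<beta>)"
  shows "0 \<le> L (\<lambda>y. L (\<lambda>x. k x y))"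
proof -
  interpret \<alpha>: finite_measure \<alpha> by fact
  interpret \<beta>: finite_measure \<beta> by fact
  define K where "K = space M"
  have sp: "space \<alpha> = K" "space \<beta> = K"
    using sets_eq_imp_space_eq[OF \<alpha>(2)] sets_eq_imp_space_eq[OF \<beta>(2)] by (auto simp: K_def)
  define T where "T = measure \<alpha> K + measure \<beta> K"
  define u where "u x = L (k x)" for x
  define I where "I = L u"
  have sym: "k x y = k y x" if "x \<in> K" "y \<in> K" for x y
    using pos_def_on_sym[OF k] that unfolding K_def by blast
  have kmx: "k x \<in> borel_measurable M" if "x \<in> K" for x
    using measurable_compose[OF measurable_Pair1'[OF that[unfolded K_def]] km] by simp
  have Lcong: "L f = L g" if "\<And>x. x \<in> K \<Longrightarrow> f x = g x" for f g
    unfolding L using that sp by (metis (mono_tags, lifting) Bochner_Integration.integral_cong)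
  have I: "L (\<lambda>y. L (\<lambda>x. k x y)) = I"
    unfolding I_def u_def by (intro Lcong) (simp add: sym)
  have um: "u \<in> borel_measurable M"
  proof -
    have "(\<lambda>(x, y). k x y) \<in> borel_measurable (M \<Otimes>\<^sub>M \<alpha>)" "(\<lambda>(x, y). k x y) \<in> borel_measurable (M \<Otimes>\<^sub>M \<beta>)"
      using km \<alpha>(2) \<beta>(2) sets_pair_measure_cong[of M M] by (metis measurable_cong_sets)+
    then show ?thesis
      unfolding u_def[abs_def] L
      by (intro borel_measurable_diff \<alpha>.borel_measurable_lebesgue_integral \<beta>.borel_measurable_lebesgue_integral)
  qed
  have Lb: "\<bar>L f\<bar> \<le> c * T" if f: "f \<in> borel_measurable M" "\<And>x. x \<in> K \<Longrightarrow> \<bar>f x\<bar> \<le> c" for f c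
  proof -
    have "integrable \<alpha> f" "integrable \<beta> f"
      using bounded_integrable[OF \<alpha> f(1)] bounded_integrable[OF \<beta> f(1)] f(2) unfolding K_def by blast+
    then have "(\<integral>x. \<bar>f x\<bar> \<partial>\<alpha>) \<le> (\<integral>x. c \<partial>\<alpha>)" "(\<integral>x. \<bar>f x\<bar> \<partial>\<beta>) \<le> (\<integral>x. c \<partial>\<beta>)"
      using f(2) sp by (auto intro!: integral_mono simp del: Bochner_Integration.lebesgue_integral_const)
    then have "\<bar>\<integral>x. f x \<partial>\<alpha>\<bar> \<le> (\<integral>x. c \<partial>\<alpha>)" "\<bar>\<integral>x. f x \<partial>\<beta>\<bar> \<le> (\<integral>x. c \<partial>\<beta>)"
      using integral_abs_bound[of \<alpha> f] integral_abs_bound[of \<beta> f] by linarith+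
    then show ?thesis unfolding L T_def using sp by (simp add: distrib_left mult.commute)
  qed
  have ub: "\<bar>u x\<bar> \<le> b * T" if "x \<in> K" for x
    unfolding u_def using kb that by (intro Lb kmx) (auto simp: K_def)
  show ?thesis
  proof (cases "T = 0")
    case True
    then show ?thesis unfolding I I_def using Lb[OF um ub] by simp
  next
    case False
    then have T0: "0 < T" unfolding T_def by (simp add: add_nonneg_eq_0_iff order_less_le add_nonneg_nonneg)
    \<comment> \<open>\<open>c\<close> is the price of one added point: \<open>T\<^sup>2 * b\<close>
      bounds its diagonal term and 1 is the slack of \<open>exists_signed_point_le\<close>.\<close>
    define c where "c = T\<^sup>2 * b + 1"
    define En where "En n x w = (\<Sum>i<n. \<Sum>j<n. w i * w j * k (x i) (x j))"
      for n :: nat and x :: "nat \<Rightarrow> 'a" and w :: "nat \<Rightarrow> real"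
    define U where "U n x w = (\<Sum>i<n. w i * u (x i))"
      for n :: nat and x :: "nat \<Rightarrow> 'a" and w :: "nat \<Rightarrow> real"
    \<comment> \<open>The starting configuration is left general because the induction adds one
      point first and then extends the larger configuration by \<open>m\<close> more.\<close>
    have ext: "\<exists>x' w'. (\<forall>i<n+m. x' i \<in> K) \<and>
        En (n + m) x' w' \<le> En n x w + 2 * real m * U n x w + real m * c + real m * (real m - 1) * I"
      if "\<forall>i<n. x i \<in> K" for m n x w
      using that
    proof (induction m arbitrary: n x w)
      case 0
      then show ?case by (auto intro!: exI[of _ x] exI[of _ w])
    next
      case (Suc m)
      \<comment> \<open>Adding \<open>y\<close> with weight \<open>t\<close> while \<open>m\<close>
        points remain to be added changes energy plus \<open>2 * m\<close> times potential by
        \<open>t * h y + t\<^sup>2 * k y y\<close>.\<close>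
      define h where "h y = 2 * (\<Sum>i<n. w i * k (x i) y) + 2 * real m * u y" for y
      have gm: "(\<lambda>y. \<Sum>i<n. w i * k (x i) y) \<in> borel_measurable M"
        using kmx Suc.prems by (intro borel_measurable_sum borel_measurable_times borel_measurable_const) auto
      have hm: "h \<in> borel_measurable M"
        unfolding h_def[abs_def] using gm um by measurable
      have hb: "\<bar>h y\<bar> \<le> 2 * (\<Sum>i<n. \<bar>w i\<bar> * b) + 2 * real m * (b * T)" if "y \<in> K" for y
      proof -
        have "\<bar>\<Sum>i<n. w i * k (x i) y\<bar> \<le> (\<Sum>i<n. \<bar>w i\<bar> * b)"
          using kb that Suc.prems unfolding K_def
          by (intro order.trans[OF sum_abs] sum_mono) (auto simp: abs_mult intro!: mult_left_mono)
        moreover have "real m * \<bar>u y\<bar> \<le> real m * (b * T)"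
          using ub[OF that] by (intro mult_left_mono) auto
        ultimately show ?thesis unfolding h_def
          by (intro order.trans[OF abs_triangle_ineq]) (simp add: abs_mult)
      qed
      have ik: "integrable \<alpha> (k (x i))" "integrable \<beta> (k (x i))" if "i < n" for i
        using bounded_integrable[OF \<alpha> kmx, of "x i" b] bounded_integrable[OF \<beta> kmx, of "x i" b]
          Suc.prems that kb unfolding K_def by auto
      have iu: "integrable \<alpha> u" "integrable \<beta> u"
        using bounded_integrable[OF \<alpha> um] bounded_integrable[OF \<beta> um] ub unfolding K_def by blast+
      have int_h: "(\<integral>y. h y \<partial>N) = 2 * (\<Sum>i<n. w i * (\<integral>y. k (x i) y \<partial>N)) + 2 * real m * (\<integral>y. u y \<partial>N)"
        if iN: "\<And>i. i < n \<Longrightarrow> integrable N (k (x i))" "integrable N u" for N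
      proof -
        have w: "integrable N (\<lambda>y. w i * k (x i) y)" if "i \<in> {..<n}" for i
          using iN(1) that by auto
        have s: "integrable N (\<lambda>y. \<Sum>i<n. w i * k (x i) y)"
          by (rule Bochner_Integration.integrable_sum) (rule w)
        have "(\<integral>y. h y \<partial>N) = (\<integral>y. 2 * (\<Sum>i<n. w i * k (x i) y) \<partial>N) + (\<integral>y. 2 * real m * u y \<partial>N)"
          unfolding h_def
          by (rule Bochner_Integration.integral_add[OF integrable_mult_right[OF s] integrable_mult_right[OF iN(2)]])
        moreover have "(\<integral>y. (\<Sum>i<n. w i * k (x i) y) \<partial>N) = (\<Sum>i<n. w i * (\<integral>y. k (x i) y \<partial>N))"
          by (subst Bochner_Integration.integral_sum[OF w]) simp_all
        ultimately show ?thesis by simp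
      qed
      have Lh: "L h = 2 * U n x w + 2 * real m * I"
      proof -
        have "(\<integral>y. h y \<partial>\<alpha>) = 2 * (\<Sum>i<n. w i * (\<integral>y. k (x i) y \<partial>\<alpha>)) + 2 * real m * (\<integral>y. u y \<partial>\<alpha>)"
          "(\<integral>y. h y \<partial>\<beta>) = 2 * (\<Sum>i<n. w i * (\<integral>y. k (x i) y \<partial>\<beta>)) + 2 * real m * (\<integral>y. u y \<partial>\<beta>)"
          by (intro int_h ik iu; assumption)+
        then show ?thesis
          unfolding I_def U_def u_def[of "x _"] L
          by (simp add: sum_subtractf right_diff_distrib)
      qed
      obtain y t where y: "y \<in> K" "\<bar>t\<bar> = T" "t * h y \<le> L h + 1"
        using exists_signed_point_le[OF \<alpha> \<beta> hm hb T_def[unfolded K_def] T0] unfolding L K_def by blast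
      define x1 where "x1 = x(n := y)"
      define w1 where "w1 = w(n := t)"
      have x1: "\<forall>i<Suc n. x1 i \<in> K" using y(1) Suc.prems by (auto simp: x1_def less_Suc_eq)
      have U1: "U (Suc n) x1 w1 = U n x w + t * u y"
        by (simp add: U_def x1_def w1_def)
      have "En (Suc n) x1 w1 = En n x w + 2 * t * (\<Sum>i<n. w i * k (x i) y) + t\<^sup>2 * k y y"
      proof -
        have "(\<Sum>j<n. w j * k y (x j)) = (\<Sum>i<n. w i * k (x i) y)"
          using Suc.prems y(1) sym by (intro sum.cong) auto
        then have "(\<Sum>j<n. t * w j * k y (x j)) = t * (\<Sum>i<n. w i * k (x i) y)"
          by (simp only: sum_distrib_left[symmetric] mult.assoc)
        moreover have "(\<Sum>i<n. w i * t * k (x i) y) = t * (\<Sum>i<n. w i * k (x i) y)"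
          by (simp add: sum_distrib_left mult_ac)
        ultimately show ?thesis
          by (simp add: En_def x1_def w1_def sum.distrib power2_eq_square)
      qed
      moreover have "t\<^sup>2 * k y y \<le> T\<^sup>2 * b"
        using kb[of y y] y(1,2) unfolding K_def
        by (metis abs_le_D1 mult_left_mono power2_abs zero_le_power2)
      ultimately have E1: "En (Suc n) x1 w1 \<le> En n x w + 2 * t * (\<Sum>i<n. w i * k (x i) y) + c - 1"
        unfolding c_def by simp
      obtain x' w' where x': "\<forall>i<Suc n + m. x' i \<in> K"
        "En (Suc n + m) x' w' \<le> En (Suc n) x1 w1 + 2 * real m * U (Suc n) x1 w1 + real m * c + real m * (real m - 1) * I"
        using Suc.IH[OF x1, of w1] by blast
      have "En (Suc n + m) x' w' \<le> En n x w + 2 * real m * U n x w + t * h y + c - 1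
          + real m * c + real m * (real m - 1) * I"
      proof -
        have "t * h y = 2 * t * (\<Sum>i<n. w i * k (x i) y) + 2 * real m * (t * u y)"
          by (simp add: h_def distrib_left)
        moreover have "2 * real m * U (Suc n) x1 w1 = 2 * real m * U n x w + 2 * real m * (t * u y)"
          unfolding U1 by (simp add: distrib_left)
        ultimately show ?thesis using x'(2) E1 by linarith
      qed
      also have "\<dots> \<le> En n x w + 2 * real m * U n x w + (2 * U n x w + 2 * real m * I) + c
          + real m * c + real m * (real m - 1) * I"
        using y(3) unfolding Lh by simp
      also have "\<dots> = En n x w + 2 * real (Suc m) * U n x w + real (Suc m) * c
          + real (Suc m) * (real (Suc m) - 1) * I"
        by (simp add: algebra_simps)
      finally show ?case using x'(1) by (metis add_Suc_shift)
    qed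
    have nn: "0 \<le> real m * (c + (real m - 1) * I)" for m
    proof -
      obtain x' w' where x': "\<forall>i<m. x' i \<in> K"
        "En m x' w' \<le> real m * c + real m * (real m - 1) * I"
        using ext[of 0 undefined m undefined] by (auto simp: En_def U_def)
      \<comment> \<open>Sampled points may coincide, so positive definiteness is pulled back to the
        indices.\<close>
      have "pos_def_on {..<m} (\<lambda>i j. k (x' i) (x' j))"
        using x'(1) by (intro pos_def_on_comp[OF k]) (auto simp: K_def)
      then have "0 \<le> En m x' w'" unfolding En_def by (rule pos_def_onD) auto
      then show ?thesis using x'(2) by (simp add: algebra_simps)
    qed
    show ?thesis
      unfolding I
    proof (rule ccontr)
      assume "\<not> 0 \<le> I"
      then have I0: "I < 0" by simp
      obtain m :: nat where m: "real m > \<bar>c\<bar> / (- I) + 1" using reals_Archimedean2 by blast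
      have "0 \<le> \<bar>c\<bar> / (- I)" using I0 by (intro divide_nonneg_pos) auto
      then have m0: "0 < real m" using m by linarith
      have "\<bar>c\<bar> / (- I) < real m - 1" using m by linarith
      then have "\<bar>c\<bar> < (real m - 1) * (- I)" using I0 by (subst (asm) pos_divide_less_eq) auto
      then have "c + (real m - 1) * I < 0" by simp
      then show False using nn[of m] m0 by (simp add: zero_le_mult_iff)
    qed
  qed
qed

text \<open>Because \<open>\<mu>\<close> has mass one, each of the two integrations reproduces the
  constant \<open>C\<close>, so the energy of \<open>C - d^p\<close> is \<open>C\<close> minus that
  of \<open>d^p\<close>. The bound \<open>b\<close> guarantees integrability; without it the Bochner
  integral could be 0 by default.\<close>

lemma max_energy_le:
  assumes K: "K \<subseteq> space (Rn n)"
    and pd: "pos_def_on K (\<lambda>x y. C - d x y powr p)"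
    and dm: "(\<lambda>(x, y). d x y) \<in> borel_measurable (restrict_space (Rn n) K \<Otimes>\<^sub>M restrict_space (Rn n) K)"
    and db: "\<And>x y. x \<in> K \<Longrightarrow> y \<in> K \<Longrightarrow> d x y powr p \<le> b"
  shows "max_energy p n K d \<le> ereal C"
  unfolding max_energy_def
proof (intro SUP_least)
  fix \<mu> assume \<mu>: "\<mu> \<in> signed_measures_mass_one n K"
  define M where "M = restrict_space (Rn n) K"
  have sp: "space M = K" using K by (auto simp: M_def space_restrict_space)
  have fs: "finite_signed_measure M \<mu>" and one: "\<mu> K = 1"
    using \<mu> unfolding signed_measures_mass_one_def M_def by auto
  define \<alpha> where "\<alpha> = positive_variation M \<mu>"
  define \<beta> where "\<beta> = negative_variation M \<mu>"
  have \<alpha>: "finite_measure \<alpha>" "sets \<alpha> = sets M" "space \<alpha> = K" and \<beta>: "finite_measure \<beta>" "sets \<beta> = sets M" "space \<beta> = K"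
    using finite_measure_positive_variation[OF fs] finite_measure_negative_variation[OF fs] sp
    by (auto simp: \<alpha>_def \<beta>_def)
  interpret \<alpha>: finite_measure \<alpha> by fact
  interpret \<beta>: finite_measure \<beta> by fact
  define L where "L f = (\<integral>x. f x \<partial>\<alpha>) - (\<integral>x. f x \<partial>\<beta>)" for f :: "(nat \<Rightarrow> real) \<Rightarrow> real"
  have L: "signed_integral M \<mu> f = L f" for f
    by (simp add: signed_integral_def L_def \<alpha>_def \<beta>_def)
  have mass: "measure \<alpha> K - measure \<beta> K = 1"
    using jordan_decomposition[OF fs sets.top] one unfolding \<alpha>_def \<beta>_def sp by simp
  have Ldiff: "L (\<lambda>x. c - f x) = c - L f" if "integrable \<alpha> f" "integrable \<beta> f" for c f
  proof -
    have "L (\<lambda>x. c - f x) = c * (measure \<alpha> K - measure \<beta> K) - L f"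
      using that \<alpha>(3) \<beta>(3) by (simp add: L_def Bochner_Integration.integral_diff right_diff_distrib mult.commute)
    then show ?thesis unfolding mass by simp
  qed
  have Lcong: "L f = L g" if "\<And>x. x \<in> K \<Longrightarrow> f x = g x" for f g
    unfolding L_def using that \<alpha>(3) \<beta>(3)
    by (intro arg_cong2[of _ _ _ _ minus] Bochner_Integration.integral_cong refl) auto
  have pm: "(\<lambda>(x, y). d x y powr p) \<in> borel_measurable (M \<Otimes>\<^sub>M M)"
    using powr_real_measurable[OF dm borel_measurable_const[of p]] by (simp add: M_def split_beta')
  have km: "(\<lambda>(x, y). C - d x y powr p) \<in> borel_measurable (M \<Otimes>\<^sub>M M)"
    using borel_measurable_diff[OF borel_measurable_const[of C] pm] by (simp add: split_beta')
  have "0 \<le> L (\<lambda>y. L (\<lambda>x. C - d x y powr p))"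
  proof (rule pos_def_on_signed_integral_nonneg[OF _ km _ \<alpha>(1,2) \<beta>(1,2) L_def])
    show "pos_def_on (space M) (\<lambda>x y. C - d x y powr p)" using pd unfolding sp .
    show "\<bar>C - d x y powr p\<bar> \<le> \<bar>C\<bar> + b" if "x \<in> space M" "y \<in> space M" for x y
      using db[of x y] that powr_ge_zero[of "d x y" p] unfolding sp by linarith
  qed
  moreover
  have int1: "integrable \<alpha> (\<lambda>x. d x y powr p)" "integrable \<beta> (\<lambda>x. d x y powr p)" if "y \<in> K" for y
  proof -
    have "(\<lambda>x. d x y powr p) \<in> borel_measurable M"
      using measurable_compose[OF measurable_Pair2'[of y M M] pm] that sp by simp
    then show "integrable \<alpha> (\<lambda>x. d x y powr p)" "integrable \<beta> (\<lambda>x. d x y powr p)"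
      using bounded_integrable[OF \<alpha>(1,2)] bounded_integrable[OF \<beta>(1,2)] db that
      unfolding sp by (metis abs_of_nonneg powr_ge_zero)+
  qed
  have "L (\<lambda>y. L (\<lambda>x. C - d x y powr p)) = L (\<lambda>y. C - L (\<lambda>x. d x y powr p))"
    by (rule Lcong) (rule Ldiff[OF int1])
  ultimately have "0 \<le> L (\<lambda>y. C - L (\<lambda>x. d x y powr p))"
    by simp
  also have "\<dots> = C - L (\<lambda>y. L (\<lambda>x. d x y powr p))"
  proof (rule Ldiff)
    have sw: "(\<lambda>(y, x). d x y powr p) \<in> borel_measurable (M \<Otimes>\<^sub>M M)"
      using measurable_compose[OF measurable_pair_swap' pm] by (simp add: split_beta')
    have "(\<lambda>(y, x). d x y powr p) \<in> borel_measurable (M \<Otimes>\<^sub>M \<alpha>)" "(\<lambda>(y, x). d x y powr p) \<in> borel_measurable (M \<Otimes>\<^sub>M \<beta>)"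
      using sw by (simp_all only: measurable_cong_sets[OF sets_pair_measure_cong[OF refl \<alpha>(2)] refl]
          measurable_cong_sets[OF sets_pair_measure_cong[OF refl \<beta>(2)] refl])
    then have m: "(\<lambda>y. L (\<lambda>x. d x y powr p)) \<in> borel_measurable M"
      unfolding L_def
      by (intro borel_measurable_diff \<alpha>.borel_measurable_lebesgue_integral \<beta>.borel_measurable_lebesgue_integral)
    have "\<bar>L (\<lambda>x. d x y powr p)\<bar> \<le> b * measure \<alpha> K + b * measure \<beta> K" if "y \<in> K" for y
    proof -
      have "(\<integral>x. d x y powr p \<partial>\<alpha>) \<le> (\<integral>x. b \<partial>\<alpha>)"
        by (rule integral_mono[OF int1(1)[OF that] \<alpha>.integrable_const]) (simp add: db that \<alpha>(3))
      moreover have "(\<integral>x. d x y powr p \<partial>\<beta>) \<le> (\<integral>x. b \<partial>\<beta>)"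
        by (rule integral_mono[OF int1(2)[OF that] \<beta>.integrable_const]) (simp add: db that \<beta>(3))
      moreover have "(\<integral>x. b \<partial>\<alpha>) = b * measure \<alpha> K" "(\<integral>x. b \<partial>\<beta>) = b * measure \<beta> K"
        using \<alpha>(3) \<beta>(3) by simp_all
      moreover have "0 \<le> (\<integral>x. d x y powr p \<partial>\<alpha>)" "0 \<le> (\<integral>x. d x y powr p \<partial>\<beta>)"
        by (rule Bochner_Integration.integral_nonneg, simp)+
      ultimately show ?thesis unfolding L_def by linarith
    qed
    then have bd: "\<bar>L (\<lambda>x. d x y powr p)\<bar> \<le> b * measure \<alpha> K + b * measure \<beta> K" if "y \<in> space M" for y
      using that unfolding sp .
    show "integrable \<alpha> (\<lambda>y. L (\<lambda>x. d x y powr p))"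
      by (rule bounded_integrable[OF \<alpha>(1,2) m bd])
    show "integrable \<beta> (\<lambda>y. L (\<lambda>x. d x y powr p))"
      by (rule bounded_integrable[OF \<beta>(1,2) m bd])
  qed
  finally show "ereal (energy n K d p \<mu>) \<le> ereal C"
    unfolding energy_def M_def[symmetric] L by simp
qed

section \<open>The l_r kernels on the Euclidean ball\<close>

lemma measurable_component_restrict_Rn:
  "i < n \<Longrightarrow> (\<lambda>x. x i) \<in> borel_measurable (restrict_space (Rn n) K)"
  unfolding Rn_def by (intro measurable_restrict_space1 measurable_component_singleton) auto

lemma measurable_lr_norm: "lr_norm n r \<in> borel_measurable (Rn n)"
  unfolding lr_norm_def[abs_def] Rn_def
  by (intro powr_real_measurable borel_measurable_sum borel_measurable_abs measurable_component_singleton borel_measurable_const) auto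

lemma measurable_lr_dist:
  assumes "\<And>i. i < n \<Longrightarrow> (\<lambda>x. x i) \<in> borel_measurable M" "\<And>i. i < n \<Longrightarrow> (\<lambda>x. x i) \<in> borel_measurable N"
  shows "(\<lambda>(x, y). lr_dist n r x y) \<in> borel_measurable (M \<Otimes>\<^sub>M N)"
proof -
  have "(\<lambda>z. fst z i) \<in> borel_measurable (M \<Otimes>\<^sub>M N)" "(\<lambda>z. snd z i) \<in> borel_measurable (M \<Otimes>\<^sub>M N)"
    if "i < n" for i
    using measurable_compose[OF measurable_fst assms(1)[OF that]]
      measurable_compose[OF measurable_snd assms(2)[OF that]] by auto
  then show ?thesis
    unfolding lr_dist_def lr_norm_def split_beta'
    by (intro powr_real_measurable borel_measurable_sum borel_measurable_abs
        borel_measurable_diff borel_measurable_const) auto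
qed

lemma lr_dist_powr:
  assumes "0 < r"
  shows "lr_dist n r x y powr p = (\<Sum>i<n. \<bar>x i - y i\<bar> powr r) powr (p / r)"
  using assms by (simp add: lr_dist_def lr_norm_def powr_powr)

lemma euclidean_unit_ball_abs_le:
  assumes "x \<in> euclidean_unit_ball n" "i < n"
  shows "\<bar>x i\<bar> \<le> 1"
proof -
  have "\<bar>x i\<bar> \<le> L2_set x {..<n}"
    using member_le_L2_set[of "{..<n}" i "\<lambda>i. \<bar>x i\<bar>"] assms(2) by (simp add: L2_set_def)
  then show ?thesis using assms(1) by (auto simp: euclidean_unit_ball_def)
qed

lemma lr_dist_powr_bounded:
  assumes "0 < r" "0 < p" "x \<in> euclidean_unit_ball n" "y \<in> euclidean_unit_ball n"
  shows "lr_dist n r x y powr p \<le> (real n * 2 powr r) powr (p / r)"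
  unfolding lr_dist_powr[OF assms(1)]
proof (rule powr_mono2)
  have "\<bar>x i - y i\<bar> \<le> 2" if "i < n" for i
    using euclidean_unit_ball_abs_le[OF assms(3) that] euclidean_unit_ball_abs_le[OF assms(4) that]
    by linarith
  then have "(\<Sum>i<n. \<bar>x i - y i\<bar> powr r) \<le> (\<Sum>i<n. 2 powr r)"
    using assms by (intro sum_mono powr_mono2) auto
  then show "(\<Sum>i<n. \<bar>x i - y i\<bar> powr r) \<le> real n * 2 powr r" by simp
qed (use assms in \<open>auto intro: sum_nonneg\<close>)

lemma max_energy_unit_ball_le:
  assumes "0 < r" "0 < p" "pos_def_on (euclidean_unit_ball n) (\<lambda>x y. C - lr_dist n r x y powr p)"
  shows "max_energy p n (euclidean_unit_ball n) (lr_dist n r) \<le> ereal C"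
  by (rule max_energy_le[OF _ assms(3) _ lr_dist_powr_bounded[OF assms(1,2)]])
    (auto simp: euclidean_unit_ball_def intro!: measurable_lr_dist measurable_component_restrict_Rn)

text \<open>The ball enters the kernel estimate only through \<open>\<bar>x i\<bar> \<le> 1\<close>:
  each coordinate contributes the same constant \<open>C\<close>, and their sum \<open>n * C\<close>
  is raised to the power \<open>p / r\<close>.\<close>

lemma max_energy_upper_less_2:
  assumes r: "1 \<le> r" "r < 2" and p: "0 < p" "p < r"
  shows "\<exists>B>0. \<forall>n\<ge>1. max_energy p n (euclidean_unit_ball n) (lr_dist n r) \<le> ereal (B * real n powr (p / r))"
proof -
  obtain C where C: "0 < C" "\<And>R. 0 < R \<Longrightarrow> pos_def_on {-R..R} (\<lambda>s t. C * R powr r - \<bar>s - t\<bar> powr r)"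
    using pos_def_on_interval_powr[of r] r by auto
  have C1: "pos_def_on {-1..1} (\<lambda>s t. C - \<bar>s - t\<bar> powr r)" using C(2)[of 1] by simp
  have "max_energy p n (euclidean_unit_ball n) (lr_dist n r) \<le> ereal (C powr (p / r) * real n powr (p / r))"
    if n: "n \<ge> 1" for n
  proof (rule max_energy_unit_ball_le)
    have "pos_def_on (euclidean_unit_ball n) (\<lambda>x y. \<Sum>i<n. (C - \<bar>x i - y i\<bar> powr r))"
      using euclidean_unit_ball_abs_le
      by (intro pos_def_on_sum pos_def_on_comp[OF C1]) (fastforce simp: abs_le_iff)+
    then have "pos_def_on (euclidean_unit_ball n) (\<lambda>x y. real n * C - (\<Sum>i<n. \<bar>x i - y i\<bar> powr r))"
      by (simp add: sum_subtractf)
    then have "pos_def_on (euclidean_unit_ball n)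
        (\<lambda>x y. (real n * C) powr (p / r) - (\<Sum>i<n. \<bar>x i - y i\<bar> powr r) powr (p / r))"
      using n C(1) r p by (intro pos_def_on_powr) (auto intro: sum_nonneg)
    then show "pos_def_on (euclidean_unit_ball n)
        (\<lambda>x y. C powr (p / r) * real n powr (p / r) - lr_dist n r x y powr p)"
      using n C(1) r by (simp add: lr_dist_powr powr_mult mult.commute)
  qed (use r p in auto)
  then show ?thesis using C(1) by (intro exI[of _ "C powr (p / r)"]) auto
qed

section \<open>Gaussian measures\<close>

definition gauss :: "real \<Rightarrow> real measure" where
  "gauss \<sigma> = density lborel (\<lambda>x. ennreal (normal_density 0 \<sigma> x))"

definition gaussn :: "nat \<Rightarrow> real \<Rightarrow> (nat \<Rightarrow> real) measure" where
  "gaussn n \<sigma> = Pi\<^sub>M {..<n} (\<lambda>_. gauss \<sigma>)"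

lemma sets_gauss[simp, measurable_cong]: "sets (gauss \<sigma>) = sets borel"
  and space_gauss[simp]: "space (gauss \<sigma>) = UNIV"
  by (simp_all add: gauss_def)

lemma prob_space_gauss: "0 < \<sigma> \<Longrightarrow> prob_space (gauss \<sigma>)"
  unfolding gauss_def by (rule prob_space_normal_density)

lemma sets_gaussn[simp, measurable_cong]: "sets (gaussn n \<sigma>) = sets (Rn n)"
  unfolding gaussn_def Rn_def by (intro sets_PiM_cong) auto

lemma space_gaussn[simp]: "space (gaussn n \<sigma>) = space (Rn n)"
  by (rule sets_eq_imp_space_eq) simp

lemma prob_space_gaussn: "0 < \<sigma> \<Longrightarrow> prob_space (gaussn n \<sigma>)"
  unfolding gaussn_def by (intro prob_space_PiM prob_space_gauss)

lemma product_prob_space_gauss: "0 < \<sigma> \<Longrightarrow> product_prob_space (\<lambda>_. gauss \<sigma>)"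
  by (intro product_prob_spaceI prob_space_gauss)

lemma distributed_gauss_ident:
  "distributed (gauss \<sigma>) lborel (\<lambda>x. x) (\<lambda>x. ennreal (normal_density 0 \<sigma> x))"
  unfolding distributed_def gauss_def by (simp add: distr_id2)

lemma distr_eq_gauss:
  assumes "distributed M lborel X (\<lambda>x. ennreal (normal_density 0 \<sigma> x))"
  shows "distr M borel X = gauss \<sigma>"
proof -
  have "distr M borel X = distr M lborel X" by (intro distr_cong) auto
  then show ?thesis using distributed_distr_eq_density[OF assms] by (simp add: gauss_def)
qed

lemma distr_gauss_scale:
  assumes "0 < \<sigma>"
  shows "distr (gauss 1) borel (\<lambda>x. \<sigma> * x) = gauss \<sigma>"
proof (rule distr_eq_gauss)
  interpret prob_space "gauss 1" by (rule prob_space_gauss) simp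
  show "distributed (gauss 1) lborel (\<lambda>x. \<sigma> * x) (\<lambda>x. ennreal (normal_density 0 \<sigma> x))"
    using normal_density_affine[OF distributed_gauss_ident, of \<sigma> 0] assms by simp
qed

lemma distr_gaussn_scale:
  assumes "0 < \<sigma>"
  shows "distr (gaussn n 1) (gaussn n 1) (compose {..<n} (\<lambda>x. \<sigma> * x)) = gaussn n \<sigma>"
proof -
  have "distr (gaussn n 1) (gaussn n 1) (compose {..<n} (\<lambda>x. \<sigma> * x)) =
      Pi\<^sub>M {..<n} (\<lambda>_. distr (gauss 1) (gauss 1) (\<lambda>x. \<sigma> * x))"
    unfolding gaussn_def
    by (rule distr_PiM_finite_prob_space[OF _ product_prob_space_gauss product_prob_space_gauss]) auto
  also have "distr (gauss 1) (gauss 1) (\<lambda>x. \<sigma> * x) = distr (gauss 1) borel (\<lambda>x. \<sigma> * x)"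
    by (intro distr_cong) auto
  finally show ?thesis unfolding distr_gauss_scale[OF assms] gaussn_def .
qed

lemma distr_pair_snd:
  assumes "prob_space M" "prob_space N"
  shows "distr (M \<Otimes>\<^sub>M N) N snd = N"
proof (rule measure_eqI)
  interpret M: prob_space M by fact
  interpret N: prob_space N by fact
  fix A assume "A \<in> sets (distr (M \<Otimes>\<^sub>M N) N snd)"
  then have A: "A \<in> sets N" by simp
  have "snd -` A \<inter> space (M \<Otimes>\<^sub>M N) = space M \<times> A"
    using sets.sets_into_space[OF A] by (auto simp: space_pair_measure)
  then show "emeasure (distr (M \<Otimes>\<^sub>M N) N snd) A = emeasure N A"
    using A by (simp add: emeasure_distr N.emeasure_pair_measure_Times M.emeasure_space_1)
qed simp

lemma distr_gauss_diff:
  assumes st: "0 < s" "0 < t"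
  shows "distr (gauss s \<Otimes>\<^sub>M gauss t) borel (\<lambda>z. fst z - snd z) = gauss (sqrt (s\<^sup>2 + t\<^sup>2))"
proof (rule distr_eq_gauss)
  interpret s: prob_space "gauss s" by (rule prob_space_gauss[OF st(1)])
  interpret t: prob_space "gauss t" by (rule prob_space_gauss[OF st(2)])
  interpret pair_prob_space "gauss s" "gauss t" ..
  have fst: "distr (gauss s \<Otimes>\<^sub>M gauss t) (gauss s) fst = gauss s" by (rule t.distr_pair_fst)
  have snd: "distr (gauss s \<Otimes>\<^sub>M gauss t) (gauss t) snd = gauss t"
    by (rule distr_pair_snd) unfold_locales
  have fst': "distr (gauss s \<Otimes>\<^sub>M gauss t) borel fst = gauss s"
    using fst by (metis distr_cong sets_gauss)
  have snd': "distr (gauss s \<Otimes>\<^sub>M gauss t) borel snd = gauss t"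
    using snd by (metis distr_cong sets_gauss)
  have "distributed (gauss s \<Otimes>\<^sub>M gauss t) lborel fst (\<lambda>x. ennreal (normal_density 0 s x))"
    unfolding distributed_def using fst' by (auto simp: gauss_def cong: distr_cong)
  moreover have "distributed (gauss s \<Otimes>\<^sub>M gauss t) lborel snd (\<lambda>x. ennreal (normal_density 0 t x))"
    unfolding distributed_def using snd' by (auto simp: gauss_def cong: distr_cong)
  moreover have "indep_var borel fst borel snd"
  proof -
    have "distr (gauss s \<Otimes>\<^sub>M gauss t) (borel \<Otimes>\<^sub>M borel) (\<lambda>x. (fst x, snd x)) = gauss s \<Otimes>\<^sub>M gauss t"
      unfolding prod.collapse by (intro distr_id2 sets_pair_measure_cong) simp_all
    then show ?thesis unfolding indep_var_distribution_eq using fst' snd' by auto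
  qed
  ultimately show "distributed (gauss s \<Otimes>\<^sub>M gauss t) lborel (\<lambda>z. fst z - snd z)
      (\<lambda>x. ennreal (normal_density 0 (sqrt (s\<^sup>2 + t\<^sup>2)) x))"
    using diff_indep_normal[of fst snd s t 0 0] st by simp
qed

text \<open>Both measures are compared on boxes. There the indicator factorizes over coordinates,
  and Tonelli with two product formulas reduces the claim to the hypothesis \<open>eq\<close> in
  each factor. This exchanges a pair of products with a product of pairs.\<close>

lemma distr_pair_PiM_componentwise:
  fixes N1 N2 N3 :: "real measure" and I :: "'i set"
  assumes N: "prob_space N1" "prob_space N2" "prob_space N3"
    and s: "sets N1 = sets borel" "sets N2 = sets borel" "sets N3 = sets borel"
    and h: "(\<lambda>z. h (fst z) (snd z)) \<in> borel_measurable (borel \<Otimes>\<^sub>M borel)"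
    and eq: "distr (N1 \<Otimes>\<^sub>M N2) borel (\<lambda>z. h (fst z) (snd z)) = N3" and I: "finite I"
  shows "distr (Pi\<^sub>M I (\<lambda>_. N1) \<Otimes>\<^sub>M Pi\<^sub>M I (\<lambda>_. N2)) (Pi\<^sub>M I (\<lambda>_. borel)) (\<lambda>z. \<lambda>i\<in>I. h (fst z i) (snd z i))
    = Pi\<^sub>M I (\<lambda>_. N3)"
proof -
  interpret N1: product_prob_space "\<lambda>_. N1" I by (intro product_prob_spaceI N)
  interpret N2: product_prob_space "\<lambda>_. N2" I by (intro product_prob_spaceI N)
  interpret N3: product_prob_space "\<lambda>_. N3" I by (intro product_prob_spaceI N)
  note s[measurable_cong]
  note h[measurable]
  have hi[measurable]: "(\<lambda>z. h (fst z i) (snd z i)) \<in> borel_measurable (Pi\<^sub>M I (\<lambda>_. N1) \<Otimes>\<^sub>M Pi\<^sub>M I (\<lambda>_. N2))"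
    if [measurable]: "i \<in> I" for i
  proof -
    have "(\<lambda>z. (fst z i, snd z i)) \<in> (Pi\<^sub>M I (\<lambda>_. N1) \<Otimes>\<^sub>M Pi\<^sub>M I (\<lambda>_. N2)) \<rightarrow>\<^sub>M (borel \<Otimes>\<^sub>M borel)"
      by measurable
    from measurable_compose[OF this h] show ?thesis by simp
  qed
  show ?thesis
  proof (rule N3.PiM_eqI[OF I])
    show "sets (distr (Pi\<^sub>M I (\<lambda>_. N1) \<Otimes>\<^sub>M Pi\<^sub>M I (\<lambda>_. N2)) (Pi\<^sub>M I (\<lambda>_. borel)) (\<lambda>z. \<lambda>i\<in>I. h (fst z i) (snd z i)))
       = sets (Pi\<^sub>M I (\<lambda>_. N3))"
      using s by (auto intro!: sets_PiM_cong)
    fix A assume "\<And>i. i \<in> I \<Longrightarrow> A i \<in> sets N3"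
    then have A[measurable]: "\<And>i. i \<in> I \<Longrightarrow> A i \<in> sets borel" using s by auto
    let ?P = "Pi\<^sub>M I (\<lambda>_. N1) \<Otimes>\<^sub>M Pi\<^sub>M I (\<lambda>_. N2)"
    let ?H = "\<lambda>z. \<lambda>i\<in>I. h (fst z i) (snd z i)"
    have H: "?H \<in> ?P \<rightarrow>\<^sub>M Pi\<^sub>M I (\<lambda>_. borel)"
      by (rule measurable_restrict) (rule hi)
    have PA: "Pi\<^sub>E I A \<in> sets (Pi\<^sub>M I (\<lambda>_. borel))" using I A by (intro sets_PiM_I_finite) auto
    have "emeasure (distr ?P (Pi\<^sub>M I (\<lambda>_. borel)) ?H) (Pi\<^sub>E I A) = (\<integral>\<^sup>+z. indicator (Pi\<^sub>E I A) (?H z) \<partial>?P)"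
      using H PA by (simp add: nn_integral_distr flip: nn_integral_indicator)
    also have "\<dots> = (\<integral>\<^sup>+z. (\<Prod>i\<in>I. indicator (A i) (h (fst z i) (snd z i))) \<partial>?P)"
    proof (rule nn_integral_cong)
      fix z
      have "(\<Prod>i\<in>I. indicator (A i) (h (fst z i) (snd z i)) :: ennreal) = (if \<forall>i\<in>I. h (fst z i) (snd z i) \<in> A i then 1 else 0)"
        using I by (auto simp: indicator_def intro!: prod.neutral)
      then show "indicator (Pi\<^sub>E I A) (?H z) = (\<Prod>i\<in>I. indicator (A i) (h (fst z i) (snd z i)) :: ennreal)"
        by (auto simp: indicator_def PiE_iff)
    qed
    also have "\<dots> = (\<integral>\<^sup>+x. \<integral>\<^sup>+y. (\<Prod>i\<in>I. indicator (A i) (h (x i) (y i))) \<partial>Pi\<^sub>M I (\<lambda>_. N2) \<partial>Pi\<^sub>M I (\<lambda>_. N1))"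
    proof (subst sigma_finite_measure.nn_integral_fst[OF prob_space_imp_sigma_finite[OF prob_space_PiM[OF N(2)]], symmetric])
      show "(\<lambda>z. \<Prod>i\<in>I. indicator (A i) (h (fst z i) (snd z i)) :: ennreal) \<in> borel_measurable ?P"
        by measurable
    qed simp
    also have "\<dots> = (\<integral>\<^sup>+x. (\<Prod>i\<in>I. \<integral>\<^sup>+y. indicator (A i) (h (x i) y) \<partial>N2) \<partial>Pi\<^sub>M I (\<lambda>_. N1))"
    proof (rule nn_integral_cong)
      fix x
      show "(\<integral>\<^sup>+y. (\<Prod>i\<in>I. indicator (A i) (h (x i) (y i))) \<partial>Pi\<^sub>M I (\<lambda>_. N2)) = (\<Prod>i\<in>I. \<integral>\<^sup>+y. indicator (A i) (h (x i) y) \<partial>N2)"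
      proof (rule N2.product_nn_integral_prod[OF I])
        fix i assume [measurable]: "i \<in> I"
        have "(\<lambda>y. h (x i) y) \<in> borel_measurable borel"
          using measurable_compose[OF measurable_Pair1'[of "x i" borel borel] h] by simp
        then show "(\<lambda>y. indicator (A i) (h (x i) y) :: ennreal) \<in> borel_measurable N2"
          using A[of i] \<open>i \<in> I\<close> by (simp add: borel_measurable_indicator' s cong: measurable_cong_sets)
      qed
    qed
    also have "\<dots> = (\<Prod>i\<in>I. \<integral>\<^sup>+x. \<integral>\<^sup>+y. indicator (A i) (h x y) \<partial>N2 \<partial>N1)"
    proof (rule N1.product_nn_integral_prod[OF I])
      fix i assume [measurable]: "i \<in> I"
      show "(\<lambda>x. \<integral>\<^sup>+y. indicator (A i) (h x y) \<partial>N2) \<in> borel_measurable N1"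
        by measurable
    qed
    also have "\<dots> = (\<Prod>i\<in>I. emeasure N3 (A i))"
    proof (rule prod.cong[OF refl])
      fix i assume [measurable]: "i \<in> I"
      have hm: "(\<lambda>z. h (fst z) (snd z)) \<in> borel_measurable (N1 \<Otimes>\<^sub>M N2)"
        by measurable
      have "(\<integral>\<^sup>+x. \<integral>\<^sup>+y. indicator (A i) (h x y) \<partial>N2 \<partial>N1) = (\<integral>\<^sup>+z. indicator (A i) (h (fst z) (snd z)) \<partial>(N1 \<Otimes>\<^sub>M N2))"
        by (subst sigma_finite_measure.nn_integral_fst[OF prob_space_imp_sigma_finite[OF N(2)], symmetric]) simp_all
      also have "\<dots> = emeasure N3 (A i)"
        unfolding eq[symmetric] using hm A[OF \<open>i \<in> I\<close>] by (simp add: nn_integral_distr flip: nn_integral_indicator)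
      finally show "(\<integral>\<^sup>+x. \<integral>\<^sup>+y. indicator (A i) (h x y) \<partial>N2 \<partial>N1) = emeasure N3 (A i)" .
    qed
    finally show "emeasure (distr ?P (Pi\<^sub>M I (\<lambda>_. borel)) ?H) (Pi\<^sub>E I A) = (\<Prod>i\<in>I. emeasure N3 (A i))" .
  qed
qed

lemma distr_gaussn_diff:
  assumes "0 < s" "0 < t"
  shows "distr (gaussn n s \<Otimes>\<^sub>M gaussn n t) (Rn n) (\<lambda>z. \<lambda>i\<in>{..<n}. fst z i - snd z i)
    = gaussn n (sqrt (s\<^sup>2 + t\<^sup>2))"
  unfolding gaussn_def Rn_def
  using assms distr_gauss_diff[OF assms]
  by (intro distr_pair_PiM_componentwise) (auto intro!: prob_space_gauss add_pos_pos)

section \<open>Marginals and moments of Gaussian vectors\<close>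

lemma distr_gaussn_component:
  assumes "0 < \<sigma>" "i < n"
  shows "distr (gaussn n \<sigma>) borel (\<lambda>\<omega>. \<omega> i) = gauss \<sigma>"
proof -
  have "distr (gaussn n \<sigma>) borel (\<lambda>\<omega>. \<omega> i) = distr (gaussn n \<sigma>) (gauss \<sigma>) (\<lambda>\<omega>. \<omega> i)"
    by (intro distr_cong) auto
  also have "\<dots> = gauss \<sigma>"
    unfolding gaussn_def using assms by (intro distr_PiM_component prob_space_gauss) auto
  finally show ?thesis .
qed

lemma distr_gaussn_inner:
  assumes "\<exists>i<n. z i \<noteq> 0"
  shows "distr (gaussn n 1) borel (\<lambda>\<omega>. \<Sum>i<n. z i * \<omega> i) = gauss (L2_set z {..<n})"
proof (rule distr_eq_gauss)
  interpret prob_space "gaussn n 1" by (rule prob_space_gaussn) simp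
  \<comment> \<open>Coordinates with \<open>z i = 0\<close> are removed, since the sum rule for
    independent normal variables asks for positive standard deviations and a nonempty index
    set.\<close>
  define J where "J = {i\<in>{..<n}. z i \<noteq> 0}"
  have J: "finite J" "J \<noteq> {}" "J \<subseteq> {..<n}" using assms by (auto simp: J_def)
  have comp[measurable]: "(\<lambda>\<omega>. \<omega> i) \<in> borel_measurable (gaussn n 1)" if "i < n" for i
    using that by (simp add: Rn_def cong: measurable_cong_sets)
  have dist1: "distr (gaussn n 1) borel (\<lambda>\<omega>. \<omega> i) = gauss 1" if "i < n" for i
    by (rule distr_gaussn_component) (use that in auto)
  have "indep_vars (\<lambda>_. borel) (\<lambda>i \<omega>. \<omega> i) {..<n}"
  proof (cases "n = 0")
    case False
    have "distr (gaussn n 1) (Pi\<^sub>M {..<n} (\<lambda>_. borel)) (\<lambda>x. \<lambda>i\<in>{..<n}. x i) = distr (gaussn n 1) (gaussn n 1) (\<lambda>x. x)"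
      by (intro distr_cong) (auto simp: Rn_def space_PiM PiE_def extensional_restrict)
    also have "\<dots> = Pi\<^sub>M {..<n} (\<lambda>i. distr (gaussn n 1) borel (\<lambda>x. x i))"
      unfolding distr_id by (subst gaussn_def) (intro PiM_cong refl, use dist1 in auto)
    finally show ?thesis
      using False by (subst indep_vars_iff_distr_eq_PiM') auto
  qed (use assms in simp)
  then have "indep_vars (\<lambda>_. borel) (\<lambda>i \<omega>. z i * \<omega> i) {..<n}"
    by (rule indep_vars_compose2) simp
  then have ind: "indep_vars (\<lambda>_. borel) (\<lambda>i \<omega>. z i * \<omega> i) J"
    using J(3) by (rule indep_vars_subset)
  have "distributed (gaussn n 1) lborel (\<lambda>\<omega>. z i * \<omega> i) (normal_density 0 \<bar>z i\<bar>)" if "i \<in> J" for i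
  proof -
    have i: "i < n" "z i \<noteq> 0" using that by (auto simp: J_def)
    have "distr (gaussn n 1) lborel (\<lambda>\<omega>. \<omega> i) = gauss 1"
      using dist1[OF i(1)] by (metis distr_cong sets_lborel)
    then have "distributed (gaussn n 1) lborel (\<lambda>\<omega>. \<omega> i) (\<lambda>x. ennreal (normal_density 0 1 x))"
      unfolding distributed_def gauss_def using comp[OF i(1)] by (auto simp: measurable_lborel1)
    from normal_density_affine[OF this, of "z i" 0] show ?thesis using i by simp
  qed
  from sum_indep_normal[OF J(1,2) ind _ this]
  have "distributed (gaussn n 1) lborel (\<lambda>\<omega>. \<Sum>i\<in>J. z i * \<omega> i) (normal_density 0 (sqrt (\<Sum>i\<in>J. (z i)\<^sup>2)))"
    by (simp add: J_def)
  moreover have "(\<Sum>i\<in>J. z i * \<omega> i) = (\<Sum>i<n. z i * \<omega> i)" for \<omega>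
    by (rule sum.mono_neutral_left) (auto simp: J_def)
  moreover have "(\<Sum>i\<in>J. (z i)\<^sup>2) = (\<Sum>i<n. (z i)\<^sup>2)"
    by (rule sum.mono_neutral_left) (auto simp: J_def)
  ultimately show "distributed (gaussn n 1) lborel (\<lambda>\<omega>. \<Sum>i<n. z i * \<omega> i) (\<lambda>x. ennreal (normal_density 0 (L2_set z {..<n}) x))"
    by (simp add: L2_set_def)
qed

text \<open>With \<open>u = t / s\<close>, the bound \<open>u - u\<^sup>2 \<le> u powr a\<close>
  holds for \<open>u \<le> 1\<close> because \<open>u \<le> u powr a\<close>, and for larger
  \<open>u\<close> because the left side is negative. It yields lower bounds for fractional moments
  from first and second moments alone.\<close>

lemma powr_ge_quadratic:
  fixes t s a :: real
  assumes "0 \<le> t" "0 < a" "a \<le> 1" "0 < s"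
  shows "s powr a * (t / s - (t / s)\<^sup>2) \<le> t powr a"
proof -
  define u where "u = t / s"
  have u0: "0 \<le> u" using assms by (simp add: u_def)
  have "u - u\<^sup>2 \<le> u powr a"
  proof (cases "u \<le> 1")
    case True
    have "u \<le> u powr a"
    proof (cases "u = 0")
      case False
      then have "u powr 1 \<le> u powr a" using True u0 assms by (intro powr_mono') auto
      then show ?thesis using u0 False by simp
    qed simp
    moreover have "0 \<le> u\<^sup>2" by simp
    ultimately show ?thesis by linarith
  next
    case False
    then have "u * 1 \<le> u * u" by (intro mult_left_mono) auto
    moreover have "0 \<le> u powr a" by simp
    ultimately show ?thesis unfolding power2_eq_square by linarith
  qed
  then have "s powr a * (u - u\<^sup>2) \<le> s powr a * u powr a"
    by (intro mult_left_mono) auto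
  also have "\<dots> = t powr a"
    using assms u0 by (simp flip: powr_mult) (simp add: u_def)
  finally show ?thesis unfolding u_def .
qed

lemma powr_le_one_plus:
  fixes t a :: real
  assumes "0 \<le> t" "0 \<le> a" "a \<le> b"
  shows "t powr a \<le> 1 + t powr b"
proof (cases "t \<le> 1")
  case True
  then have "t powr a \<le> 1" using assms by (simp add: powr_le1)
  then show ?thesis using powr_ge_zero[of t b] by linarith
next
  case False
  then have "t powr a \<le> t powr b" using assms by (intro powr_mono) auto
  then show ?thesis by simp
qed

definition gauss_moment :: "real \<Rightarrow> real" where
  "gauss_moment q = (\<integral>x. \<bar>x\<bar> powr q \<partial>gauss 1)"

lemma integrable_gauss_power: "integrable (gauss 1) (\<lambda>x. x ^ k)"
  unfolding gauss_def
  by (subst integrable_density) (auto intro: integrable_std_normal_moment)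

lemma integral_gauss_power_even:
  "(\<integral>x. x ^ (2 * k) \<partial>gauss 1) = fact (2 * k) / (2 ^ k * fact k)"
  unfolding gauss_def
  by (subst integral_density) (auto simp: integral_std_normal_moment_even)

lemma integrable_gauss_powr:
  assumes "0 \<le> q" "q \<le> 4"
  shows "integrable (gauss 1) (\<lambda>x. \<bar>x\<bar> powr q)"
proof (rule Bochner_Integration.integrable_bound)
  interpret prob_space "gauss 1" by (rule prob_space_gauss) simp
  show "integrable (gauss 1) (\<lambda>x. 1 + x ^ 4)" using integrable_gauss_power by simp
  have "\<bar>x\<bar> powr q \<le> 1 + x ^ 4" for x :: real
  proof -
    have "\<bar>x\<bar> powr 4 = x ^ 4" by (cases "x = 0") simp_all
    then show ?thesis using powr_le_one_plus[of "\<bar>x\<bar>" q 4] assms by simp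
  qed
  then show "AE x in gauss 1. norm (\<bar>x\<bar> powr q) \<le> norm (1 + x ^ 4)"
    by (intro AE_I2) (simp add: abs_of_nonneg)
qed simp

lemma gauss_moment_pos:
  assumes q: "0 < q" "q \<le> 2"
  shows "0 < gauss_moment q"
proof -
  interpret prob_space "gauss 1" by (rule prob_space_gauss) simp
  \<comment> \<open>\<open>s = 6\<close> maximizes \<open>1 / s - 3 / s\<^sup>2\<close>, where 1 and
    3 are the second and fourth moments of the standard normal law.\<close>
  have i: "integrable (gauss 1) (\<lambda>x. 6 powr (q / 2) * (x ^ 2 / 6 - x ^ 4 / 36))"
    using integrable_gauss_power by simp
  have "6 powr (q / 2) * (1 / 6 - 3 / 36) = (\<integral>x. 6 powr (q / 2) * (x ^ 2 / 6 - x ^ 4 / 36) \<partial>gauss 1)"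
    using integral_gauss_power_even[of 1] integral_gauss_power_even[of 2] integrable_gauss_power
    by (simp add: fact_numeral)
  also have "\<dots> \<le> gauss_moment q"
    unfolding gauss_moment_def
  proof (rule integral_mono[OF i integrable_gauss_powr])
    fix x :: real
    have "(x\<^sup>2) powr (q / 2) = \<bar>x\<bar> powr q"
      by (metis abs_ge_zero powr_powr power2_abs powr_numeral times_divide_eq_right nonzero_mult_div_cancel_left zero_neq_numeral)
    then show "6 powr (q / 2) * (x ^ 2 / 6 - x ^ 4 / 36) \<le> \<bar>x\<bar> powr q"
      using powr_ge_quadratic[of "x\<^sup>2" "q / 2" 6] q by (simp add: power_divide)
  qed (use q in auto)
  finally have "6 powr (q / 2) * (1 / 6 - 3 / 36) \<le> gauss_moment q" .
  moreover have "0 < (6::real) powr (q / 2) * (1 / 6 - 3 / 36)" by simp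
  ultimately show ?thesis by linarith
qed

lemma measurable_component_Rn[measurable]: "i < n \<Longrightarrow> (\<lambda>\<omega>. \<omega> i) \<in> borel_measurable (Rn n)"
  by (simp add: Rn_def)

lemma gaussn_component:
  fixes f :: "real \<Rightarrow> real"
  assumes "i < n" "integrable (gauss 1) f"
  shows "integrable (gaussn n 1) (\<lambda>\<omega>. f (\<omega> i))" "(\<integral>\<omega>. f (\<omega> i) \<partial>gaussn n 1) = (\<integral>x. f x \<partial>gauss 1)"
proof -
  have d: "distr (gaussn n 1) borel (\<lambda>\<omega>. \<omega> i) = gauss 1" using distr_gaussn_component[of 1 i n] assms by simp
  have f: "f \<in> borel_measurable borel"
    using borel_measurable_integrable[OF assms(2)] by simp
  have m: "(\<lambda>\<omega>. \<omega> i) \<in> borel_measurable (gaussn n 1)" using assms by simp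
  show "integrable (gaussn n 1) (\<lambda>\<omega>. f (\<omega> i))"
    using assms(2) unfolding d[symmetric] integrable_distr_eq[OF m f] .
  show "(\<integral>\<omega>. f (\<omega> i) \<partial>gaussn n 1) = (\<integral>x. f x \<partial>gauss 1)"
    unfolding d[symmetric] integral_distr[OF m f] ..
qed

lemma lr_norm_powr: "0 < r \<Longrightarrow> lr_norm n r x powr p = (\<Sum>i<n. \<bar>x i\<bar> powr r) powr (p / r)"
  by (simp add: lr_norm_def powr_powr)

lemma gaussn_sum_powr:
  assumes "0 \<le> r" "r \<le> 4"
  shows "integrable (gaussn n 1) (\<lambda>x. \<Sum>i<n. \<bar>x i\<bar> powr r)"
    "(\<integral>x. (\<Sum>i<n. \<bar>x i\<bar> powr r) \<partial>gaussn n 1) = real n * gauss_moment r"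
proof -
  have *: "integrable (gaussn n 1) (\<lambda>x. \<bar>x i\<bar> powr r)" "(\<integral>x. \<bar>x i\<bar> powr r \<partial>gaussn n 1) = gauss_moment r"
    if "i < n" for i
    using gaussn_component[OF that integrable_gauss_powr[OF assms]] by (auto simp: gauss_moment_def)
  show "integrable (gaussn n 1) (\<lambda>x. \<Sum>i<n. \<bar>x i\<bar> powr r)"
    by (rule Bochner_Integration.integrable_sum) (use * in auto)
  have "(\<integral>x. (\<Sum>i<n. \<bar>x i\<bar> powr r) \<partial>gaussn n 1) = (\<Sum>i<n. \<integral>x. \<bar>x i\<bar> powr r \<partial>gaussn n 1)"
    by (rule Bochner_Integration.integral_sum) (use * in auto)
  then show "(\<integral>x. (\<Sum>i<n. \<bar>x i\<bar> powr r) \<partial>gaussn n 1) = real n * gauss_moment r"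
    using * by simp
qed

lemma integrable_lr_norm_gaussn:
  assumes "0 < r" "r \<le> 4" "0 < p" "p \<le> r"
  shows "integrable (gaussn n 1) (\<lambda>x. lr_norm n r x powr p)"
proof (rule Bochner_Integration.integrable_bound)
  interpret prob_space "gaussn n 1" by (rule prob_space_gaussn) simp
  show "integrable (gaussn n 1) (\<lambda>x. 1 + (\<Sum>i<n. \<bar>x i\<bar> powr r))"
    using gaussn_sum_powr(1) assms by simp
  show "(\<lambda>x. lr_norm n r x powr p) \<in> borel_measurable (gaussn n 1)"
    using measurable_lr_norm[of n r] by (simp cong: measurable_cong_sets)
  show "AE x in gaussn n 1. norm (lr_norm n r x powr p) \<le> norm (1 + (\<Sum>i<n. \<bar>x i\<bar> powr r))"
  proof (rule AE_I2)
    fix x :: "nat \<Rightarrow> real"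
    have s: "0 \<le> (\<Sum>i<n. \<bar>x i\<bar> powr r)" by (simp add: sum_nonneg)
    have "(\<Sum>i<n. \<bar>x i\<bar> powr r) powr (p / r) \<le> 1 + (\<Sum>i<n. \<bar>x i\<bar> powr r) powr 1"
      using s assms by (intro powr_le_one_plus) auto
    then show "norm (lr_norm n r x powr p) \<le> norm (1 + (\<Sum>i<n. \<bar>x i\<bar> powr r))"
      using s assms by (simp add: lr_norm_powr)
  qed
qed

text \<open>The sum is divided by \<open>n\<close> before the crude bound
  \<open>t^a <= 1 + t\<close> is applied, so that the factor \<open>n^(p/r)\<close> is kept outside;
  applied directly, that bound would give order \<open>n\<close>.\<close>

lemma gaussn_lr_norm_le:
  assumes "0 < r" "r \<le> 4" "0 < p" "p \<le> r" "n \<ge> 1"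
  shows "(\<integral>x. lr_norm n r x powr p \<partial>gaussn n 1) \<le> (1 + gauss_moment r) * real n powr (p / r)"
proof -
  interpret prob_space "gaussn n 1" by (rule prob_space_gaussn) simp
  have i: "integrable (gaussn n 1) (\<lambda>x. real n powr (p / r) * (1 + (\<Sum>i<n. \<bar>x i\<bar> powr r) / real n))"
    using gaussn_sum_powr(1) assms by simp
  have "(\<integral>x. lr_norm n r x powr p \<partial>gaussn n 1) \<le>
      (\<integral>x. real n powr (p / r) * (1 + (\<Sum>i<n. \<bar>x i\<bar> powr r) / real n) \<partial>gaussn n 1)"
  proof (rule integral_mono[OF integrable_lr_norm_gaussn i])
    fix x :: "nat \<Rightarrow> real"
    define X where "X = (\<Sum>i<n. \<bar>x i\<bar> powr r)"
    have s: "0 \<le> X" by (simp add: X_def sum_nonneg)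
    have "X powr (p / r) = real n powr (p / r) * (X / real n) powr (p / r)"
      using s assms by (simp flip: powr_mult)
    also have "\<dots> \<le> real n powr (p / r) * (1 + (X / real n) powr 1)"
      using s assms by (intro mult_left_mono powr_le_one_plus) auto
    finally show "lr_norm n r x powr p \<le> real n powr (p / r) * (1 + (\<Sum>i<n. \<bar>x i\<bar> powr r) / real n)"
      using s assms by (simp add: lr_norm_powr X_def)
  qed (use assms in auto)
  also have "\<dots> = real n powr (p / r) * (1 + real n * gauss_moment r / real n)"
    using gaussn_sum_powr[of r n] assms prob_space by simp
  finally show ?thesis using assms by (simp add: mult.commute)
qed

text \<open>Jensen points the wrong way for the exponent \<open>p / r\<close>, so
  \<open>powr_ge_quadratic\<close> is used. The square of the sum is bounded by Cauchy-Schwarz,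
  which leaves only the one-dimensional moments \<open>m\<close> and \<open>m2\<close>.\<close>

lemma gaussn_lr_norm_ge:
  assumes r: "0 < r" "r \<le> 2" and p: "0 < p" "p \<le> r"
  obtains c where "0 < c" "\<And>n. n \<ge> 1 \<Longrightarrow> c * real n powr (p / r) \<le> (\<integral>x. lr_norm n r x powr p \<partial>gaussn n 1)"
proof -
  define m where "m = gauss_moment r"
  define m2 where "m2 = gauss_moment (2 * r)"
  have m: "0 < m" unfolding m_def using gauss_moment_pos r by simp
  \<comment> \<open>The exponent \<open>2 * r\<close> can exceed 2, beyond
    \<open>gauss_moment_pos\<close>; nonnegativity of the variance gives
    \<open>m\<^sup>2 \<le> m2\<close> instead.\<close>
  have m2: "0 < m2"
  proof -
    interpret prob_space "gauss 1" by (rule prob_space_gauss) simp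
    have "(\<integral>x. \<bar>x\<bar> powr r \<partial>gauss 1)\<^sup>2 \<le> (\<integral>x. (\<bar>x\<bar> powr r)\<^sup>2 \<partial>gauss 1)"
    proof -
      have e: "(\<bar>x\<bar> powr r)\<^sup>2 = \<bar>x\<bar> powr (2 * r)" for x :: real
        by (simp add: power2_eq_square flip: powr_add)
      have "variance (\<lambda>x. \<bar>x\<bar> powr r) = expectation (\<lambda>x. (\<bar>x\<bar> powr r)\<^sup>2) - (expectation (\<lambda>x. \<bar>x\<bar> powr r))\<^sup>2"
        using r unfolding e[symmetric] by (intro variance_eq) (auto simp: e intro!: integrable_gauss_powr)
      moreover have "0 \<le> variance (\<lambda>x. \<bar>x\<bar> powr r)" by (rule variance_positive)
      ultimately show ?thesis by linarith
    qed
    also have "(\<lambda>x::real. (\<bar>x\<bar> powr r)\<^sup>2) = (\<lambda>x. \<bar>x\<bar> powr (2 * r))"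
      by (simp add: power2_eq_square flip: powr_add)
    finally have "m\<^sup>2 \<le> m2" by (simp add: m_def m2_def gauss_moment_def)
    moreover have "0 < m\<^sup>2" using m by simp
    ultimately show ?thesis by linarith
  qed
  define c where "c = (2 * m2 / m) powr (p / r) * (m\<^sup>2 / (4 * m2))"
  have "c * real n powr (p / r) \<le> (\<integral>x. lr_norm n r x powr p \<partial>gaussn n 1)" if n: "n \<ge> 1" for n
  proof -
    \<comment> \<open>This \<open>s\<close> maximizes \<open>n m / s - n^2 m2 / s^2\<close>; the
      maximum \<open>m\<^sup>2 / (4 * m2)\<close> is free of \<open>n\<close>.\<close>
    define s where "s = real n * (2 * m2 / m)"
    have s: "0 < s" using n m m2 by (simp add: s_def)
    define X where "X x = (\<Sum>i<n. \<bar>x i\<bar> powr r)" for x :: "nat \<Rightarrow> real"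
    define Y where "Y x = (\<Sum>i<n. \<bar>x i\<bar> powr (2 * r))" for x :: "nat \<Rightarrow> real"
    have X: "integrable (gaussn n 1) X" "(\<integral>x. X x \<partial>gaussn n 1) = real n * m"
      unfolding X_def[abs_def] m_def using r gaussn_sum_powr[of r n] by simp_all
    have Y: "integrable (gaussn n 1) Y" "(\<integral>x. Y x \<partial>gaussn n 1) = real n * m2"
      unfolding Y_def[abs_def] m2_def using r gaussn_sum_powr[of "2 * r" n] by simp_all
    have i: "integrable (gaussn n 1) (\<lambda>x. s powr (p / r) * (X x / s - real n * Y x / s\<^sup>2))"
      using X(1) Y(1) by simp
    have "c * real n powr (p / r) = s powr (p / r) * (real n * m / s - real n * (real n * m2) / s\<^sup>2)"
    proof -
      have "real n * m / s - real n * (real n * m2) / s\<^sup>2 = m\<^sup>2 / (4 * m2)"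
        using n m m2 unfolding s_def by (simp add: field_simps power2_eq_square)
      moreover have "s powr (p / r) = (2 * m2 / m) powr (p / r) * real n powr (p / r)"
        unfolding s_def using powr_mult[of "real n" "2 * m2 / m" "p / r"] n m m2 by simp
      ultimately show ?thesis by (simp add: c_def)
    qed
    also have "\<dots> = (\<integral>x. s powr (p / r) * (X x / s - real n * Y x / s\<^sup>2) \<partial>gaussn n 1)"
      using X Y by simp
    also have "\<dots> \<le> (\<integral>x. lr_norm n r x powr p \<partial>gaussn n 1)"
    proof (rule integral_mono[OF i integrable_lr_norm_gaussn])
      fix x :: "nat \<Rightarrow> real"
      have "(X x)\<^sup>2 \<le> real n * Y x"
      proof -
        have "(\<Sum>i<n. \<bar>x i\<bar> powr r)\<^sup>2 \<le> (\<Sum>i<n. (\<bar>x i\<bar> powr r)\<^sup>2) * card {..<n}"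
          by (rule sum_squared_le_sum_of_squares)
        also have "(\<Sum>i<n. (\<bar>x i\<bar> powr r)\<^sup>2) = Y x"
          unfolding Y_def by (simp add: power2_eq_square flip: powr_add)
        finally show ?thesis by (simp add: X_def mult.commute)
      qed
      then have "(X x)\<^sup>2 / s\<^sup>2 \<le> real n * Y x / s\<^sup>2" by (intro divide_right_mono) auto
      then have "s powr (p / r) * (X x / s - real n * Y x / s\<^sup>2) \<le> s powr (p / r) * (X x / s - (X x / s)\<^sup>2)"
        by (intro mult_left_mono) (auto simp: power_divide)
      also have "\<dots> \<le> X x powr (p / r)"
        using r p s by (intro powr_ge_quadratic) (auto simp: X_def sum_nonneg)
      finally show "s powr (p / r) * (X x / s - real n * Y x / s\<^sup>2) \<le> lr_norm n r x powr p"
        using r by (simp add: lr_norm_powr X_def)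
    qed (use r p in auto)
    finally show ?thesis .
  qed
  moreover have "0 < c" using m m2 by (simp add: c_def)
  ultimately show ?thesis using that by blast
qed

lemma lr_norm_2: "lr_norm n 2 x = L2_set x {..<n}"
  by (simp add: lr_norm_def L2_set_def powr_half_sqrt sum_nonneg)

text \<open>The inner product with \<open>z\<close> is a centred normal variable of standard
  deviation \<open>\<bar>z\<bar>\<close>, so its p-th absolute moment scales like
  \<open>\<bar>z\<bar>^p\<close>. The case \<open>z = 0\<close> is separate because the law has no
  density there.\<close>

lemma integral_gaussn_inner_powr:
  assumes p: "0 < p" "p \<le> 4"
  shows "integrable (gaussn n 1) (\<lambda>\<omega>. \<bar>\<Sum>i<n. z i * \<omega> i\<bar> powr p)"
    "(\<integral>\<omega>. \<bar>\<Sum>i<n. z i * \<omega> i\<bar> powr p \<partial>gaussn n 1) = gauss_moment p * lr_norm n 2 z powr p"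
proof -
  have "integrable (gaussn n 1) (\<lambda>\<omega>. \<bar>\<Sum>i<n. z i * \<omega> i\<bar> powr p) \<and>
    (\<integral>\<omega>. \<bar>\<Sum>i<n. z i * \<omega> i\<bar> powr p \<partial>gaussn n 1) = gauss_moment p * lr_norm n 2 z powr p"
  proof (cases "\<exists>i<n. z i \<noteq> 0")
    case False
    then have "(\<Sum>i<n. z i * \<omega> i) = 0" for \<omega> by (intro sum.neutral) auto
    moreover have "lr_norm n 2 z = 0" using False by (simp add: lr_norm_2 L2_set_def)
    ultimately show ?thesis by simp
  next
    case True
    define \<sigma> where "\<sigma> = L2_set z {..<n}"
    have \<sigma>: "0 < \<sigma>"
    proof -
      have "\<sigma> \<noteq> 0" unfolding \<sigma>_def using True by (subst L2_set_eq_0_iff) auto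
      then show ?thesis using L2_set_nonneg[of z "{..<n}"] unfolding \<sigma>_def by linarith
    qed
    have m1: "(\<lambda>\<omega>. \<Sum>i<n. z i * \<omega> i) \<in> borel_measurable (gaussn n 1)" by simp
    have m2: "(\<lambda>x. \<sigma> * x) \<in> borel_measurable (gauss 1)"
      by (intro borel_measurable_times borel_measurable_const measurable_ident_sets) simp
    have f: "(\<lambda>x::real. \<bar>x\<bar> powr p) \<in> borel_measurable borel" by simp
    have d: "distr (gaussn n 1) borel (\<lambda>\<omega>. \<Sum>i<n. z i * \<omega> i) = distr (gauss 1) borel (\<lambda>x. \<sigma> * x)"
      using distr_gaussn_inner[OF True] distr_gauss_scale[OF \<sigma>] by (simp add: \<sigma>_def)
    have e: "\<bar>\<sigma> * x\<bar> powr p = \<sigma> powr p * \<bar>x\<bar> powr p" for x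
      using \<sigma> by (simp add: abs_mult powr_mult)
    have "integrable (gauss 1) (\<lambda>x. \<bar>\<sigma> * x\<bar> powr p)"
      unfolding e using integrable_gauss_powr[of p] p by simp
    then have "integrable (gaussn n 1) (\<lambda>\<omega>. \<bar>\<Sum>i<n. z i * \<omega> i\<bar> powr p)"
      using integrable_distr_eq[OF m1 f] integrable_distr_eq[OF m2 f] d by simp
    moreover have "(\<integral>\<omega>. \<bar>\<Sum>i<n. z i * \<omega> i\<bar> powr p \<partial>gaussn n 1) = (\<integral>x. \<bar>\<sigma> * x\<bar> powr p \<partial>gauss 1)"
      using integral_distr[OF m1 f] integral_distr[OF m2 f] d by simp
    ultimately show ?thesis
      unfolding e lr_norm_2 \<sigma>_def[symmetric] by (simp add: gauss_moment_def mult.commute)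
  qed
  then show "integrable (gaussn n 1) (\<lambda>\<omega>. \<bar>\<Sum>i<n. z i * \<omega> i\<bar> powr p)"
    "(\<integral>\<omega>. \<bar>\<Sum>i<n. z i * \<omega> i\<bar> powr p \<partial>gaussn n 1) = gauss_moment p * lr_norm n 2 z powr p"
    by auto
qed

text \<open>The one-dimensional kernels in a random direction average to the Euclidean one.\<close>

lemma max_energy_upper_2:
  assumes p: "0 < p" "p < 2"
  shows "\<exists>B>0. \<forall>n\<ge>1. max_energy p n (euclidean_unit_ball n) (lr_dist n 2) \<le> ereal (B * real n powr (p / 2))"
proof -
  obtain C where C: "0 < C" "\<And>R. 0 < R \<Longrightarrow> pos_def_on {-R..R} (\<lambda>s t. C * R powr p - \<bar>s - t\<bar> powr p)"
    using pos_def_on_interval_powr[of p] p by auto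
  define B where "B = C / gauss_moment p * (1 + gauss_moment 2)"
  have mp: "0 < gauss_moment p" using gauss_moment_pos p by simp
  have B: "0 < B" using C(1) mp gauss_moment_pos[of 2] by (simp add: B_def add_pos_pos)
  have "max_energy p n (euclidean_unit_ball n) (lr_dist n 2) \<le> ereal (B * real n powr (p / 2))"
    if n: "n \<ge> 1" for n
  proof -
    define E where "E = (\<integral>x. lr_norm n 2 x powr p \<partial>gaussn n 1)"
    let ?S = "euclidean_unit_ball n"
    let ?ip = "\<lambda>x \<omega>. \<Sum>i<n. x i * \<omega> i :: real"
    let ?k = "\<lambda>\<omega> x y. C * lr_norm n 2 \<omega> powr p - \<bar>?ip x \<omega> - ?ip y \<omega>\<bar> powr p"
    have kip: "?ip x \<omega> - ?ip y \<omega> = ?ip (\<lambda>i. x i - y i) \<omega>" for x y \<omega>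
      by (simp add: left_diff_distrib sum_subtractf)
    have i1: "integrable (gaussn n 1) (\<lambda>\<omega>. lr_norm n 2 \<omega> powr p)"
      using p by (intro integrable_lr_norm_gaussn) auto
    have i2: "integrable (gaussn n 1) (\<lambda>\<omega>. \<bar>?ip z \<omega>\<bar> powr p)" for z
      using integral_gaussn_inner_powr(1)[of p n z] p by simp
    have "pos_def_on ?S (\<lambda>x y. \<integral>\<omega>. ?k \<omega> x y \<partial>gaussn n 1)"
    proof (rule pos_def_on_lebesgue_integral)
      fix \<omega> :: "nat \<Rightarrow> real"
      \<comment> \<open>By Cauchy-Schwarz the ball projects into \<open>{-R..R}\<close>. The kernel
        depends on \<open>R\<close> in each direction, and only its average over
        \<open>\<omega>\<close> has to be of the right order.\<close>
      define R where "R = L2_set \<omega> {..<n}"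
      have ip: "\<bar>?ip x \<omega>\<bar> \<le> R" if "x \<in> ?S" for x
      proof -
        have "\<bar>?ip x \<omega>\<bar> \<le> (\<Sum>i<n. \<bar>x i\<bar> * \<bar>\<omega> i\<bar>)"
          by (rule order.trans[OF sum_abs]) (simp add: abs_mult)
        also have "\<dots> \<le> L2_set x {..<n} * R" unfolding R_def by (rule L2_set_mult_ineq)
        also have "\<dots> \<le> 1 * R"
          using that by (intro mult_right_mono) (auto simp: euclidean_unit_ball_def R_def)
        finally show ?thesis by simp
      qed
      show "pos_def_on ?S (?k \<omega>)"
      proof (cases "R = 0")
        case True
        have "pos_def_on ?S (\<lambda>x y. 0)" by (rule pos_def_on_const) simp
        then show ?thesis
          by (rule pos_def_on_cong) (use ip True in \<open>simp add: lr_norm_2 R_def[symmetric]\<close>)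
      next
        case False
        then have R: "0 < R" using L2_set_nonneg[of \<omega> "{..<n}"] unfolding R_def by linarith
        show ?thesis
          unfolding lr_norm_2 R_def[symmetric] using ip
          by (intro pos_def_on_comp[OF C(2)[OF R]]) (auto simp: abs_le_iff minus_le_iff)
      qed
    next
      fix x y
      show "integrable (gaussn n 1) (\<lambda>\<omega>. ?k \<omega> x y)"
        unfolding kip using i1 i2 by simp
    qed
    moreover have "(\<integral>\<omega>. ?k \<omega> x y \<partial>gaussn n 1) = C * E - gauss_moment p * lr_dist n 2 x y powr p" for x y
      unfolding kip using i1 i2 integral_gaussn_inner_powr(2)[of p n "\<lambda>i. x i - y i"] p
      by (simp add: E_def lr_dist_def)
    ultimately have "pos_def_on ?S (\<lambda>x y. C * E - gauss_moment p * lr_dist n 2 x y powr p)" by simp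
    then have "pos_def_on ?S (\<lambda>x y. 1 / gauss_moment p * (C * E - gauss_moment p * lr_dist n 2 x y powr p))"
      using mp by (intro pos_def_on_scale) auto
    then have "pos_def_on ?S (\<lambda>x y. C / gauss_moment p * E - lr_dist n 2 x y powr p)"
      by (rule pos_def_on_cong) (use mp in \<open>simp add: right_diff_distrib\<close>)
    then have "max_energy p n ?S (lr_dist n 2) \<le> ereal (C / gauss_moment p * E)"
      using p by (intro max_energy_unit_ball_le) auto
    also have "C / gauss_moment p * E \<le> C / gauss_moment p * ((1 + gauss_moment 2) * real n powr (p / 2))"
      unfolding E_def using C(1) mp p n by (intro mult_left_mono gaussn_lr_norm_le) auto
    finally show ?thesis by (simp add: B_def mult.assoc)
  qed
  then show ?thesis using B by blast
qed

section \<open>Chebyshev polynomials\<close>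

fun chebyshev :: "nat \<Rightarrow> real poly" where
  "chebyshev 0 = 1"
| "chebyshev (Suc 0) = [:0, 1:]"
| "chebyshev (Suc (Suc n)) = smult 2 (pCons 0 (chebyshev (Suc n))) - chebyshev n"

lemma poly_chebyshev_cos: "poly (chebyshev n) (cos \<theta>) = cos (real n * \<theta>)"
proof (induction n rule: chebyshev.induct)
  case (3 n)
  have "cos (real (Suc (Suc n)) * \<theta>) = cos (real (Suc n) * \<theta> + \<theta>)"
    "cos (real n * \<theta>) = cos (real (Suc n) * \<theta> - \<theta>)"
    by (simp_all add: algebra_simps)
  then show ?case using 3 by (simp add: cos_add cos_diff)
qed simp_all

lemma degree_chebyshev_le: "degree (chebyshev n) \<le> n"
proof (induction n rule: chebyshev.induct)
  case (3 n)
  have "degree (smult 2 (pCons 0 (chebyshev (Suc n)))) \<le> Suc (Suc n)"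
    using 3(1) degree_pCons_le[of 0 "chebyshev (Suc n)"] by (simp add: le_trans)
  then show ?case using 3(2) by (auto intro: degree_diff_le)
qed simp_all

lemma poly_eq_sum_atMost:
  fixes p :: "'a::comm_semiring_1 poly"
  assumes "degree p \<le> n"
  shows "poly p x = (\<Sum>j\<le>n. coeff p j * x ^ j)"
  unfolding poly_altdef using assms
  by (intro sum.mono_neutral_left) (auto simp: coeff_eq_0)

text \<open>The recursion costs \<open>2 * 3 ^ (n + 1) + 3 ^ n\<close>, below
  \<open>3 ^ (n + 2)\<close>. Any exponential rate will do, as the clipping error decays like
  \<open>e^(-n v)\<close> with \<open>v\<close> free.\<close>

lemma sum_abs_coeff_chebyshev_le: "(\<Sum>j\<le>n. \<bar>coeff (chebyshev n) j\<bar>) \<le> 3 ^ n"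
proof (induction n rule: chebyshev.induct)
  case (3 n)
  have "(\<Sum>j\<le>Suc (Suc n). \<bar>coeff (chebyshev (Suc (Suc n))) j\<bar>) \<le>
      (\<Sum>j\<le>Suc (Suc n). \<bar>coeff (pCons 0 (chebyshev (Suc n))) j\<bar> * 2 + \<bar>coeff (chebyshev n) j\<bar>)"
    by (intro sum_mono) (auto simp: coeff_pCons abs_mult split: nat.split intro!: order.trans[OF abs_triangle_ineq4])
  also have "\<dots> = 2 * (\<Sum>j\<le>Suc (Suc n). \<bar>coeff (pCons 0 (chebyshev (Suc n))) j\<bar>)
      + (\<Sum>j\<le>Suc (Suc n). \<bar>coeff (chebyshev n) j\<bar>)"
    by (simp add: sum.distrib sum_distrib_left mult.commute)
  also have "(\<Sum>j\<le>Suc (Suc n). \<bar>coeff (pCons 0 (chebyshev (Suc n))) j\<bar>) = (\<Sum>j\<le>Suc n. \<bar>coeff (chebyshev (Suc n)) j\<bar>)"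
    by (subst sum.atMost_Suc_shift) simp
  also have "(\<Sum>j\<le>Suc (Suc n). \<bar>coeff (chebyshev n) j\<bar>) = (\<Sum>j\<le>n. \<bar>coeff (chebyshev n) j\<bar>)"
    using degree_chebyshev_le[of n] by (simp add: coeff_eq_0)
  also have "2 * (\<Sum>j\<le>Suc n. \<bar>coeff (chebyshev (Suc n)) j\<bar>) + (\<Sum>j\<le>n. \<bar>coeff (chebyshev n) j\<bar>)
      \<le> 2 * 3 ^ Suc n + 3 ^ n"
    using 3 by (intro add_mono mult_left_mono) auto
  also have "\<dots> \<le> 3 ^ Suc (Suc n)" by simp
  finally show ?case .
qed (simp_all add: atMost_Suc)

lemma abs_poly_chebyshev_le: "\<bar>x\<bar> \<le> 1 \<Longrightarrow> \<bar>poly (chebyshev n) x\<bar> \<le> 1"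
  using poly_chebyshev_cos[of n "arccos x"] by (simp add: cos_arccos_abs)

lemma half_le_sin:
  fixes x :: real
  assumes "0 \<le> x" "x \<le> 1"
  shows "x / 2 \<le> sin x"
proof -
  have "sin 0 - 0 / 2 \<le> sin x - x / 2"
  proof (rule DERIV_nonneg_imp_nondecreasing[OF assms(1)])
    fix t assume t: "0 \<le> t" "t \<le> x"
    have "cos (pi / 3) \<le> cos t"
      using t assms pi_gt3 by (intro cos_monotone_0_pi_le) auto
    then have "0 \<le> cos t - 1 / 2" by (simp add: cos_60)
    moreover have "((\<lambda>t. sin t - t / 2) has_real_derivative (cos t - 1 / 2)) (at t)"
      by (auto intro!: derivative_eq_intros)
    ultimately show "\<exists>y. ((\<lambda>t. sin t - t / 2) has_real_derivative y) (at t) \<and> 0 \<le> y" by blast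
  qed
  then show ?thesis by simp
qed

text \<open>On this window \<open>e\<^sup>-\<^sup>t = cos \<theta>\<close> with \<open>1/4 \<le> n \<theta> \<le> \<pi>/2\<close>, so that the Chebyshev polynomial has
  already moved away from its value \<open>1\<close> at \<open>t = 0\<close>.\<close>

lemma chebyshev_window:
  assumes n: "n \<ge> 1" and t: "1 / (16 * real n ^ 2) \<le> t" "t \<le> 1 / (4 * real n ^ 2)"
  shows "(poly (chebyshev n) (exp (- t)))\<^sup>2 \<le> (cos (1 / 4))\<^sup>2"
proof -
  have n0: "real n > 0" using n by simp
  have t0: "0 < t" using t(1) n0 by (smt (verit) divide_pos_pos zero_less_power)
  have "(1::real) \<le> real n ^ 2" using n by simp
  then have "1 / (4 * real n ^ 2) \<le> 1" by (subst divide_le_eq_1_pos) linarith+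
  then have t1: "t \<le> 1" using t(2) by linarith
  define \<theta> where "\<theta> = arccos (exp (- t))"
  have ex: "0 < exp (- t)" "exp (- t) < 1" using t0 by auto
  have \<theta>: "0 \<le> \<theta>" "\<theta> \<le> pi / 2" "cos \<theta> = exp (- t)"
    unfolding \<theta>_def using ex
    by (intro arccos_lbound arccos_le_pi2 cos_arccos; linarith)+
  have half: "1 - exp (- t) = 2 * (sin (\<theta> / 2))\<^sup>2"
    using \<theta>(3) cos_double_sin[of "\<theta> / 2"] by simp
  have s2: "sin (\<theta> / 2) \<ge> 0" using \<theta> pi_gt3 by (intro sin_ge_zero) auto
  \<comment> \<open>Estimating \<open>1 - e^(-t) = 2 sin^2(\<theta>/2)\<close> from both sides gives
    \<open>t <= \<theta>^2 <= 8 t\<close>. The window is thus mapped into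
    \<open>1/4 <= n \<theta> <= sqrt 2\<close>, and \<open>sqrt 2 < 3/2 < pi/2\<close>.\<close>
  have "t / 2 \<le> 1 - exp (- t)"
  proof -
    have "exp (- t) * (1 + t) \<le> 1"
      using exp_ge_add_one_self[of t] by (simp add: exp_minus field_simps)
    then have "exp (- t) \<le> 1 / (1 + t)" using t0 by (simp add: field_simps)
    also have "\<dots> \<le> 1 - t / 2"
      using t0 t1 by (simp add: field_simps)
    finally show ?thesis by linarith
  qed
  also have "\<dots> \<le> 2 * (\<theta> / 2)\<^sup>2"
    unfolding half using \<theta> s2 by (intro mult_left_mono power_mono sin_x_le_x) auto
  finally have lo: "t \<le> \<theta>\<^sup>2" by (simp add: power_divide)
  have "\<theta> / 2 / 2 \<le> sin (\<theta> / 2)"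
    using \<theta> pi_less_4 by (intro half_le_sin) auto
  then have "2 * (\<theta> / 2 / 2)\<^sup>2 \<le> 1 - exp (- t)"
    unfolding half using \<theta> by (intro mult_left_mono power_mono) auto
  also have "\<dots> \<le> t" using exp_ge_add_one_self[of "- t"] by linarith
  finally have hi: "\<theta>\<^sup>2 \<le> 8 * t" by (simp add: power_divide)
  have "(1 / 4)\<^sup>2 \<le> (real n * \<theta>)\<^sup>2"
  proof -
    have "(1 / 4)\<^sup>2 \<le> real n ^ 2 * t" using t(1) n0 by (simp add: field_simps power2_eq_square)
    also have "\<dots> \<le> real n ^ 2 * \<theta>\<^sup>2" using lo by (intro mult_left_mono) auto
    finally show ?thesis by (simp add: power_mult_distrib)
  qed
  then have lo': "1 / 4 \<le> real n * \<theta>" by (rule power2_le_imp_le) (use \<theta>(1) in simp)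
  have "(real n * \<theta>)\<^sup>2 \<le> (3 / 2)\<^sup>2"
  proof -
    have "(real n * \<theta>)\<^sup>2 \<le> real n ^ 2 * (8 * t)" unfolding power_mult_distrib using hi by (intro mult_left_mono) auto
    also have "\<dots> \<le> 2" using t(2) n0 by (simp add: field_simps)
    also have "\<dots> \<le> (3 / 2)\<^sup>2" by (simp add: power2_eq_square)
    finally show ?thesis .
  qed
  then have hi': "real n * \<theta> \<le> 3 / 2" by (rule power2_le_imp_le) simp
  have "0 \<le> cos (real n * \<theta>)"
    using lo' hi' pi_gt3 by (intro cos_ge_zero) auto
  moreover have "cos (real n * \<theta>) \<le> cos (1 / 4)"
    using lo' hi' pi_gt3 by (intro cos_monotone_0_pi_le) auto
  ultimately have "(cos (real n * \<theta>))\<^sup>2 \<le> (cos (1 / 4))\<^sup>2" by (rule power_mono[rotated])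
  then show ?thesis using poly_chebyshev_cos[of n \<theta>] \<theta>(3) by simp
qed

text \<open>This is the integrand of the representation of the Bernstein function
  \<open>x powr b\<close>, \<open>0 < b < 1\<close>. The indicator extends it to the whole line, so
  that affine substitution in \<open>lborel\<close> applies.\<close>

definition powr_kernel :: "real \<Rightarrow> real \<Rightarrow> real \<Rightarrow> real" where
  "powr_kernel b x t = indicator {0<..} t * ((1 - exp (- x * t)) * t powr (- 1 - b))"

lemma powr_kernel_measurable[measurable]: "powr_kernel b x \<in> borel_measurable borel"
  unfolding powr_kernel_def[abs_def] by measurable

lemma powr_kernel_nonneg: "0 \<le> x \<Longrightarrow> 0 \<le> powr_kernel b x t"
  by (auto simp: powr_kernel_def indicator_def)

text \<open>Near 0, \<open>1 - e^(-t) <= t\<close> leaves \<open>t powr (- b)\<close>, integrable as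
  \<open>b < 1\<close>; at infinity, \<open>1 - e^(-t) <= 1\<close> leaves
  \<open>t powr (- 1 - b)\<close>, integrable as \<open>b > 0\<close>.\<close>

lemma integrable_powr_kernel_1:
  assumes b: "0 < b" "b < 1"
  shows "integrable lborel (powr_kernel b 1)"
proof -
  define g where "g t = (if t \<in> {0..1} then t powr (- b) else 0) + (if t \<in> {1..} then t powr (- 1 - b) else 0)"
    for t :: real
  have "((\<lambda>t. t powr (- b)) has_integral (1 powr (- b + 1) / (- b + 1))) {0..1}"
    using b by (intro has_integral_powr_from_0) auto
  moreover have "((\<lambda>t. t powr (- 1 - b)) has_integral - (1 powr (- 1 - b + 1)) / (- 1 - b + 1)) {1..}"
    using b by (intro has_integral_powr_to_inf) auto
  ultimately have "(g has_integral (1 powr (- b + 1) / (- b + 1)) + - (1 powr (- 1 - b + 1)) / (- 1 - b + 1)) UNIV"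
    unfolding g_def by (intro has_integral_add) (simp_all only: has_integral_restrict_UNIV)
  moreover have g0: "0 \<le> g t" for t by (simp add: g_def)
  moreover have gm: "g \<in> borel_measurable borel" unfolding g_def[abs_def] by measurable
  ultimately have "(\<integral>\<^sup>+t. ennreal (g t) \<partial>lborel) < \<infinity>"
    using nn_integral_has_integral_lborel[of g] by simp
  then have gi: "integrable lborel g"
    using g0 gm by (intro integrableI_nonneg) auto
  show ?thesis
  proof (rule Bochner_Integration.integrable_bound[OF gi])
    show "AE t in lborel. norm (powr_kernel b 1 t) \<le> norm (g t)"
    proof (rule AE_I2)
      fix t :: real
      have "powr_kernel b 1 t \<le> g t"
      proof (cases "0 < t")
        case True
        have "(1 - exp (- t)) * t powr (- 1 - b) \<le> g t"
        proof (cases "t \<le> 1")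
          case True
          have "(1 - exp (- t)) * t powr (- 1 - b) \<le> t * t powr (- 1 - b)"
            using exp_ge_add_one_self[of "- t"] by (intro mult_right_mono) auto
          also have "\<dots> = t powr (- b)" using \<open>0 < t\<close> by (simp add: power_mult_powr)
          also have "\<dots> \<le> g t" using True \<open>0 < t\<close> by (simp add: g_def)
          finally show ?thesis .
        next
          case False
          have "(1 - exp (- t)) * t powr (- 1 - b) \<le> 1 * t powr (- 1 - b)"
            by (intro mult_right_mono) auto
          then show ?thesis using False by (simp add: g_def)
        qed
        then show ?thesis using True by (simp add: powr_kernel_def)
      qed (use g0 in \<open>simp add: powr_kernel_def\<close>)
      then show "norm (powr_kernel b 1 t) \<le> norm (g t)"
        using g0 powr_kernel_nonneg[of 1 b t] by simp
    qed
  qed simp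
qed

text \<open>Substituting \<open>x * t\<close> for \<open>t\<close> shows homogeneity of degree
  \<open>b\<close>. The integral at \<open>x = 1\<close> stays unevaluated; only its positivity will
  matter.\<close>

lemma integral_powr_kernel:
  assumes b: "0 < b" "b < 1" and x: "0 < x"
  shows "integrable lborel (powr_kernel b x)"
    "(\<integral>t. powr_kernel b x t \<partial>lborel) = x powr b * (\<integral>t. powr_kernel b 1 t \<partial>lborel)"
proof -
  have e: "powr_kernel b 1 (0 + x * t) = x powr (- 1 - b) * powr_kernel b x t" for t
    using x by (auto simp: powr_kernel_def indicator_def powr_mult zero_less_mult_iff)
  have "integrable lborel (\<lambda>t. powr_kernel b 1 (0 + x * t))"
    using integrable_powr_kernel_1[OF b] x by (intro lborel_integrable_real_affine) auto
  from integrable_mult_right[OF this[unfolded e], of "x powr (1 + b)"]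
  have "integrable lborel (\<lambda>t. x powr (1 + b) * (x powr (- 1 - b) * powr_kernel b x t))" .
  moreover have c: "x powr (1 + b) * (x powr (- 1 - b) * y) = y" for y
    using x by (simp flip: mult.assoc powr_add)
  ultimately show "integrable lborel (powr_kernel b x)" by (simp only: c)
  have "(\<integral>t. powr_kernel b 1 t \<partial>lborel) = x * (x powr (- 1 - b) * (\<integral>t. powr_kernel b x t \<partial>lborel))"
    using lborel_integral_real_affine[of x "powr_kernel b 1" 0] x unfolding e by simp
  then have "x powr b * (\<integral>t. powr_kernel b 1 t \<partial>lborel) =
      (x * x powr b) * (x powr (- 1 - b) * (\<integral>t. powr_kernel b x t \<partial>lborel))"
    by simp
  also have "x * x powr b = x powr (1 + b)" using x by (simp add: power_mult_powr add.commute)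
  finally show "(\<integral>t. powr_kernel b x t \<partial>lborel) = x powr b * (\<integral>t. powr_kernel b 1 t \<partial>lborel)"
    unfolding c ..
qed

text \<open>Writing \<open>x powr b\<close> as a mixture of the functions \<open>1 - e\<^sup>-\<^sup>x\<^sup>t\<close> turns the quadratic form into an
  integral of \<open>1 - (e\<^sup>-\<^sup>t T\<^sub>n(e\<^sup>-\<^sup>t))\<^sup>2 \<ge> 0\<close>.\<close>

lemma chebyshev_quadratic_form_ge:
  assumes b: "0 < b" "b < 1"
  obtains c where "0 < c" "\<And>n. n \<ge> 1 \<Longrightarrow> c * real n powr (2 * b) \<le>
    (\<Sum>j\<le>n. \<Sum>k\<le>n. coeff (chebyshev n) j * coeff (chebyshev n) k * (real j + real k + 2) powr b)"
proof -
  define Q where "Q n = (\<Sum>j\<le>n. \<Sum>k\<le>n. coeff (chebyshev n) j * coeff (chebyshev n) k * (real j + real k + 2) powr b)" for n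
  define \<gamma> where "\<gamma> = (\<integral>t. powr_kernel b 1 t \<partial>lborel)"
  \<comment> \<open>\<open>1 - cos^2(1/4)\<close> comes from the bound of
    \<open>chebyshev_window\<close>, and \<open>3 / 4\<close> is the length of the window relative
    to its right end.\<close>
  define c0 where "c0 = (1 - (cos (1 / 4 :: real))\<^sup>2) * (3 / 4)"
  have "0 < (sin (1 / 4 :: real))\<^sup>2"
    using sin_gt_zero[of "1/4"] pi_gt3 by simp
  then have c0: "0 < c0" unfolding c0_def by (simp add: cos_squared_eq)
  have main: "c0 * real n powr (2 * b) \<le> \<gamma> * Q n" if n: "n \<ge> 1" for n
  proof -
    let ?\<tau> = "coeff (chebyshev n)"
    define h where "h t = indicator {0<..} t * ((1 - (exp (- t) * poly (chebyshev n) (exp (- t)))\<^sup>2) * t powr (- 1 - b))"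
      for t :: real
    \<comment> \<open>As \<open>T_n(1) = 1\<close>, the constant terms of the mixtures add up to 1
      in the quadratic form.\<close>
    have one: "(\<Sum>j\<le>n. ?\<tau> j) = 1"
      using poly_eq_sum_atMost[OF degree_chebyshev_le, of n 1] poly_chebyshev_cos[of n 0] by simp
    have "(\<Sum>j\<le>n. \<Sum>k\<le>n. ?\<tau> j * ?\<tau> k * powr_kernel b (real j + real k + 2) t) = h t" for t
    proof -
      have "(\<Sum>j\<le>n. \<Sum>k\<le>n. ?\<tau> j * ?\<tau> k * (1 - exp (- (real j + real k + 2) * t)))
        = (\<Sum>j\<le>n. ?\<tau> j)\<^sup>2 - (exp (- t) * (\<Sum>j\<le>n. ?\<tau> j * exp (- t) ^ j))\<^sup>2"
      proof -
        \<comment> \<open>Reading \<open>j + k + 2\<close> as \<open>(j + 1) + (k + 1)\<close> makes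
          the double sum a square. The shifts by 1 leave the extra factor \<open>e^(-t)\<close>,
          which for \<open>t > 0\<close> only decreases that square.\<close>
        have "exp (- (real j + real k + 2) * t) = exp (- t) * exp (- t) ^ j * (exp (- t) * exp (- t) ^ k)" for j k
          by (simp flip: exp_of_nat_mult exp_add) (simp add: algebra_simps)
        then show ?thesis
          by (simp add: power2_eq_square sum_product right_diff_distrib sum_subtractf sum_distrib_left mult_ac)
      qed
      also have "\<dots> = 1 - (exp (- t) * poly (chebyshev n) (exp (- t)))\<^sup>2"
        using one poly_eq_sum_atMost[OF degree_chebyshev_le, of n "exp (- t)"] by simp
      finally have *: "(\<Sum>j\<le>n. \<Sum>k\<le>n. ?\<tau> j * ?\<tau> k * (1 - exp (- (real j + real k + 2) * t)))
        = 1 - (exp (- t) * poly (chebyshev n) (exp (- t)))\<^sup>2" .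
      have "(\<Sum>j\<le>n. \<Sum>k\<le>n. ?\<tau> j * ?\<tau> k * powr_kernel b (real j + real k + 2) t) =
         (\<Sum>j\<le>n. \<Sum>k\<le>n. ?\<tau> j * ?\<tau> k * (1 - exp (- (real j + real k + 2) * t))) * (indicator {0<..} t * t powr (- 1 - b))"
        unfolding powr_kernel_def sum_distrib_right by (intro sum.cong refl) simp
      then show ?thesis unfolding * h_def by simp
    qed
    moreover have i: "integrable lborel (\<lambda>t. ?\<tau> j * ?\<tau> k * powr_kernel b (real j + real k + 2) t)" for j k
      using integral_powr_kernel(1)[OF b, of "real j + real k + 2"] by simp
    ultimately have hi: "integrable lborel h" and hI: "(\<integral>t. h t \<partial>lborel) = \<gamma> * Q n"
    proof -
      have h: "h = (\<lambda>t. \<Sum>j\<le>n. \<Sum>k\<le>n. ?\<tau> j * ?\<tau> k * powr_kernel b (real j + real k + 2) t)"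
        using \<open>\<And>t. _ = h t\<close> by auto
      show "integrable lborel h"
        unfolding h by (intro Bochner_Integration.integrable_sum i)
      have "(\<integral>t. h t \<partial>lborel) = (\<Sum>j\<le>n. \<Sum>k\<le>n. ?\<tau> j * ?\<tau> k * (\<integral>t. powr_kernel b (real j + real k + 2) t \<partial>lborel))"
        unfolding h
        by (subst Bochner_Integration.integral_sum, intro Bochner_Integration.integrable_sum i, rule sum.cong[OF refl],
            subst Bochner_Integration.integral_sum, rule i, rule sum.cong[OF refl]) simp
      also have "\<dots> = (\<Sum>j\<le>n. \<Sum>k\<le>n. \<gamma> * (?\<tau> j * ?\<tau> k * (real j + real k + 2) powr b))"
        by (intro sum.cong refl, subst integral_powr_kernel(2)[OF b]) (simp_all add: \<gamma>_def)
      also have "\<dots> = \<gamma> * Q n" unfolding Q_def by (simp add: sum_distrib_left)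
      finally show "(\<integral>t. h t \<partial>lborel) = \<gamma> * Q n" .
    qed
    define l u where "l = 1 / (16 * real n ^ 2)" and "u = 1 / (4 * real n ^ 2)"
    have lu: "0 < l" "l \<le> u" using n by (auto simp: l_def u_def field_simps)
    \<comment> \<open>A constant lower bound for \<open>h\<close> on the window:
      \<open>t powr (- 1 - b)\<close> is decreasing, so its smallest value is at the right end
      \<open>u\<close>. Elsewhere \<open>h\<close> is nonnegative.\<close>
    define w where "w = (1 - (cos (1 / 4 :: real))\<^sup>2) * u powr (- 1 - b)"
    have "w * (u - l) = (\<integral>t. indicator {l..u} t * w \<partial>lborel)"
      using lu by simp
    also have "\<dots> \<le> (\<integral>t. h t \<partial>lborel)"
    proof (rule integral_mono[OF _ hi])
      show "integrable lborel (\<lambda>t. indicator {l..u} t * w)" using lu by simp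
      fix t :: real
      have sq: "(exp (- t) * poly (chebyshev n) (exp (- t)))\<^sup>2 \<le> (poly (chebyshev n) (exp (- t)))\<^sup>2" if "0 < t"
      proof -
        have "(exp (- t))\<^sup>2 \<le> 1" using that by (simp add: power_le_one)
        then show ?thesis by (simp add: power_mult_distrib mult_left_le_one_le)
      qed
      show "indicator {l..u} t * w \<le> h t"
      proof (cases "t \<in> {l..u}")
        case True
        then have t0: "0 < t" using lu by auto
        have "w \<le> (1 - (exp (- t) * poly (chebyshev n) (exp (- t)))\<^sup>2) * t powr (- 1 - b)"
          unfolding w_def
        proof (rule mult_mono)
          show "1 - (cos (1 / 4 :: real))\<^sup>2 \<le> 1 - (exp (- t) * poly (chebyshev n) (exp (- t)))\<^sup>2"
            using chebyshev_window[OF n, of t] True sq[OF t0] by (simp add: l_def u_def)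
          then show "0 \<le> 1 - (exp (- t) * poly (chebyshev n) (exp (- t)))\<^sup>2"
            using c0 unfolding c0_def by (simp add: zero_less_mult_iff)
          show "u powr (- 1 - b) \<le> t powr (- 1 - b)"
            using True t0 b by (intro powr_mono2') auto
        qed simp
        then show ?thesis using True t0 by (simp add: h_def)
      next
        case False
        have "0 \<le> h t"
        proof (cases "0 < t")
          case True
          have "(poly (chebyshev n) (exp (- t)))\<^sup>2 \<le> 1"
            using abs_poly_chebyshev_le[of "exp (- t)" n] True by (simp add: abs_square_le_1)
          then show ?thesis using sq[OF True] True by (simp add: h_def)
        qed (simp add: h_def)
        then show ?thesis using False by simp
      qed
    qed
    finally have "w * (u - l) \<le> \<gamma> * Q n" unfolding hI .
    moreover have "c0 * real n powr (2 * b) \<le> w * (u - l)"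
    proof -
      have u0: "0 < u" using lu by linarith
      have "u - l = u * (3 / 4)" by (simp add: u_def l_def)
      then have "w * (u - l) = c0 * (u * u powr (- 1 - b))" by (simp add: w_def c0_def)
      also have "u * u powr (- 1 - b) = u powr (- b)" using u0 by (simp add: power_mult_powr)
      also have "u powr (- b) = (4 * real n ^ 2) powr b"
        using n by (simp add: u_def powr_minus powr_divide)
      also have "\<dots> = 4 powr b * real n powr (2 * b)"
        using n by (simp add: powr_mult powr_powr flip: powr_numeral)
      finally have "w * (u - l) = c0 * (4 powr b * real n powr (2 * b))" .
      moreover have "1 \<le> (4::real) powr b" using b by (intro ge_one_powr_ge_zero) auto
      then have "1 * real n powr (2 * b) \<le> 4 powr b * real n powr (2 * b)"
        by (intro mult_right_mono) auto
      ultimately show ?thesis using c0 by simp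
    qed
    ultimately show ?thesis by linarith
  qed
  have "0 \<le> \<gamma>" unfolding \<gamma>_def using powr_kernel_nonneg[of 1 b] by (intro Bochner_Integration.integral_nonneg) simp
  \<comment> \<open>For \<open>\<gamma> = 0\<close> the inequality \<open>main\<close> at
    \<open>n = 1\<close> would read \<open>c0 <= 0\<close>.\<close>
  moreover have "\<gamma> \<noteq> 0" using main[of 1] c0 by auto
  ultimately have \<gamma>: "0 < \<gamma>" by linarith
  show ?thesis
  proof (rule that[of "c0 / \<gamma>"])
    show "0 < c0 / \<gamma>" using c0 \<gamma> by simp
    show "c0 / \<gamma> * real n powr (2 * b) \<le> (\<Sum>j\<le>n. \<Sum>k\<le>n. coeff (chebyshev n) j * coeff (chebyshev n) k * (real j + real k + 2) powr b)"
      if "n \<ge> 1" for n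
      using main[OF that] \<gamma> unfolding Q_def[symmetric] by (simp add: field_simps)
  qed
qed

section \<open>Gaussian mixtures on the ball\<close>

text \<open>The origin has to be the restricted zero function: elements of
  \<open>space (Rn n)\<close> are \<open>undefined\<close> outside \<open>{..<n}\<close>.\<close>

definition clip :: "nat \<Rightarrow> (nat \<Rightarrow> real) \<Rightarrow> nat \<Rightarrow> real" where
  "clip n x = (if x \<in> euclidean_unit_ball n then x else (\<lambda>i\<in>{..<n}. 0))"

lemma origin_in_unit_ball: "(\<lambda>i\<in>{..<n}. 0) \<in> euclidean_unit_ball n"
  by (simp add: euclidean_unit_ball_def Rn_def space_PiM L2_set_def)

lemma clip_in_unit_ball: "clip n x \<in> euclidean_unit_ball n"
  by (simp add: clip_def origin_in_unit_ball)

lemma sets_euclidean_unit_ball: "euclidean_unit_ball n \<in> sets (Rn n)"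
proof -
  have "(\<lambda>x. L2_set x {..<n}) \<in> borel_measurable (Rn n)"
    using measurable_lr_norm[of n 2] by (simp add: lr_norm_2[abs_def] cong: measurable_cong)
  then show ?thesis unfolding euclidean_unit_ball_def by measurable
qed

lemma space_unit_ball: "space (restrict_space (Rn n) (euclidean_unit_ball n)) = euclidean_unit_ball n"
  by (auto simp: space_restrict_space euclidean_unit_ball_def)

lemma measurable_clip: "clip n \<in> Rn n \<rightarrow>\<^sub>M restrict_space (Rn n) (euclidean_unit_ball n)"
proof (rule measurable_restrict_space2)
  have "(\<lambda>i\<in>{..<n}. 0) \<in> space (Rn n)" by (simp add: Rn_def space_PiM)
  then show "clip n \<in> Rn n \<rightarrow>\<^sub>M Rn n"
    unfolding clip_def[abs_def] using sets_euclidean_unit_ball[of n]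
    by (intro measurable_If_set measurable_ident measurable_const)
      (auto simp: sets.Int_space_eq2)
qed (use clip_in_unit_ball in auto)

lemma lr_dist_commute: "lr_dist n r x y = lr_dist n r y x"
  by (simp add: lr_dist_def lr_norm_def abs_minus_commute)

lemma integral_pair_marginal:
  fixes g :: "'a \<Rightarrow> real" and h :: "'b \<Rightarrow> real"
  assumes M: "prob_space M" and N: "prob_space N"
  shows "integrable M g \<Longrightarrow> integrable (M \<Otimes>\<^sub>M N) (\<lambda>z. g (fst z))"
    "integrable M g \<Longrightarrow> (\<integral>z. g (fst z) \<partial>(M \<Otimes>\<^sub>M N)) = (\<integral>x. g x \<partial>M)"
    "integrable N h \<Longrightarrow> integrable (M \<Otimes>\<^sub>M N) (\<lambda>z. h (snd z))"
    "integrable N h \<Longrightarrow> (\<integral>z. h (snd z) \<partial>(M \<Otimes>\<^sub>M N)) = (\<integral>x. h x \<partial>N)"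
proof -
  have f: "distr (M \<Otimes>\<^sub>M N) M fst = M" by (rule prob_space.distr_pair_fst[OF N])
  have s: "distr (M \<Otimes>\<^sub>M N) N snd = N" by (rule distr_pair_snd[OF M N])
  show "integrable (M \<Otimes>\<^sub>M N) (\<lambda>z. g (fst z))" if "integrable M g"
    using integrable_distr_eq[OF measurable_fst borel_measurable_integrable[OF that], of N] that f by simp
  show "(\<integral>z. g (fst z) \<partial>(M \<Otimes>\<^sub>M N)) = (\<integral>x. g x \<partial>M)" if "integrable M g"
    using integral_distr[OF measurable_fst borel_measurable_integrable[OF that], of N] f by simp
  show "integrable (M \<Otimes>\<^sub>M N) (\<lambda>z. h (snd z))" if "integrable N h"
    using integrable_distr_eq[OF measurable_snd borel_measurable_integrable[OF that], of M] that s by simp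
  show "(\<integral>z. h (snd z) \<partial>(M \<Otimes>\<^sub>M N)) = (\<integral>x. h x \<partial>N)" if "integrable N h"
    using integral_distr[OF measurable_snd borel_measurable_integrable[OF that], of M] s by simp
qed

lemma measurable_compose_scale: "compose {..<n} (\<lambda>x. \<sigma> * x) \<in> Rn n \<rightarrow>\<^sub>M (Rn n :: (nat \<Rightarrow> real) measure)"
proof -
  have "(\<lambda>\<omega>. \<lambda>i\<in>{..<n}. \<sigma> * \<omega> i) \<in> Rn n \<rightarrow>\<^sub>M Pi\<^sub>M {..<n} (\<lambda>_. borel)"
    by (intro measurable_restrict borel_measurable_times borel_measurable_const measurable_component_Rn) simp
  then show ?thesis unfolding compose_def[abs_def] Rn_def .
qed

lemma integral_gaussn_lr_norm:
  assumes r: "0 < r" "r \<le> 4" and p: "0 < p" "p \<le> r" and \<sigma>: "0 < \<sigma>"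
  shows "integrable (gaussn n \<sigma>) (\<lambda>x. lr_norm n r x powr p)"
    "(\<integral>x. lr_norm n r x powr p \<partial>gaussn n \<sigma>) = \<sigma> powr p * (\<integral>x. lr_norm n r x powr p \<partial>gaussn n 1)"
proof -
  have c: "compose {..<n} (\<lambda>x. \<sigma> * x) \<in> gaussn n 1 \<rightarrow>\<^sub>M gaussn n 1"
    using measurable_compose_scale[of n \<sigma>] by (simp cong: measurable_cong_sets)
  have f: "(\<lambda>x. lr_norm n r x powr p) \<in> borel_measurable (gaussn n 1)"
    using measurable_lr_norm[of n r] by (simp cong: measurable_cong_sets)
  have e: "lr_norm n r (compose {..<n} (\<lambda>x. \<sigma> * x) x) powr p = \<sigma> powr p * lr_norm n r x powr p" for x
  proof -
    have "(\<Sum>i<n. \<bar>compose {..<n} (\<lambda>x. \<sigma> * x) x i\<bar> powr r) = \<sigma> powr r * (\<Sum>i<n. \<bar>x i\<bar> powr r)"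
      unfolding sum_distrib_left using \<sigma> by (intro sum.cong refl) (simp add: compose_def abs_mult powr_mult)
    then show ?thesis
      using r \<sigma> by (simp add: lr_norm_powr powr_mult powr_powr sum_nonneg)
  qed
  show "integrable (gaussn n \<sigma>) (\<lambda>x. lr_norm n r x powr p)"
    unfolding distr_gaussn_scale[OF \<sigma>, of n, symmetric] integrable_distr_eq[OF c f] e
    using integrable_lr_norm_gaussn[OF r p] by simp
  show "(\<integral>x. lr_norm n r x powr p \<partial>gaussn n \<sigma>) = \<sigma> powr p * (\<integral>x. lr_norm n r x powr p \<partial>gaussn n 1)"
    unfolding distr_gaussn_scale[OF \<sigma>, of n, symmetric] integral_distr[OF c f] e by simp
qed

text \<open>The difference of two independent Gaussian vectors is Gaussian with variance
  \<open>s\<^sup>2 + t\<^sup>2\<close> in each coordinate, and scaling takes this factor out. The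
  remaining integral is common to all pairs of components of a mixture.\<close>

lemma integral_gaussn_lr_dist:
  assumes r: "0 < r" "r \<le> 4" and p: "0 < p" "p \<le> r" and st: "0 < s" "0 < t"
  shows "integrable (gaussn n s \<Otimes>\<^sub>M gaussn n t) (\<lambda>z. lr_dist n r (fst z) (snd z) powr p)"
    "(\<integral>z. lr_dist n r (fst z) (snd z) powr p \<partial>(gaussn n s \<Otimes>\<^sub>M gaussn n t)) =
      (s\<^sup>2 + t\<^sup>2) powr (p / 2) * (\<integral>x. lr_norm n r x powr p \<partial>gaussn n 1)"
proof -
  let ?d = "\<lambda>z. \<lambda>i\<in>{..<n}. fst z i - snd z i"
  have c: "?d \<in> gaussn n s \<Otimes>\<^sub>M gaussn n t \<rightarrow>\<^sub>M Rn n"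
  proof -
    have "(\<lambda>z. fst z i) \<in> borel_measurable (Rn n \<Otimes>\<^sub>M Rn n)" "(\<lambda>z. snd z i) \<in> borel_measurable (Rn n \<Otimes>\<^sub>M Rn n)"
      if "i < n" for i
      using measurable_compose[OF measurable_fst measurable_component_Rn[OF that], of "Rn n"]
        measurable_compose[OF measurable_snd measurable_component_Rn[OF that], of "Rn n"] by auto
    then have d: "?d \<in> Rn n \<Otimes>\<^sub>M Rn n \<rightarrow>\<^sub>M Pi\<^sub>M {..<n} (\<lambda>_. borel)"
      by (intro measurable_restrict borel_measurable_diff) auto
    have "sets (gaussn n s \<Otimes>\<^sub>M gaussn n t) = sets (Rn n \<Otimes>\<^sub>M Rn n)"
      by (intro sets_pair_measure_cong) auto
    from measurable_cong_sets[OF this refl] d show ?thesis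
      unfolding Rn_def[of n, symmetric] by blast
  qed
  have f: "(\<lambda>x. lr_norm n r x powr p) \<in> borel_measurable (Rn n)"
    using measurable_lr_norm[of n r] by simp
  have e: "lr_norm n r (?d z) = lr_dist n r (fst z) (snd z)" for z
    by (simp add: lr_dist_def lr_norm_def)
  define \<sigma> where "\<sigma> = sqrt (s\<^sup>2 + t\<^sup>2)"
  have s0: "0 < s\<^sup>2 + t\<^sup>2" using st by (simp add: add_pos_pos)
  then have \<sigma>: "0 < \<sigma>" by (simp add: \<sigma>_def)
  have \<sigma>p: "\<sigma> powr p = (s\<^sup>2 + t\<^sup>2) powr (p / 2)"
    using s0 by (simp add: \<sigma>_def powr_half_sqrt[symmetric] powr_powr)
  have d: "distr (gaussn n s \<Otimes>\<^sub>M gaussn n t) (Rn n) ?d = gaussn n \<sigma>"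
    unfolding \<sigma>_def by (rule distr_gaussn_diff[OF st])
  show "integrable (gaussn n s \<Otimes>\<^sub>M gaussn n t) (\<lambda>z. lr_dist n r (fst z) (snd z) powr p)"
    using integral_gaussn_lr_norm(1)[OF r p \<sigma>, of n] unfolding d[symmetric] integrable_distr_eq[OF c f] e .
  show "(\<integral>z. lr_dist n r (fst z) (snd z) powr p \<partial>(gaussn n s \<Otimes>\<^sub>M gaussn n t)) =
      (s\<^sup>2 + t\<^sup>2) powr (p / 2) * (\<integral>x. lr_norm n r x powr p \<partial>gaussn n 1)"
    using integral_gaussn_lr_norm(2)[OF r p \<sigma>, of n] unfolding d[symmetric] integral_distr[OF c f] e \<sigma>p .
qed

section \<open>Exponential moments and the clipping error\<close>

lemma integral_gauss_exp_square:
  "integrable (gauss 1) (\<lambda>x. exp (x\<^sup>2 / 4))" "(\<integral>x. exp (x\<^sup>2 / 4) \<partial>gauss 1) = sqrt 2"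
proof -
  \<comment> \<open>The exponents \<open>- x^2/2\<close> and \<open>x^2/4\<close> add up to that of
    variance 2; the normalizations differ by \<open>sqrt 2\<close>.\<close>
  have e: "normal_density 0 1 x * exp (x\<^sup>2 / 4) = sqrt 2 * normal_density 0 (sqrt 2) x" for x :: real
  proof -
    have "exp (- x\<^sup>2 / 2) * exp (x\<^sup>2 / 4) = exp (- x\<^sup>2 / 4)"
      by (simp flip: exp_add)
    then show ?thesis
      by (simp add: normal_density_def real_sqrt_mult field_simps)
  qed
  show "integrable (gauss 1) (\<lambda>x. exp (x\<^sup>2 / 4))"
    unfolding gauss_def by (subst integrable_density) (simp_all add: e)
  show "(\<integral>x. exp (x\<^sup>2 / 4) \<partial>gauss 1) = sqrt 2"
    unfolding gauss_def by (subst integral_density) (simp_all add: e)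
qed

text \<open>Scaling to unit variance turns the exponent into at most a quarter of the squared norm,
  whose exponential moment is a product of \<open>n\<close> factors \<open>sqrt 2\<close>.\<close>

lemma integral_gaussn_exp_square_le:
  assumes \<sigma>: "0 < \<sigma>" and a: "0 \<le> a" "a * \<sigma>\<^sup>2 \<le> 1 / 4"
  shows "integrable (gaussn n \<sigma>) (\<lambda>x. exp (a * (\<Sum>i<n. (x i)\<^sup>2)))"
    "(\<integral>x. exp (a * (\<Sum>i<n. (x i)\<^sup>2)) \<partial>gaussn n \<sigma>) \<le> 2 ^ n"
proof -
  interpret product_sigma_finite "\<lambda>_::nat. gauss 1"
    by (simp add: product_sigma_finite_def prob_space_imp_sigma_finite prob_space_gauss)
  have E: "exp ((\<Sum>i<n. (x i)\<^sup>2) / 4) = (\<Prod>i<n. exp ((x i)\<^sup>2 / 4))" for x :: "nat \<Rightarrow> real"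
    by (simp add: exp_sum sum_divide_distrib)
  have i1: "integrable (gaussn n 1) (\<lambda>x. exp ((\<Sum>i<n. (x i)\<^sup>2) / 4))"
    unfolding E gaussn_def using integral_gauss_exp_square(1)
    by (intro product_integrable_prod) auto
  have I1: "(\<integral>x. exp ((\<Sum>i<n. (x i)\<^sup>2) / 4) \<partial>gaussn n 1) = sqrt 2 ^ n"
    unfolding E gaussn_def using integral_gauss_exp_square
    by (subst product_integral_prod) auto
  have c: "compose {..<n} (\<lambda>x. \<sigma> * x) \<in> gaussn n 1 \<rightarrow>\<^sub>M gaussn n 1"
    using measurable_compose_scale[of n \<sigma>] by (simp cong: measurable_cong_sets)
  have f: "(\<lambda>x. exp (a * (\<Sum>i<n. (x i)\<^sup>2))) \<in> borel_measurable (gaussn n 1)"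
  proof -
    have "(\<lambda>x. exp (a * (\<Sum>i<n. (x i)\<^sup>2))) \<in> borel_measurable (Rn n)"
      by (intro borel_measurable_exp[THEN measurable_compose[rotated]] borel_measurable_times
          borel_measurable_const borel_measurable_sum borel_measurable_power measurable_component_Rn) auto
    then show ?thesis by (simp cong: measurable_cong_sets)
  qed
  have le: "exp (a * (\<Sum>i<n. (compose {..<n} (\<lambda>x. \<sigma> * x) x i)\<^sup>2)) \<le> exp ((\<Sum>i<n. (x i)\<^sup>2) / 4)" for x
  proof -
    have "(\<Sum>i<n. (compose {..<n} (\<lambda>x. \<sigma> * x) x i)\<^sup>2) = \<sigma>\<^sup>2 * (\<Sum>i<n. (x i)\<^sup>2)"
      unfolding sum_distrib_left by (intro sum.cong refl) (simp add: compose_def power_mult_distrib)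
    then have "a * (\<Sum>i<n. (compose {..<n} (\<lambda>x. \<sigma> * x) x i)\<^sup>2) = (a * \<sigma>\<^sup>2) * (\<Sum>i<n. (x i)\<^sup>2)" by simp
    also have "\<dots> \<le> 1 / 4 * (\<Sum>i<n. (x i)\<^sup>2)" using a by (intro mult_right_mono sum_nonneg) auto
    finally show ?thesis by simp
  qed
  have i2: "integrable (gaussn n 1) (\<lambda>x. exp (a * (\<Sum>i<n. (compose {..<n} (\<lambda>x. \<sigma> * x) x i)\<^sup>2)))"
    using measurable_compose[OF c f] le by (intro Bochner_Integration.integrable_bound[OF i1]) auto
  show "integrable (gaussn n \<sigma>) (\<lambda>x. exp (a * (\<Sum>i<n. (x i)\<^sup>2)))"
    using i2 unfolding distr_gaussn_scale[OF \<sigma>, of n, symmetric] integrable_distr_eq[OF c f] .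
  have "(\<integral>x. exp (a * (\<Sum>i<n. (x i)\<^sup>2)) \<partial>gaussn n \<sigma>) \<le> sqrt 2 ^ n"
    unfolding distr_gaussn_scale[OF \<sigma>, of n, symmetric] integral_distr[OF c f] I1[symmetric]
    by (rule integral_mono[OF i2 i1]) (rule le)
  also have "\<dots> \<le> 2 ^ n" by (intro power_mono) (auto simp: real_sqrt_le_iff real_le_lsqrt)
  finally show "(\<integral>x. exp (a * (\<Sum>i<n. (x i)\<^sup>2)) \<partial>gaussn n \<sigma>) \<le> 2 ^ n" .
qed

text \<open>If the squared norms \<open>X\<close> and \<open>Y\<close> add up to at most 1, neither
  point is moved. Otherwise the difference is at most \<open>4 n (1 + X + Y)\<close>, and
  \<open>X + Y > 1\<close> allows a factor \<open>e^(-l)\<close> to be bought with a larger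
  exponent, as in a Chernoff bound.\<close>

lemma clip_error_le:
  assumes r: "1 \<le> r" "r \<le> 2" and p: "0 < p" "p < r" and n: "n \<ge> 1" and l: "0 \<le> l"
    and xy: "x \<in> space (Rn n)" "y \<in> space (Rn n)"
  shows "\<bar>lr_dist n r (clip n x) (clip n y) powr p - lr_dist n r x y powr p\<bar> \<le>
    2 * real n * exp (- l) * (exp (2 * (1 + l) * (\<Sum>i<n. (x i)\<^sup>2)) + exp (2 * (1 + l) * (\<Sum>i<n. (y i)\<^sup>2)))"
proof -
  define X where "X = (\<Sum>i<n. (x i)\<^sup>2)"
  define Y where "Y = (\<Sum>i<n. (y i)\<^sup>2)"
  have XY: "0 \<le> X" "0 \<le> Y" by (simp_all add: X_def Y_def sum_nonneg)
  have ball: "x \<in> euclidean_unit_ball n" if "X \<le> 1"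
    using that xy by (simp add: euclidean_unit_ball_def L2_set_def X_def)
  have ball': "y \<in> euclidean_unit_ball n" if "Y \<le> 1"
    using that xy by (simp add: euclidean_unit_ball_def L2_set_def Y_def)
  show ?thesis
  proof (cases "X + Y \<le> 1")
    case True
    then have "clip n x = x" "clip n y = y"
      using XY ball ball' by (auto simp: clip_def)
    then show ?thesis by simp
  next
    case False
    define F where "F = lr_dist n r x y powr p"
    define G where "G = lr_dist n r (clip n x) (clip n y) powr p"
    have n1: "1 \<le> real n" using n by simp
    have pr: "0 \<le> p / r" "p / r \<le> 1" using p r by auto
    have "G \<le> (real n * 2 powr r) powr (p / r)"
      unfolding G_def using r p clip_in_unit_ball by (intro lr_dist_powr_bounded) auto
    also have "\<dots> \<le> (real n * 4) powr 1"
    proof -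
      have "2 powr r \<le> 2 powr (2::real)" using r by (intro powr_mono) auto
      then have "(real n * 2 powr r) powr (p / r) \<le> (real n * 4) powr (p / r)"
        using pr n1 by (intro powr_mono2 mult_left_mono) auto
      also have "\<dots> \<le> (real n * 4) powr 1" using pr n1 by (intro powr_mono) auto
      finally show ?thesis .
    qed
    finally have G: "G \<le> 4 * real n" by simp
    have "F = (\<Sum>i<n. \<bar>x i - y i\<bar> powr r) powr (p / r)"
      unfolding F_def using r by (intro lr_dist_powr) simp
    also have "\<dots> \<le> 1 + (\<Sum>i<n. \<bar>x i - y i\<bar> powr r) powr 1"
      using pr by (intro powr_le_one_plus) (auto simp: sum_nonneg)
    also have "(\<Sum>i<n. \<bar>x i - y i\<bar> powr r) powr 1 = (\<Sum>i<n. \<bar>x i - y i\<bar> powr r)"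
      by (simp add: sum_nonneg)
    also have "\<dots> \<le> (\<Sum>i<n. 1 + (2 * (x i)\<^sup>2 + 2 * (y i)\<^sup>2))"
    proof (rule sum_mono)
      fix i
      have "\<bar>x i - y i\<bar> powr r \<le> 1 + \<bar>x i - y i\<bar> powr 2"
        using r by (intro powr_le_one_plus) auto
      also have "\<bar>x i - y i\<bar> powr 2 = (x i - y i)\<^sup>2"
        by (cases "x i = y i") (simp_all add: powr_numeral)
      also have "(x i - y i)\<^sup>2 \<le> 2 * (x i)\<^sup>2 + 2 * (y i)\<^sup>2"
        using zero_le_power2[of "x i + y i"] by (simp add: power2_eq_square algebra_simps)
      finally show "\<bar>x i - y i\<bar> powr r \<le> 1 + (2 * (x i)\<^sup>2 + 2 * (y i)\<^sup>2)" by simp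
    qed
    also have "\<dots> = real n + 2 * X + 2 * Y"
      by (simp add: sum.distrib X_def Y_def sum_distrib_left)
    finally have F: "F \<le> 1 + (real n + 2 * X + 2 * Y)" by simp
    have "0 \<le> F" "0 \<le> G" by (simp_all add: F_def G_def)
    then have "G - F \<le> 4 * real n + (2 * X + 2 * Y)" "F - G \<le> 4 * real n + (2 * X + 2 * Y)"
      using F G n1 XY by linarith+
    then have "\<bar>G - F\<bar> \<le> 4 * real n + 2 * (X + Y)" by (simp add: abs_le_iff distrib_left)
    also have "\<dots> \<le> 4 * real n * (1 + (X + Y))"
    proof -
      have "4 * N + 2 * Z \<le> 4 * N * (1 + Z)" if "1 \<le> N" "0 \<le> Z" for N Z :: real
      proof -
        have "1 * Z \<le> N * Z" using that by (intro mult_right_mono)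
        moreover have "4 * N * (1 + Z) = 4 * N + 4 * (N * Z)" by (simp add: algebra_simps)
        ultimately show ?thesis using that by linarith
      qed
      from this[OF n1 add_nonneg_nonneg[OF XY]] show ?thesis .
    qed
    also have "\<dots> \<le> 4 * real n * exp ((1 + l) * (X + Y) - l)"
    proof (rule mult_left_mono)
      have "l * 1 \<le> l * (X + Y)" using False l by (intro mult_left_mono) auto
      then have "X + Y \<le> (1 + l) * (X + Y) - l" by (simp add: distrib_right)
      then have "exp (X + Y) \<le> exp ((1 + l) * (X + Y) - l)" by simp
      then show "1 + (X + Y) \<le> exp ((1 + l) * (X + Y) - l)"
        using exp_ge_add_one_self[of "X + Y"] by linarith
    qed simp
    also have "exp ((1 + l) * (X + Y) - l) = exp (- l) * (exp ((1 + l) * X) * exp ((1 + l) * Y))"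
      by (simp flip: exp_add) (simp add: algebra_simps)
    also have "4 * real n * (exp (- l) * (exp ((1 + l) * X) * exp ((1 + l) * Y))) =
        2 * real n * exp (- l) * (2 * exp ((1 + l) * X) * exp ((1 + l) * Y))" by simp
    \<comment> \<open>The inequality \<open>2 a b <= a^2 + b^2\<close> separates \<open>x\<close>
      from \<open>y\<close>, so that only marginals need to be integrated; this doubles the
      exponent.\<close>
    also have "\<dots> \<le> 2 * real n * exp (- l) * (exp (2 * (1 + l) * X) + exp (2 * (1 + l) * Y))"
    proof (rule mult_left_mono)
      have "exp (2 * (1 + l) * Z) = (exp ((1 + l) * Z))\<^sup>2" for Z
        by (simp flip: exp_double)
      then show "2 * exp ((1 + l) * X) * exp ((1 + l) * Y) \<le> exp (2 * (1 + l) * X) + exp (2 * (1 + l) * Y)"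
        using sum_squares_bound[of "exp ((1 + l) * X)" "exp ((1 + l) * Y)"] by simp
    qed simp
    finally show ?thesis unfolding X_def Y_def F_def G_def .
  qed
qed

text \<open>The smallness conditions on \<open>s\<close> and \<open>t\<close> are the range in which
  the exponential moments from \<open>clip_error_le\<close> are at most \<open>2 ^ n\<close>; the
  error is \<open>2 n e^(-l)\<close> times two such moments.\<close>

lemma clip_energy_error:
  assumes r: "1 \<le> r" "r \<le> 2" and p: "0 < p" "p < r" and n: "n \<ge> 1" and l: "0 \<le> l"
    and s: "0 < s" "2 * (1 + l) * s\<^sup>2 \<le> 1 / 4" and t: "0 < t" "2 * (1 + l) * t\<^sup>2 \<le> 1 / 4"
  shows "\<bar>(\<integral>y. \<integral>x. lr_dist n r (clip n x) (clip n y) powr p \<partial>gaussn n s \<partial>gaussn n t)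
      - (s\<^sup>2 + t\<^sup>2) powr (p / 2) * (\<integral>x. lr_norm n r x powr p \<partial>gaussn n 1)\<bar> \<le> 4 * real n * exp (- l) * 2 ^ n"
proof -
  interpret s: prob_space "gaussn n s" by (rule prob_space_gaussn[OF s(1)])
  interpret t: prob_space "gaussn n t" by (rule prob_space_gaussn[OF t(1)])
  interpret P: pair_prob_space "gaussn n t" "gaussn n s" ..
  let ?P = "gaussn n t \<Otimes>\<^sub>M gaussn n s"
  let ?M = "restrict_space (Rn n) (euclidean_unit_ball n)"
  let ?F = "\<lambda>z. lr_dist n r (fst z) (snd z) powr p"
  let ?G = "\<lambda>z. lr_dist n r (clip n (fst z)) (clip n (snd z)) powr p"
  let ?e = "\<lambda>x. exp (2 * (1 + l) * (\<Sum>i<n. (x i)\<^sup>2))"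
  have r0: "0 < r" "r \<le> 4" and pr: "0 < p" "p \<le> r" using r p by auto
  note F = integral_gaussn_lr_dist[OF r0 pr t(1) s(1), of n]
  have clipm: "clip n \<in> gaussn n t \<rightarrow>\<^sub>M ?M" "clip n \<in> gaussn n s \<rightarrow>\<^sub>M ?M"
    using measurable_clip[of n] by (simp_all cong: measurable_cong_sets)
  have d: "(\<lambda>(x, y). lr_dist n r x y) \<in> borel_measurable (?M \<Otimes>\<^sub>M ?M)"
    by (intro measurable_lr_dist measurable_component_restrict_Rn)
  have c: "(\<lambda>z. (clip n (fst z), clip n (snd z))) \<in> ?P \<rightarrow>\<^sub>M ?M \<Otimes>\<^sub>M ?M"
    by (intro measurable_Pair measurable_compose[OF measurable_fst clipm(1)]
        measurable_compose[OF measurable_snd clipm(2)])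
  have Gm: "?G \<in> borel_measurable ?P"
    using powr_real_measurable[OF measurable_compose[OF c d] borel_measurable_const[of p]] by simp
  have G: "integrable ?P ?G"
    by (rule P.integrable_const_bound[OF AE_I2 Gm, of "(real n * 2 powr r) powr (p / r)"])
      (use lr_dist_powr_bounded[OF r0(1) p(1)] clip_in_unit_ball in auto)
  have "(\<integral>y. \<integral>x. lr_dist n r (clip n x) (clip n y) powr p \<partial>gaussn n s \<partial>gaussn n t) = (\<integral>z. ?G z \<partial>?P)"
    using P.integral_fst[of "\<lambda>y x. lr_dist n r (clip n y) (clip n x) powr p"] G
    by (simp add: split_beta' lr_dist_commute[of n r "clip n _" "clip n _"])
  moreover have "(s\<^sup>2 + t\<^sup>2) powr (p / 2) * (\<integral>x. lr_norm n r x powr p \<partial>gaussn n 1) = (\<integral>z. ?F z \<partial>?P)"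
    using F(2) by (simp add: add.commute)
  moreover have "\<bar>(\<integral>z. ?G z \<partial>?P) - (\<integral>z. ?F z \<partial>?P)\<bar> \<le> 4 * real n * exp (- l) * 2 ^ n"
  proof -
    have et: "integrable (gaussn n t) ?e" "(\<integral>x. ?e x \<partial>gaussn n t) \<le> 2 ^ n"
      using integral_gaussn_exp_square_le[OF t(1) _ t(2), of n] l by auto
    have es: "integrable (gaussn n s) ?e" "(\<integral>x. ?e x \<partial>gaussn n s) \<le> 2 ^ n"
      using integral_gaussn_exp_square_le[OF s(1) _ s(2), of n] l by auto
    note mt = integral_pair_marginal(1,2)[OF t.prob_space_axioms s.prob_space_axioms et(1)]
    note ms = integral_pair_marginal(3,4)[OF t.prob_space_axioms s.prob_space_axioms es(1)]
    let ?B = "\<lambda>z. 2 * real n * exp (- l) * (?e (fst z) + ?e (snd z))"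
    have B: "integrable ?P ?B"
      by (rule integrable_mult_right[OF Bochner_Integration.integrable_add[OF mt(1) ms(1)]])
    have "\<bar>(\<integral>z. ?G z \<partial>?P) - (\<integral>z. ?F z \<partial>?P)\<bar> = \<bar>\<integral>z. ?G z - ?F z \<partial>?P\<bar>"
      using G F(1) by simp
    also have "\<dots> \<le> (\<integral>z. \<bar>?G z - ?F z\<bar> \<partial>?P)" by (rule integral_abs_bound)
    also have "\<dots> \<le> (\<integral>z. ?B z \<partial>?P)"
    proof (rule integral_mono[OF _ B])
      show "integrable ?P (\<lambda>z. \<bar>?G z - ?F z\<bar>)"
        using G F(1) by (intro integrable_abs Bochner_Integration.integrable_diff)
      fix z assume "z \<in> space ?P"
      then have "fst z \<in> space (Rn n)" "snd z \<in> space (Rn n)" by (auto simp: space_pair_measure)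
      then show "\<bar>?G z - ?F z\<bar> \<le> ?B z" by (rule clip_error_le[OF r p n l])
    qed
    also have "\<dots> = 2 * real n * exp (- l) * ((\<integral>x. ?e x \<partial>gaussn n t) + (\<integral>x. ?e x \<partial>gaussn n s))"
      unfolding integral_mult_right_zero Bochner_Integration.integral_add[OF mt(1) ms(1)] mt(2) ms(2) ..
    also have "\<dots> \<le> 2 * real n * exp (- l) * (2 ^ n + 2 ^ n)"
      using et(2) es(2) by (intro mult_left_mono add_mono) auto
    finally show ?thesis by simp
  qed
  ultimately show ?thesis by simp
qed

section \<open>Energies of signed mixtures\<close>

lemma signed_integral_cong:
  "(\<And>x. x \<in> space M \<Longrightarrow> f x = g x) \<Longrightarrow> signed_integral M \<mu> f = signed_integral M \<mu> g"
  unfolding signed_integral_def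
  by (intro arg_cong2[of _ _ _ _ minus] Bochner_Integration.integral_cong refl) auto

text \<open>\<open>signed_integral_combination\<close> is used twice, for the inner variable with
  \<open>y\<close> fixed and then for the bounded function \<open>h\<close> of \<open>y\<close> that
  results. Thus the Jordan decomposition of the combination never has to be identified.\<close>

lemma energy_combination:
  fixes \<nu> :: "'i \<Rightarrow> (nat \<Rightarrow> real) measure"
  assumes K: "K \<subseteq> space (Rn n)" and I: "finite I"
    and \<nu>: "\<And>i. i \<in> I \<Longrightarrow> prob_space (\<nu> i)" "\<And>i. i \<in> I \<Longrightarrow> sets (\<nu> i) = sets (restrict_space (Rn n) K)"
    and dm: "(\<lambda>(x, y). d x y) \<in> borel_measurable (restrict_space (Rn n) K \<Otimes>\<^sub>M restrict_space (Rn n) K)"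
    and db: "\<And>x y. x \<in> K \<Longrightarrow> y \<in> K \<Longrightarrow> d x y powr p \<le> b"
  shows "energy n K d p (\<lambda>A. \<Sum>i\<in>I. c i * measure (\<nu> i) A) =
    (\<Sum>k\<in>I. \<Sum>j\<in>I. c k * c j * (\<integral>y. \<integral>x. d x y powr p \<partial>\<nu> j \<partial>\<nu> k))"
proof -
  define M where "M = restrict_space (Rn n) K"
  have sp: "space M = K" using K by (auto simp: M_def space_restrict_space)
  have sets: "sets (\<nu> i) = sets M" "space (\<nu> i) = K" if "i \<in> I" for i
    using \<nu>(2)[OF that] sets_eq_imp_space_eq[OF \<nu>(2)[OF that]] sp by (auto simp: M_def)
  have fin: "finite_measure (\<nu> i)" if "i \<in> I" for i
    using \<nu>(1)[OF that] by (simp add: prob_space_def)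
  have pm: "(\<lambda>(x, y). d x y powr p) \<in> borel_measurable (M \<Otimes>\<^sub>M M)"
    using powr_real_measurable[OF dm borel_measurable_const[of p]] by (simp add: M_def split_beta')
  have sw: "(\<lambda>(y, x). d x y powr p) \<in> borel_measurable (M \<Otimes>\<^sub>M M)"
    using measurable_compose[OF measurable_pair_swap' pm] by (simp add: split_beta')
  have xm: "(\<lambda>x. d x y powr p) \<in> borel_measurable M" if "y \<in> K" for y
    using measurable_compose[OF measurable_Pair2'[of y M M] pm] that sp by simp
  have inner_m: "(\<lambda>y. \<integral>x. d x y powr p \<partial>\<nu> j) \<in> borel_measurable M" if j: "j \<in> I" for j
  proof -
    interpret finite_measure "\<nu> j" by (rule fin[OF j])
    have "(\<lambda>(y, x). d x y powr p) \<in> borel_measurable (M \<Otimes>\<^sub>M \<nu> j)"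
      using sw by (simp only: measurable_cong_sets[OF sets_pair_measure_cong[OF refl sets(1)[OF j]] refl])
    then show ?thesis by (rule borel_measurable_lebesgue_integral)
  qed
  have inner_b: "\<bar>\<integral>x. d x y powr p \<partial>\<nu> j\<bar> \<le> b" if j: "j \<in> I" and y: "y \<in> K" for j y
  proof -
    interpret prob_space "\<nu> j" by (rule \<nu>(1)[OF j])
    have "integrable (\<nu> j) (\<lambda>x. d x y powr p)"
      by (rule bounded_integrable[OF fin[OF j] sets(1)[OF j] xm[OF y]]) (use db y sp in auto)
    then have "(\<integral>x. d x y powr p \<partial>\<nu> j) \<le> b"
      using db y sets(2)[OF j] by (intro integral_le_const AE_I2) auto
    moreover have "0 \<le> (\<integral>x. d x y powr p \<partial>\<nu> j)"
      by (rule Bochner_Integration.integral_nonneg) simp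
    ultimately show ?thesis by simp
  qed
  define h where "h y = (\<Sum>j\<in>I. c j * (\<integral>x. d x y powr p \<partial>\<nu> j))" for y
  have hm: "h \<in> borel_measurable M"
    unfolding h_def[abs_def] by (intro borel_measurable_sum borel_measurable_times borel_measurable_const inner_m)
  have hb: "\<bar>h y\<bar> \<le> (\<Sum>j\<in>I. \<bar>c j\<bar> * b)" if "y \<in> space M" for y
    unfolding h_def using that sp
    by (intro order.trans[OF sum_abs] sum_mono) (simp only: abs_mult, intro mult_left_mono inner_b, auto)
  have "energy n K d p (\<lambda>A. \<Sum>i\<in>I. c i * measure (\<nu> i) A) =
      signed_integral M (\<lambda>A. \<Sum>i\<in>I. c i * measure (\<nu> i) A) h"
    unfolding energy_def M_def[symmetric]
  proof (rule signed_integral_cong)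
    fix y assume y: "y \<in> space M"
    show "signed_integral M (\<lambda>A. \<Sum>i\<in>I. c i * measure (\<nu> i) A) (\<lambda>x. d x y powr p) = h y"
      unfolding h_def using y sp db
      by (intro signed_integral_combination[OF I fin sets(1) xm, where b = b]) auto
  qed
  also have "\<dots> = (\<Sum>k\<in>I. c k * (\<integral>y. h y \<partial>\<nu> k))"
    by (rule signed_integral_combination[OF I fin sets(1) hm hb])
  also have "\<dots> = (\<Sum>k\<in>I. \<Sum>j\<in>I. c k * c j * (\<integral>y. \<integral>x. d x y powr p \<partial>\<nu> j \<partial>\<nu> k))"
  proof (rule sum.cong[OF refl])
    fix k assume k: "k \<in> I"
    have i: "integrable (\<nu> k) (\<lambda>y. c j * (\<integral>x. d x y powr p \<partial>\<nu> j))" if "j \<in> I" for j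
      by (rule integrable_mult_right, rule bounded_integrable[OF fin[OF k] sets(1)[OF k] inner_m[OF that]])
        (use inner_b[OF that] sp in auto)
    have "(\<integral>y. h y \<partial>\<nu> k) = (\<Sum>j\<in>I. \<integral>y. c j * (\<integral>x. d x y powr p \<partial>\<nu> j) \<partial>\<nu> k)"
      unfolding h_def by (rule Bochner_Integration.integral_sum) (rule i)
    then show "c k * (\<integral>y. h y \<partial>\<nu> k) = (\<Sum>j\<in>I. c k * c j * (\<integral>y. \<integral>x. d x y powr p \<partial>\<nu> j \<partial>\<nu> k))"
      by (simp add: sum_distrib_left mult.assoc)
  qed
  finally show ?thesis .
qed

lemma abs_double_sum_diff_le:
  fixes c :: "'i \<Rightarrow> real"
  assumes "\<And>j k. j \<in> I \<Longrightarrow> k \<in> I \<Longrightarrow> \<bar>A k j - B k j\<bar> \<le> e"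
  shows "\<bar>(\<Sum>k\<in>I. \<Sum>j\<in>I. c k * c j * A k j) - (\<Sum>k\<in>I. \<Sum>j\<in>I. c k * c j * B k j)\<bar> \<le> (\<Sum>j\<in>I. \<bar>c j\<bar>)\<^sup>2 * e"
proof -
  have "(\<Sum>k\<in>I. \<Sum>j\<in>I. c k * c j * A k j) - (\<Sum>k\<in>I. \<Sum>j\<in>I. c k * c j * B k j) =
      (\<Sum>k\<in>I. \<Sum>j\<in>I. c k * c j * (A k j - B k j))"
    by (simp add: sum_subtractf right_diff_distrib)
  also have "\<bar>\<dots>\<bar> \<le> (\<Sum>k\<in>I. \<Sum>j\<in>I. \<bar>c k\<bar> * \<bar>c j\<bar> * e)"
    using assms by (intro order.trans[OF sum_abs] sum_mono) (auto simp: abs_mult intro!: mult_left_mono)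
  also have "\<dots> = (\<Sum>j\<in>I. \<bar>c j\<bar>)\<^sup>2 * e"
  proof -
    have "(\<Sum>j\<in>I. \<bar>c j\<bar>)\<^sup>2 = (\<Sum>k\<in>I. \<Sum>j\<in>I. \<bar>c k\<bar> * \<bar>c j\<bar>)"
      by (simp add: power2_eq_square sum_product)
    then show ?thesis by (simp only: sum_distrib_right)
  qed
  finally show ?thesis .
qed

lemma max_energy_ge_chebyshev:
  assumes r: "1 \<le> r" "r \<le> 2" and p: "0 < p" "p < r" and n: "n \<ge> 1" and v: "1 \<le> v"
  shows "ereal ((1 / (16 * v * (real n)\<^sup>2)) powr (p / 2) * (\<integral>x. lr_norm n r x powr p \<partial>gaussn n 1) *
      (\<Sum>j\<le>n. \<Sum>k\<le>n. coeff (chebyshev n) j * coeff (chebyshev n) k * (real j + real k + 2) powr (p / 2))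
      - 9 ^ n * (4 * real n * exp (1 - real n * v) * 2 ^ n))
    \<le> max_energy p n (euclidean_unit_ball n) (lr_dist n r)"
proof -
  let ?K = "euclidean_unit_ball n"
  let ?M = "restrict_space (Rn n) ?K"
  let ?\<tau> = "coeff (chebyshev n)"
  let ?m = "\<integral>x. lr_norm n r x powr p \<partial>gaussn n 1"
  \<comment> \<open>The largest variance \<open>a * (n + 1)\<close> is at most
    \<open>1 / (8 * v * n)\<close>, so a component has mean squared norm at most
    \<open>1 / (8 * v)\<close>, well inside the ball for large \<open>v\<close>.\<close>
  define a where "a = 1 / (16 * v * (real n)\<^sup>2)"
  have a: "0 < a" using n v by (simp add: a_def)
  \<comment> \<open>The shift \<open>j + 1\<close> keeps the first Gaussian nondegenerate and is the
    source of the \<open>+ 2\<close> in the quadratic form.\<close>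
  define \<sigma> where "\<sigma> j = sqrt (a * (real j + 1))" for j :: nat
  have \<sigma>: "0 < \<sigma> j" "(\<sigma> j)\<^sup>2 = a * (real j + 1)" for j
    using a by (simp_all add: \<sigma>_def)
  define \<nu> where "\<nu> j = distr (gaussn n (\<sigma> j)) ?M (clip n)" for j
  define \<mu> where "\<mu> A = (\<Sum>j\<le>n. ?\<tau> j * measure (\<nu> j) A)" for A
  have clipm: "clip n \<in> gaussn n (\<sigma> j) \<rightarrow>\<^sub>M ?M" for j
    using measurable_clip[of n] by (simp cong: measurable_cong_sets)
  have \<nu>p: "prob_space (\<nu> j)" for j
    unfolding \<nu>_def by (intro prob_space.prob_space_distr prob_space_gaussn \<sigma> clipm)
  have \<nu>s: "sets (\<nu> j) = sets ?M" "space (\<nu> j) = ?K" for j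
    by (simp_all add: \<nu>_def space_unit_ball)
  have Ksub: "?K \<subseteq> space (Rn n)" by (auto simp: euclidean_unit_ball_def)
  have dm: "(\<lambda>(x, y). lr_dist n r x y) \<in> borel_measurable (?M \<Otimes>\<^sub>M ?M)"
    by (intro measurable_lr_dist measurable_component_restrict_Rn)
  have db: "lr_dist n r x y powr p \<le> (real n * 2 powr r) powr (p / r)" if "x \<in> ?K" "y \<in> ?K" for x y
    using that r p by (intro lr_dist_powr_bounded) auto
  have "finite_signed_measure ?M \<mu>"
    unfolding \<mu>_def[abs_def] using \<nu>p \<nu>s(1)
    by (intro finite_signed_measure_combination) (auto simp: prob_space_def)
  moreover have "\<mu> ?K = 1"
  proof -
    have "measure (\<nu> j) ?K = 1" for j using prob_space.prob_space[OF \<nu>p[of j]] \<nu>s(2) by simp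
    then have "\<mu> ?K = poly (chebyshev n) 1"
      by (simp add: \<mu>_def poly_eq_sum_atMost[OF degree_chebyshev_le])
    also have "\<dots> = 1" using poly_chebyshev_cos[of n 0] by simp
    finally show ?thesis .
  qed
  ultimately have \<mu>: "\<mu> \<in> signed_measures_mass_one n ?K" by (simp add: signed_measures_mass_one_def)
  define A where "A k j = (\<integral>y. \<integral>x. lr_dist n r x y powr p \<partial>\<nu> j \<partial>\<nu> k)" for k j
  define B where "B k j = ((\<sigma> j)\<^sup>2 + (\<sigma> k)\<^sup>2) powr (p / 2) * ?m" for k j
  have energy: "energy n ?K (lr_dist n r) p \<mu> = (\<Sum>k\<le>n. \<Sum>j\<le>n. ?\<tau> k * ?\<tau> j * A k j)"
    unfolding \<mu>_def[abs_def] A_def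
    by (rule energy_combination[OF Ksub _ \<nu>p \<nu>s(1) dm db]) auto
  have A: "A k j = (\<integral>y. \<integral>x. lr_dist n r (clip n x) (clip n y) powr p \<partial>gaussn n (\<sigma> j) \<partial>gaussn n (\<sigma> k))" for k j
  proof -
    have pm: "(\<lambda>(x, y). lr_dist n r x y powr p) \<in> borel_measurable (?M \<Otimes>\<^sub>M ?M)"
      using powr_real_measurable[OF dm borel_measurable_const[of p]] by (simp add: split_beta')
    have sw: "(\<lambda>(y, x). lr_dist n r x y powr p) \<in> borel_measurable (?M \<Otimes>\<^sub>M ?M)"
      using measurable_compose[OF measurable_pair_swap' pm] by (simp add: split_beta')
    have "(\<lambda>y. \<integral>x. lr_dist n r x y powr p \<partial>\<nu> j) \<in> borel_measurable ?M"
    proof -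
      interpret prob_space "\<nu> j" by (rule \<nu>p)
      have "(\<lambda>(y, x). lr_dist n r x y powr p) \<in> borel_measurable (?M \<Otimes>\<^sub>M \<nu> j)"
        using sw by (simp only: measurable_cong_sets[OF sets_pair_measure_cong[OF refl \<nu>s(1)] refl])
      then show ?thesis by (rule borel_measurable_lebesgue_integral)
    qed
    then have "A k j = (\<integral>y. \<integral>x. lr_dist n r x (clip n y) powr p \<partial>\<nu> j \<partial>gaussn n (\<sigma> k))"
      unfolding A_def \<nu>_def[of k] by (rule integral_distr[OF clipm])
    also have "\<dots> = (\<integral>y. \<integral>x. lr_dist n r (clip n x) (clip n y) powr p \<partial>gaussn n (\<sigma> j) \<partial>gaussn n (\<sigma> k))"
    proof (rule Bochner_Integration.integral_cong[OF refl])
      fix y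
      have "(\<lambda>x. lr_dist n r x (clip n y) powr p) \<in> borel_measurable ?M"
        using measurable_compose[OF measurable_Pair2'[of "clip n y" ?M ?M] pm] clip_in_unit_ball
        by (simp add: space_unit_ball)
      then show "(\<integral>x. lr_dist n r x (clip n y) powr p \<partial>\<nu> j) =
          (\<integral>x. lr_dist n r (clip n x) (clip n y) powr p \<partial>gaussn n (\<sigma> j))"
        unfolding \<nu>_def by (rule integral_distr[OF clipm])
    qed
    finally show ?thesis .
  qed
  \<comment> \<open>The clipping bound is used with \<open>l = n v - 1\<close>, so
    \<open>1 + l = n v\<close> and its smallness condition becomes
    \<open>(j + 1) / (8 n) <= 1/4\<close>. The factor 16 in \<open>a\<close> makes this hold up to
    \<open>j = n\<close>.\<close>
  have nv: "0 \<le> real n * v - 1"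
  proof -
    have "1 * 1 \<le> real n * v" using n v by (intro mult_mono) auto
    then show ?thesis by simp
  qed
  have small: "2 * (1 + (real n * v - 1)) * (\<sigma> j)\<^sup>2 \<le> 1 / 4" if "j \<le> n" for j
  proof -
    have "2 * (1 + (real n * v - 1)) * (\<sigma> j)\<^sup>2 = (real j + 1) / (8 * real n)"
      unfolding \<sigma>(2) a_def using n v by (simp add: power2_eq_square) (simp add: field_simps)
    also have "\<dots> \<le> (real n + real n) / (8 * real n)"
      using that n by (intro divide_right_mono add_mono) auto
    finally show ?thesis using n by simp
  qed
  have err: "\<bar>A k j - B k j\<bar> \<le> 4 * real n * exp (1 - real n * v) * 2 ^ n" if "j \<in> {..n}" "k \<in> {..n}" for j k
    using clip_energy_error[OF r p n nv \<sigma>(1) small \<sigma>(1) small, of j k] that unfolding A B_def by simp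
  have "\<bar>(\<Sum>k\<le>n. \<Sum>j\<le>n. ?\<tau> k * ?\<tau> j * A k j) - (\<Sum>k\<le>n. \<Sum>j\<le>n. ?\<tau> k * ?\<tau> j * B k j)\<bar>
      \<le> (\<Sum>j\<le>n. \<bar>?\<tau> j\<bar>)\<^sup>2 * (4 * real n * exp (1 - real n * v) * 2 ^ n)"
    by (rule abs_double_sum_diff_le[OF err])
  also have "\<dots> \<le> 9 ^ n * (4 * real n * exp (1 - real n * v) * 2 ^ n)"
  proof (rule mult_right_mono)
    have "(\<Sum>j\<le>n. \<bar>?\<tau> j\<bar>)\<^sup>2 \<le> (3 ^ n)\<^sup>2"
      by (intro power_mono sum_abs_coeff_chebyshev_le sum_nonneg) auto
    also have "(3 ^ n)\<^sup>2 = (9::real) ^ n" by (simp flip: power_mult add: mult.commute[of n])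
        (simp add: power_mult)
    finally show "(\<Sum>j\<le>n. \<bar>?\<tau> j\<bar>)\<^sup>2 \<le> 9 ^ n" .
  qed simp
  finally have "(\<Sum>k\<le>n. \<Sum>j\<le>n. ?\<tau> k * ?\<tau> j * B k j) - 9 ^ n * (4 * real n * exp (1 - real n * v) * 2 ^ n)
      \<le> energy n ?K (lr_dist n r) p \<mu>"
    unfolding energy by linarith
  moreover have "(\<Sum>k\<le>n. \<Sum>j\<le>n. ?\<tau> k * ?\<tau> j * B k j) = a powr (p / 2) * ?m *
      (\<Sum>j\<le>n. \<Sum>k\<le>n. ?\<tau> j * ?\<tau> k * (real j + real k + 2) powr (p / 2))"
    unfolding sum_distrib_left
  proof (intro sum.cong refl)
    fix k j
    have "(\<sigma> j)\<^sup>2 + (\<sigma> k)\<^sup>2 = a * (real k + real j + 2)" by (simp add: \<sigma>(2) algebra_simps)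
    then have "B k j = a powr (p / 2) * (real k + real j + 2) powr (p / 2) * ?m"
      using a by (simp add: B_def powr_mult)
    then show "?\<tau> k * ?\<tau> j * B k j = a powr (p / 2) * ?m * (?\<tau> k * ?\<tau> j * (real k + real j + 2) powr (p / 2))"
      by simp
  qed
  ultimately show ?thesis
    unfolding max_energy_def a_def[symmetric] using \<mu> by (intro SUP_upper2[of \<mu>]) auto
qed

lemma max_energy_lower:
  assumes r: "1 \<le> r" "r \<le> 2" and p: "0 < p" "p < r"
  shows "\<exists>A>0. \<forall>n\<ge>1. ereal (A * real n powr (p / r)) \<le> max_energy p n (euclidean_unit_ball n) (lr_dist n r)"
proof -
  define b where "b = p / 2"
  have b: "0 < b" "b < 1" using p r by (auto simp: b_def)
  obtain c1 where c1: "0 < c1" "\<And>n. n \<ge> 1 \<Longrightarrow> c1 * real n powr (2 * b) \<le>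
    (\<Sum>j\<le>n. \<Sum>k\<le>n. coeff (chebyshev n) j * coeff (chebyshev n) k * (real j + real k + 2) powr b)"
    using chebyshev_quadratic_form_ge[OF b] by blast
  obtain c2 where c2: "0 < c2" "\<And>n. n \<ge> 1 \<Longrightarrow> c2 * real n powr (p / r) \<le> (\<integral>x. lr_norm n r x powr p \<partial>gaussn n 1)"
    using gaussn_lr_norm_ge[of r p] r p by auto
  \<comment> \<open>\<open>432 = 12 * 36\<close>: the error will be at most
    \<open>12 * 36 * e^(-v)\<close> and has to stay below \<open>A\<close>, half the constant of the
    main term. The main term decays in \<open>v\<close> only like \<open>v^(-b)\<close>.\<close>
  have "eventually (\<lambda>v::real. 432 * exp (- v) * (16 * v) powr b < c1 * c2 / 2) at_top"
  proof (rule order_tendstoD(2))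
    show "((\<lambda>v::real. 432 * exp (- v) * (16 * v) powr b) \<longlongrightarrow> 0) at_top"
      using b by real_asymp
  qed (use c1 c2 in simp)
  moreover have "eventually (\<lambda>v::real. 36 * exp (- v) < 1) at_top"
    by real_asymp
  ultimately have "eventually (\<lambda>v::real. 432 * exp (- v) * (16 * v) powr b < c1 * c2 / 2 \<and> 36 * exp (- v) < 1 \<and> 1 \<le> v) at_top"
    using eventually_ge_at_top[of "1::real"] by eventually_elim simp
  then obtain v :: real where v: "432 * exp (- v) * (16 * v) powr b < c1 * c2 / 2" "36 * exp (- v) < 1" "1 \<le> v"
    using eventually_happens'[OF trivial_limit_at_top_linorder] by blast
  define A where "A = c1 * c2 / (2 * (16 * v) powr b)"
  have V: "0 < (16 * v) powr b" using v(3) by simp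
  have A0: "0 < A" using c1 c2 V by (simp add: A_def)
  have "ereal (A * real n powr (p / r)) \<le> max_energy p n (euclidean_unit_ball n) (lr_dist n r)" if n: "n \<ge> 1" for n
  proof -
    let ?Q = "\<Sum>j\<le>n. \<Sum>k\<le>n. coeff (chebyshev n) j * coeff (chebyshev n) k * (real j + real k + 2) powr b"
    let ?m = "\<integral>x. lr_norm n r x powr p \<partial>gaussn n 1"
    have N: "1 \<le> real n powr (p / r)" using n r p by (intro ge_one_powr_ge_zero) auto
    have "9 ^ n * (4 * real n * exp (1 - real n * v) * 2 ^ n) \<le> A * real n powr (p / r)"
    proof -
      \<comment> \<open>Here \<open>4 e <= 12\<close> and \<open>n <= 2 ^ n\<close> reduce
        everything to a power of \<open>36 e^(-v) < 1\<close>, so \<open>n = 1\<close> is the worst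
        case.\<close>
      have "9 ^ n * (4 * real n * exp (1 - real n * v) * 2 ^ n) = 4 * exp 1 * (real n * (18 ^ n * exp (- v) ^ n))"
        by (simp add: exp_diff exp_minus exp_of_nat_mult power_divide power_inverse divide_inverse flip: power_mult_distrib)
      also have "\<dots> \<le> 12 * (2 ^ n * (18 ^ n * exp (- v) ^ n))"
        using e_less_272 of_nat_less_two_power[of n, where 'a=real]
        by (intro mult_mono) auto
      also have "\<dots> = 12 * (36 * exp (- v)) ^ n"
      proof -
        have "36 * exp (- v) = 2 * (18 * exp (- v))" by simp
        then show ?thesis by (simp only: power_mult_distrib)
      qed
      also have "\<dots> \<le> 12 * (36 * exp (- v)) ^ 1"
        using v(2) n by (intro mult_left_mono power_decreasing) auto
      also have "\<dots> \<le> A" using v(1) V by (simp add: A_def field_simps)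
      also have "\<dots> \<le> A * real n powr (p / r)"
        using mult_left_mono[OF N, of A] A0 by simp
      finally show ?thesis .
    qed
    moreover have "2 * A * real n powr (p / r) \<le> (1 / (16 * v * (real n)\<^sup>2)) powr b * ?m * ?Q"
    proof -
      \<comment> \<open>The variance scale contributes \<open>n^(-2b)\<close>, which the Chebyshev
        form of order \<open>n^(2b)\<close> cancels; the order \<open>n^(p/r)\<close> is that of the
        Gaussian moment.\<close>
      have e: "(1 / (16 * v * (real n)\<^sup>2)) powr b = 1 / ((16 * v) powr b * real n powr (2 * b))"
        using n v(3) by (simp add: powr_divide powr_mult powr_powr flip: powr_numeral)
      have "2 * A * real n powr (p / r) = (1 / ((16 * v) powr b * real n powr (2 * b))) * (c2 * real n powr (p / r)) * (c1 * real n powr (2 * b))"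
        using n by (simp add: A_def)
      also have "\<dots> \<le> (1 / ((16 * v) powr b * real n powr (2 * b))) * ?m * ?Q"
      proof (rule mult_mono)
        show "c1 * real n powr (2 * b) \<le> ?Q" by (rule c1(2)[OF n])
        show "(1 / ((16 * v) powr b * real n powr (2 * b))) * (c2 * real n powr (p / r)) \<le> (1 / ((16 * v) powr b * real n powr (2 * b))) * ?m"
          by (rule mult_left_mono[OF c2(2)[OF n]]) simp
        show "0 \<le> (1 / ((16 * v) powr b * real n powr (2 * b))) * ?m"
          by (intro mult_nonneg_nonneg Bochner_Integration.integral_nonneg) auto
      qed (use c1(1) in simp)
      finally show ?thesis unfolding e .
    qed
    ultimately have "A * real n powr (p / r) \<le> (1 / (16 * v * (real n)\<^sup>2)) powr b * ?m * ?Q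
        - 9 ^ n * (4 * real n * exp (1 - real n * v) * 2 ^ n)" by linarith
    then have "ereal (A * real n powr (p / r)) \<le> ereal ((1 / (16 * v * (real n)\<^sup>2)) powr b * ?m * ?Q
        - 9 ^ n * (4 * real n * exp (1 - real n * v) * 2 ^ n))" by simp
    also have "\<dots> \<le> max_energy p n (euclidean_unit_ball n) (lr_dist n r)"
      unfolding b_def by (rule max_energy_ge_chebyshev[OF r p n v(3)])
    finally show ?thesis .
  qed
  then show ?thesis using A0 by blast
qed

theorem theorem2p6:
  fixes p r :: real
  assumes "1 \<le> r" "r \<le> 2" "0 < p" "p < r"
  shows "\<exists>A B :: real. A > 0 \<and> B > 0 \<and>
    (\<forall>n :: nat. n \<ge> 1 \<longrightarrow>
       ereal (A * real n powr (p / r)) \<le> max_energy p n (euclidean_unit_ball n) (lr_dist n r) \<and>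
       max_energy p n (euclidean_unit_ball n) (lr_dist n r) \<le> ereal (B * real n powr (p / r)))"
proof -
  have "\<exists>B>0. \<forall>n\<ge>1. max_energy p n (euclidean_unit_ball n) (lr_dist n r) \<le> ereal (B * real n powr (p / r))"
    using max_energy_upper_less_2[of r p] max_energy_upper_2[of p] assms by (cases "r < 2") auto
  then show ?thesis using max_energy_lower[of r p] assms by blast
qed

end
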